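(* Let $\Omega_1,\Omega_2\subset\mathbb{C}^n$ be bounded domains. A proper holomorphic map $f:\Omega_1\to\Omega_2$ is a biholomorphism if and only if $f$ is sufficient for the Bergman statistical model $\Phi_1:\Omega_1\to\mathcal{P}(\Omega_1,dV)$.
   Context: $dV$ is Lebesgue measure. For a measurable space $\Xi$ with reference measure $\mu_0$, $\mathcal{P}(\Xi,\mu_0)$ is the set of probability measures $\phi\mu_0$ with $\phi\in L^1(\Xi,\mu_0)$, $\phi>0$ $\mu_0$-a.e. Bergman statistical model of $\Omega_1$: $\Phi_1(z)=P_1(z,\xi)\,dV(\xi)$, $P_1(z,\xi)=\frac{|\mathcal{B}_1(z,\xi)|^2}{\mathcal{B}_1(z,z)}$, where $\mathcal{B}_1$ is the Bergman kernel of $\Omega_1$ (reproducing kernel of the space of $L^2$ holomorphic functions). It is Fréchet $C^1$ with derivative $d\Phi_1(V)=\partial_VP_1(z,\cdot)\,dV$. Fisher information metric at a probability measure $\mu$: $(g_F)_\mu(\sigma_1,\sigma_2)=\int\frac{d\sigma_1}{d\mu}\frac{d\sigma_2}{d\mu}\,d\mu$ for (signed) measures $\sigma_1,\sigma_2\ll\mu$ of total mass $0$. The map $f$ induces the push-forward $\kappa(\mu)(B)=\mu(f^{-1}(B))$ of (signed) measures, mapping $\mathcal{P}(\Omega_1,dV)$ to $\mathcal{P}(\Omega_2,\kappa(dV))$. Let $g_{F_1},g_{F_2}$ be the Fisher information metrics on these two spaces. $f$ is sufficient for $\Phi_1$ if for all $x\in\Omega_1$, $V\in T_x\Omega_1$,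 $$(g_{F_2})_{\kappa(\Phi_1(x))}\big(\kappa(d\Phi_1(V)),\kappa(d\Phi_1(V))\big)=(g_{F_1})_{\Phi_1(x)}\big(d\Phi_1(V),d\Phi_1(V)\big).$$ *)

theory Defs
  imports "HOL-Analysis.Analysis"
begin

section \<open>Holomorphic maps in several complex variables\<close>

definition bounded_domain :: "'a::real_normed_vector set \<Rightarrow> bool"
  where "bounded_domain \<Omega> \<longleftrightarrow> open \<Omega> \<and> connected \<Omega> \<and> \<Omega> \<noteq> {} \<and> bounded \<Omega>"

definition holomorphic_fun_on :: "(complex ^ 'n::finite \<Rightarrow> complex) \<Rightarrow> (complex ^ 'n) set \<Rightarrow> bool"
  where "holomorphic_fun_on h \<Omega> \<longleftrightarrow>
    (\<forall>z\<in>\<Omega>. \<exists>h'. (h has_derivative h') (at z) \<and> (\<forall>c v. h' (c *s v) = c * h' v))"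

definition holomorphic_map_on ::
    "(complex ^ 'n::finite \<Rightarrow> complex ^ 'm::finite) \<Rightarrow> (complex ^ 'n) set \<Rightarrow> bool"
  where "holomorphic_map_on f \<Omega> \<longleftrightarrow> (\<forall>i. holomorphic_fun_on (\<lambda>z. f z $ i) \<Omega>)"

definition biholomorphism ::
    "(complex ^ 'n::finite) set \<Rightarrow> (complex ^ 'm::finite) set \<Rightarrow> (complex ^ 'n \<Rightarrow> complex ^ 'm) \<Rightarrow> bool"
  where "biholomorphism \<Omega>1 \<Omega>2 f \<longleftrightarrow>
    bij_betw f \<Omega>1 \<Omega>2 \<and> holomorphic_map_on f \<Omega>1 \<and> holomorphic_map_on (inv_into \<Omega>1 f) \<Omega>2"


section \<open>The Bergman kernel\<close>

text \<open>Lebesgue measure on the Borel sets of \<open>\<Omega>\<close>. The Borel sigma-algebra is used, rather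
  than its completion, so that continuous maps are measurable and push-forwards make sense.\<close>

definition dV :: "'a::euclidean_space set \<Rightarrow> 'a measure"
  where "dV \<Omega> = restrict_space lborel \<Omega>"

definition bergman_space :: "(complex ^ 'n::finite) set \<Rightarrow> (complex ^ 'n \<Rightarrow> complex) set"
  where "bergman_space \<Omega> =
    {h. holomorphic_fun_on h \<Omega> \<and> integrable (dV \<Omega>) (\<lambda>\<xi>. (cmod (h \<xi>))\<^sup>2)}"

text \<open>\<open>bergman_kernel \<Omega> z w\<close> is the value at \<open>z\<close> of the element of the Bergman space that
  represents evaluation at \<open>w\<close>. For \<open>z, w \<in> \<Omega>\<close> this value is unique, since two representing elements
  agree on \<open>\<Omega>\<close>; elsewhere it is unspecified (and never used).\<close>

definition bergman_kernel :: "(complex ^ 'n::finite) set \<Rightarrow> complex ^ 'n \<Rightarrow> complex ^ 'n \<Rightarrow> complex"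
  where "bergman_kernel \<Omega> z w =
    (SOME g. g \<in> bergman_space \<Omega> \<and>
       (\<forall>h\<in>bergman_space \<Omega>. h w = (\<integral>\<xi>. h \<xi> * cnj (g \<xi>) \<partial>dV \<Omega>))) z"


section \<open>Fisher information metric\<close>

text \<open>Finite signed measures are represented by their real-valued set functions, which only matter
  on measurable sets. The density below is determined almost everywhere
  whenever \<open>\<sigma>\<close> is a finite signed measure absolutely continuous with respect to a
  finite measure \<open>\<mu>\<close>.\<close>

definition signed_RN_deriv :: "'a measure \<Rightarrow> ('a set \<Rightarrow> real) \<Rightarrow> 'a \<Rightarrow> real"
  where "signed_RN_deriv \<mu> \<sigma> =
    (SOME d. integrable \<mu> d \<and> (\<forall>A\<in>sets \<mu>. \<sigma> A = (LINT \<xi>:A|\<mu>. d \<xi>)))"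

definition fisher_metric :: "'a measure \<Rightarrow> ('a set \<Rightarrow> real) \<Rightarrow> ('a set \<Rightarrow> real) \<Rightarrow> real"
  where "fisher_metric \<mu> \<sigma>1 \<sigma>2 =
    (\<integral>\<xi>. signed_RN_deriv \<mu> \<sigma>1 \<xi> * signed_RN_deriv \<mu> \<sigma>2 \<xi> \<partial>\<mu>)"

text \<open>The analogue of \<^const>\<open>distr\<close> for signed measures on \<open>space M\<close>.\<close>

definition signed_distr :: "'a measure \<Rightarrow> ('a \<Rightarrow> 'b) \<Rightarrow> ('a set \<Rightarrow> real) \<Rightarrow> ('b set \<Rightarrow> real)"
  where "signed_distr M f \<sigma> = (\<lambda>B. \<sigma> (f -` B \<inter> space M))"

text \<open>A statistical model on an open set \<open>X\<close> is given by \<open>\<Phi>\<close> together with its derivative, where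
  \<open>d\<Phi> x V\<close> is the signed measure obtained by differentiating at \<open>x\<close> in direction \<open>V\<close>. The
  statistic \<open>f\<close> takes values in the measurable space \<open>N\<close>; only the sigma-algebra of \<open>N\<close>
  matters.\<close>

definition sufficient_for ::
    "'x set \<Rightarrow> ('x \<Rightarrow> 'a measure) \<Rightarrow> ('x \<Rightarrow> 'x \<Rightarrow> 'a set \<Rightarrow> real) \<Rightarrow> 'b measure \<Rightarrow> ('a \<Rightarrow> 'b) \<Rightarrow> bool"
  where "sufficient_for X \<Phi> d\<Phi> N f \<longleftrightarrow>
    (\<forall>x\<in>X. \<forall>V.
       fisher_metric (distr (\<Phi> x) N f)
         (signed_distr (\<Phi> x) f (d\<Phi> x V)) (signed_distr (\<Phi> x) f (d\<Phi> x V))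
       = fisher_metric (\<Phi> x) (d\<Phi> x V) (d\<Phi> x V))"


section \<open>The Bergman statistical model\<close>

text \<open>The diagonal value \<open>bergman_kernel \<Omega> z z\<close> is the squared norm of the representing element,
  hence real; \<^const>\<open>Re\<close> only changes its type.\<close>

definition bergman_density :: "(complex ^ 'n::finite) set \<Rightarrow> complex ^ 'n \<Rightarrow> complex ^ 'n \<Rightarrow> real"
  where "bergman_density \<Omega> z \<xi> = (cmod (bergman_kernel \<Omega> z \<xi>))\<^sup>2 / Re (bergman_kernel \<Omega> z z)"

definition bergman_model :: "(complex ^ 'n::finite) set \<Rightarrow> complex ^ 'n \<Rightarrow> (complex ^ 'n) measure"
  where "bergman_model \<Omega> z = density (dV \<Omega>) (\<lambda>\<xi>. ennreal (bergman_density \<Omega> z \<xi>))"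

text \<open>Tangent vectors are real: \<open>V\<close> ranges over the underlying real vector space, and the
  derivative in \<open>z\<close> is the real Frechet derivative.\<close>

definition bergman_model_deriv ::
    "(complex ^ 'n::finite) set \<Rightarrow> complex ^ 'n \<Rightarrow> complex ^ 'n \<Rightarrow> (complex ^ 'n) set \<Rightarrow> real"
  where "bergman_model_deriv \<Omega> z V A =
    (LINT \<xi>:A|dV \<Omega>. frechet_derivative (\<lambda>w. bergman_density \<Omega> w \<xi>) (at z) V)"

end

theory Submission
  imports Defs "HOL-Complex_Analysis.Complex_Analysis"
begin

text \<open>Let \<open>d = \<partial>\<^sub>V ln P\<^sub>1(z, \<cdot>)\<close> be the score of the Bergman model. Pushing forward replaces \<open>d\<close> by its
  conditional expectation given \<open>f\<close>, an orthogonal projection in \<open>L\<^sup>2\<close>; so \<open>f\<close> is sufficient if and only if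
  every score is almost everywhere a function of \<open>f\<close>. This is clear for a biholomorphism.

  Conversely, if \<open>\<xi>\<close> and \<open>\<eta>\<close> are regular points of \<open>f\<close> with \<open>f(\<xi>) = f(\<eta>)\<close>, then, \<open>f\<close> being open near both points,
  all scores agree at \<open>\<xi>\<close> and \<open>\<eta>\<close>. Hence \<open>B\<^sub>1(\<cdot>, \<xi>) = c B\<^sub>1(\<cdot>, \<eta>)\<close>, that is, \<open>h(\<xi>)\<close> is a fixed multiple of \<open>h(\<eta>)\<close>
  for all \<open>h\<close> in the Bergman space; the functions 1 and \<open>z\<^sub>i\<close> give \<open>\<xi> = \<eta>\<close>. So \<open>f\<close> is injective on its regular points.

  It remains to show that such a proper map is a biholomorphism. Where \<open>|f - w|\<^sup>2 - \<epsilon>|z|\<^sup>2\<close> is minimal, its Levi form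
  is nonnegative, so that the point is regular, and the gradient condition makes \<open>|f - w|\<close> small there; this shows that \<open>f\<close> is
  surjective and has regular points. The inverse of \<open>f\<close> on regular values is bounded and extends holomorphically by
  theorems of Rado and Riemann on complex lines.\<close>

section \<open>Rotation invariance of Lebesgue measure\<close>

text \<open>Holomorphy means a complex linear Frechet derivative, while the analysis is done in one
  variable: continuity plus holomorphy on all complex lines is the working criterion. The lines
  through a point are put together by averaging against a radial bump, which is where invariance of
  Lebesgue measure under unit scalars enters. A score factors through \<open>f\<close> only almost
  everywhere, which says nothing about two given points; continuity of the scores and openness of
  \<open>f\<close> near both points are needed, hence the restriction to regular points. A score is
  moreover only a real part; passing from \<open>v\<close> to \<open>\<i> *s v\<close> recovers the
  complex logarithmic derivative of the kernel. The remaining obstacle is the critical set, where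
  neither the fibres nor the continuity of an inverse are under control. The Jacobian gets around
  it: it descends to \<open>\<Omega>2\<close>, and since a proper map is closed, the descended
  function is continuous even where the chosen inverse might jump. Its zeros then form the set
  across which the inverse is extended.\<close>

lemma nn_integral_lborel_translate:
  fixes g :: "'a::euclidean_space \<Rightarrow> ennreal"
  assumes "g \<in> borel_measurable borel"
  shows "(\<integral>\<^sup>+x. g (a + x) \<partial>lborel) = (\<integral>\<^sup>+x. g x \<partial>lborel)"
proof -
  have "(\<integral>\<^sup>+x. g x \<partial>lborel) = (\<integral>\<^sup>+x. g x \<partial>distr lborel borel ((+) a))"
    by (simp add: lborel_distr_plus)
  also have "\<dots> = (\<integral>\<^sup>+x. g (a + x) \<partial>lborel)"
    using assms by (intro nn_integral_distr) auto
  finally show ?thesis by simp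
qed

text \<open>Uniqueness of Haar measure in disguise: Tonelli applied to \<open>1\<^sub>A(Tx) 1\<^sub>B(Tx - y)\<close> with
  \<open>B\<close> the unit ball.\<close>

lemma lborel_distr_linear_isometry:
  fixes T :: "'a::euclidean_space \<Rightarrow> 'a"
  assumes T: "linear T" and iso: "\<And>x. norm (T x) = norm x"
  shows "distr lborel borel T = lborel"
proof (rule measure_eqI)
  have cT: "continuous_on UNIV T"
    using T linear_continuous_on linear_conv_bounded_linear by blast
  have mT [measurable]: "T \<in> borel_measurable borel"
    using cT by (rule borel_measurable_continuous_onI)
  have "inj T"
    using T iso by (metis linear_injective_0 norm_eq_zero)
  then have sT: "surj T"
    using T by (simp add: linear_injective_imp_surjective)
  fix A :: "'a set" assume "A \<in> sets (distr lborel borel T)"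
  then have A [measurable]: "A \<in> sets borel" by simp
  \<comment> \<open>\<open>B\<close> is invariant under \<open>T\<close>; its measure is finite and
    nonzero and cancels at the end.\<close>
  define B where "B = ball (0::'a) 1"
  have B [measurable]: "B \<in> sets borel" by (simp add: B_def)
  have TB: "T x \<in> B \<longleftrightarrow> x \<in> B" for x
    by (simp add: B_def iso)
  have "(\<integral>\<^sup>+y. indicator B (T x - y) \<partial>lborel) = emeasure lborel B" for x
  proof -
    have "(\<integral>\<^sup>+y. indicator B (T x - y) \<partial>lborel) = (\<integral>\<^sup>+y. indicator B (- T x + y) \<partial>lborel)"
    proof (rule nn_integral_cong)
      fix y
      have "norm (T x - y) = norm (- T x + y)"
        by (metis norm_minus_commute uminus_add_conv_diff)
      then show "indicator B (T x - y) = (indicator B (- T x + y)::ennreal)"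
        by (simp add: B_def indicator_def)
    qed
    also have "\<dots> = (\<integral>\<^sup>+y. indicator B y \<partial>lborel)"
      by (rule nn_integral_lborel_translate) simp
    finally show ?thesis by simp
  qed
  then have "emeasure (distr lborel borel T) A * emeasure lborel B
      = (\<integral>\<^sup>+x. indicator A (T x) * (\<integral>\<^sup>+y. indicator B (T x - y) \<partial>lborel) \<partial>lborel)"
    by (simp add: nn_integral_multc nn_integral_distr[of T lborel borel "indicator A", symmetric])
  also have "\<dots> = (\<integral>\<^sup>+x. \<integral>\<^sup>+y. indicator A (T x) * indicator B (T x - y) \<partial>lborel \<partial>lborel)"
    by (simp add: nn_integral_cmult)
  also have "\<dots> = (\<integral>\<^sup>+y. \<integral>\<^sup>+x. indicator A (T x) * indicator B (T x - y) \<partial>lborel \<partial>lborel)"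
    by (rule lborel_pair.Fubini'[symmetric]) measurable
  \<comment> \<open>Translating \<open>x\<close> by a preimage of \<open>y\<close> under
    \<open>T\<close> moves \<open>y\<close> from the ball over to \<open>A\<close>.\<close>
  also have "\<dots> = (\<integral>\<^sup>+y. \<integral>\<^sup>+x. indicator A (T x + y) * indicator B (T x) \<partial>lborel \<partial>lborel)"
  proof (rule nn_integral_cong)
    fix y
    obtain z where z: "T z = y" using sT by (metis surjD)
    have "(\<integral>\<^sup>+x. indicator A (T x) * indicator B (T x - y) \<partial>lborel)
        = (\<integral>\<^sup>+x. indicator A (T (z + x)) * indicator B (T (z + x) - y) \<partial>lborel)"
      by (rule nn_integral_lborel_translate[symmetric]) measurable
    then show "(\<integral>\<^sup>+x. indicator A (T x) * indicator B (T x - y) \<partial>lborel)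
        = (\<integral>\<^sup>+x. indicator A (T x + y) * indicator B (T x) \<partial>lborel)"
      by (simp add: linear_add[OF T] z add.commute)
  qed
  also have "\<dots> = (\<integral>\<^sup>+x. \<integral>\<^sup>+y. indicator A (T x + y) * indicator B (T x) \<partial>lborel \<partial>lborel)"
    by (rule lborel_pair.Fubini') measurable
  also have "\<dots> = (\<integral>\<^sup>+x. emeasure lborel A * indicator B (T x) \<partial>lborel)"
  proof (rule nn_integral_cong)
    fix x
    show "(\<integral>\<^sup>+y. indicator A (T x + y) * indicator B (T x) \<partial>lborel) = emeasure lborel A * indicator B (T x)"
      using nn_integral_lborel_translate[of "indicator A" "T x"]
      by (simp add: nn_integral_multc)
  qed
  also have "\<dots> = emeasure lborel A * emeasure lborel B"
  proof -
    have "(\<lambda>x. indicator B (T x)) = (indicator B :: 'a \<Rightarrow> ennreal)"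
      using TB by (auto simp: indicator_def fun_eq_iff)
    then have "(\<integral>\<^sup>+x. indicator B (T x) \<partial>lborel) = emeasure lborel B"
      by simp
    then show ?thesis by (simp add: nn_integral_cmult)
  qed
  finally have eq: "emeasure (distr lborel borel T) A * emeasure lborel B
      = emeasure lborel A * emeasure lborel B" .
  have "emeasure lborel B < \<infinity>"
    unfolding B_def by (intro emeasure_bounded_finite) auto
  moreover have "emeasure lborel B \<noteq> 0"
    unfolding B_def using open_not_negligible[of "ball (0::'a) 1"]
    by (simp add: negligible_iff_emeasure0 emeasure_completion)
  ultimately show "emeasure (distr lborel borel T) A = emeasure lborel A"
    using eq ennreal_mult_cancel_left[of "emeasure lborel B"]
    by (metis infinity_ennreal_def less_irrefl mult.commute)
qed simp

section \<open>Holomorphic functions of several variables\<close>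

lemma open_Collect_nonzero:
  fixes u :: "'a::topological_space \<Rightarrow> 'b::{t1_space, zero}"
  assumes "open S" "continuous_on S u"
  shows "open {z \<in> S. u z \<noteq> 0}"
proof -
  have "open (S \<inter> u -` (- {0}))"
    using assms by (intro continuous_open_preimage) auto
  then show ?thesis by (simp add: Int_def vimage_def)
qed

lemma norm_scale_vec: "norm (c *s (v :: complex ^ 'n)) = cmod c * norm v"
  unfolding norm_vec_def by (simp add: L2_set_right_distrib norm_mult)

lemma linear_scale_vec: "linear (\<lambda>v :: complex ^ 'n. c *s v)"
  by (rule linearI) (simp_all add: vec_eq_iff algebra_simps scaleR_conv_of_real)

lemma bounded_bilinear_scale_vec:
  "bounded_bilinear (\<lambda>(c::complex) (v :: complex ^ 'n). c *s v)"
proof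
  show "\<exists>K. \<forall>c (v :: complex ^ 'n). norm (c *s v) \<le> norm c * norm v * K"
    by (rule exI[of _ 1]) (simp add: norm_scale_vec)
qed (simp_all add: vec_eq_iff algebra_simps)

lemmas continuous_on_scale_vec [continuous_intros] =
  bounded_bilinear.continuous_on[OF bounded_bilinear_scale_vec]

lemma has_derivative_line:
  fixes z v :: "complex ^ 'n"
  shows "((\<lambda>t. z + t *s v) has_derivative (\<lambda>t. t *s v)) F"
proof -
  have "bounded_linear (\<lambda>t. t *s v)"
    by (rule bounded_bilinear.bounded_linear_left[OF bounded_bilinear_scale_vec])
  then show ?thesis
    using has_derivative_add[OF has_derivative_const[of z F]
        bounded_linear_imp_has_derivative] by fastforce
qed

lemma open_line_preimage:
  fixes \<Omega> :: "(complex ^ 'n) set"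
  assumes "open \<Omega>"
  shows "open {t. z + t *s v \<in> \<Omega>}"
proof -
  have "open ((\<lambda>t. z + t *s v) -` \<Omega>)"
    by (rule open_vimage[OF assms]) (intro continuous_intros)
  then show ?thesis by (simp add: vimage_def)
qed

text \<open>All complex directions are taken, not just the coordinate ones, so that circle averages
  about a point can be integrated over all directions. The base point \<open>z\<close> may lie
  outside \<open>\<Omega>\<close>.\<close>

definition line_holomorphic_on :: "(complex ^ 'n \<Rightarrow> complex) \<Rightarrow> (complex ^ 'n) set \<Rightarrow> bool"
  where "line_holomorphic_on h \<Omega> \<longleftrightarrow>
    (\<forall>z v. (\<lambda>t. h (z + t *s v)) holomorphic_on {t. z + t *s v \<in> \<Omega>})"

lemma line_holomorphic_onD:
  assumes "line_holomorphic_on h \<Omega>" "\<And>t. t \<in> S \<Longrightarrow> z + t *s v \<in> \<Omega>"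
  shows "(\<lambda>t. h (z + t *s v)) holomorphic_on S"
  using assms unfolding line_holomorphic_on_def
  by (metis (mono_tags, lifting) holomorphic_on_subset mem_Collect_eq subsetI)

lemma holomorphic_fun_on_continuous_on:
  "holomorphic_fun_on h \<Omega> \<Longrightarrow> continuous_on \<Omega> h"
  unfolding holomorphic_fun_on_def
  by (meson continuous_at_imp_continuous_on has_derivative_continuous)

lemma holomorphic_fun_on_line_holomorphic_on:
  assumes "holomorphic_fun_on h \<Omega>"
  shows "line_holomorphic_on h \<Omega>"
  unfolding line_holomorphic_on_def
proof (intro allI)
  fix z v
  show "(\<lambda>t. h (z + t *s v)) holomorphic_on {t. z + t *s v \<in> \<Omega>}"
    unfolding holomorphic_on_def
  proof
    fix t assume "t \<in> {t. z + t *s v \<in> \<Omega>}"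
    then obtain h' where h': "(h has_derivative h') (at (z + t *s v))"
      and lin: "\<And>c v. h' (c *s v) = c * h' v"
      using assms unfolding holomorphic_fun_on_def by auto
    have "((\<lambda>t. h (z + t *s v)) has_derivative (\<lambda>s. h' (s *s v))) (at t)"
      by (rule has_derivative_compose[OF has_derivative_line h'])
    then have "((\<lambda>t. h (z + t *s v)) has_field_derivative h' v) (at t)"
      unfolding has_field_derivative_def
      by (rule has_derivative_eq_rhs) (simp add: lin fun_eq_iff mult.commute)
    then show "(\<lambda>t. h (z + t *s v)) field_differentiable at t within {t. z + t *s v \<in> \<Omega>}"
      using field_differentiable_def field_differentiable_at_within by blast
  qed
qed

text \<open>Squaring the positive part makes the function differentiable across the sphere of radius
  \<open>r\<close>. It depends on \<open>x\<close> only through its norm, hence does not change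
  under multiplication by unit scalars.\<close>

definition bump :: "real \<Rightarrow> 'a::euclidean_space \<Rightarrow> real"
  where "bump r x = (max 0 (r\<^sup>2 - x \<bullet> x))\<^sup>2"

lemma bump_nonneg: "0 \<le> bump r x"
  by (simp add: bump_def)

lemma bump_eq_0: "0 < r \<Longrightarrow> x \<notin> cball 0 r \<Longrightarrow> bump r x = 0"
  unfolding bump_def by (auto simp: dot_square_norm max_def power2_le_iff_abs_le)

lemma continuous_on_bump [continuous_intros]:
  "continuous_on S g \<Longrightarrow> continuous_on S (\<lambda>x. bump r (g x))"
  unfolding bump_def by (intro continuous_intros)

lemma borel_measurable_bump [measurable]: "bump r \<in> borel_measurable borel"
  by (intro borel_measurable_continuous_onI continuous_intros)

lemma integrable_continuous_times_bump:
  fixes h :: "'a::euclidean_space \<Rightarrow> 'b::{banach, second_countable_topology}"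
  assumes "0 < r" "continuous_on (cball z r) h"
  shows "integrable lborel (\<lambda>x. bump r (x - z) *\<^sub>R h x)"
proof -
  have "integrable lborel (\<lambda>x. indicator (cball z r) x *\<^sub>R (bump r (x - z) *\<^sub>R h x))"
    using assms by (intro borel_integrable_compact continuous_intros) auto
  moreover have "(\<lambda>x. indicator (cball z r) x *\<^sub>R (bump r (x - z) *\<^sub>R h x)) = (\<lambda>x. bump r (x - z) *\<^sub>R h x)"
    using bump_eq_0[OF assms(1)] 
    by (auto simp: fun_eq_iff indicator_def dist_norm norm_minus_commute)
  ultimately show ?thesis by simp
qed

lemma integral_bump_pos:
  assumes "0 < r"
  shows "0 < (\<integral>x. bump r (x::'a::euclidean_space) \<partial>lborel)"
proof -
  have int: "integrable lborel (bump r :: 'a \<Rightarrow> real)"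
    using integrable_continuous_times_bump[OF assms, of 0 "\<lambda>_. 1::real"] by simp
  have "(\<integral>x. bump r (x::'a) \<partial>lborel) \<noteq> 0"
  proof
    assume "(\<integral>x. bump r (x::'a) \<partial>lborel) = 0"
    then have "AE x in lborel. bump r (x::'a) = 0"
      using int by (subst (asm) integral_nonneg_eq_0_iff_AE) (auto simp: bump_nonneg)
    then have "AE x in lborel. (x::'a) \<notin> ball 0 r"
    proof eventually_elim
      case (elim x)
      then have "r\<^sup>2 \<le> (norm x)\<^sup>2"
        by (auto simp: bump_def max_def dot_square_norm split: if_splits)
      then show ?case
        using assms by (auto simp: power2_le_iff_abs_le)
    qed
    then have "emeasure lborel (ball (0::'a) r) = 0"
      by (subst (asm) AE_iff_null) (auto simp: ball_def)
    then show False
      using open_not_negligible[of "ball (0::'a) r"] assms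
      by (simp add: negligible_iff_emeasure0 emeasure_completion)
  qed
  moreover have "0 \<le> (\<integral>x. bump r (x::'a) \<partial>lborel)"
    by (simp add: bump_nonneg)
  ultimately show ?thesis by linarith
qed

lemma DERIV_max_0_power2: "((\<lambda>s::real. (max 0 s)\<^sup>2) has_field_derivative 2 * max 0 s) (at s)"
proof -
  consider "s < 0" | "s = 0" | "s > 0" by linarith
  then show ?thesis
  proof cases
    case 1
    have "((\<lambda>s::real. 0) has_field_derivative 0) (at s)" by simp
    moreover have "eventually (\<lambda>s::real. s < 0) (nhds s)"
      using 1 by (intro eventually_nhds_in_open[of "{..<0}", simplified]) auto
    then have "eventually (\<lambda>s::real. (max 0 s)\<^sup>2 = 0) (nhds s)"
      by eventually_elim (auto simp: max_def)
    moreover have "2 * max 0 s = 0" using 1 by simp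
    ultimately show ?thesis by (simp only: DERIV_cong_ev)
  next
    case 2
    have "((\<lambda>h. (max 0 h)\<^sup>2 / h) \<longlongrightarrow> 0) (at (0::real))"
    proof (rule Lim_null_comparison)
      show "\<forall>\<^sub>F h in at (0::real). norm ((max 0 h)\<^sup>2 / h) \<le> \<bar>h\<bar>"
        by (rule eventuallyI) (auto simp: max_def power2_eq_square)
    qed (intro tendsto_rabs_zero tendsto_ident_at)
    then show ?thesis using 2 by (simp add: DERIV_def)
  next
    case 3
    have "((\<lambda>s::real. s\<^sup>2) has_field_derivative 2 * s) (at s)"
      by (auto intro!: derivative_eq_intros)
    moreover have "eventually (\<lambda>s::real. s > 0) (nhds s)"
      using 3 by (intro eventually_nhds_in_open[of "{0<..}", simplified]) auto
    then have "eventually (\<lambda>s::real. (max 0 s)\<^sup>2 = s\<^sup>2) (nhds s)"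
      by eventually_elim (auto simp: max_def)
    moreover have "2 * max 0 s = 2 * s" using 3 by simp
    ultimately show ?thesis by (simp only: DERIV_cong_ev)
  qed
qed

text \<open>Cauchy's formula at the centre: on the unit circle \<open>dw / w\<close> is a constant
  multiple of \<open>d\<theta>\<close>.\<close>

lemma circle_average:
  assumes "g holomorphic_on ball 0 1" "continuous_on (cball 0 1) g"
  shows "((\<lambda>\<theta>. g (exp (2 * of_real pi * \<i> * of_real \<theta>))) has_integral g 0) {0..1}"
proof -
  have "((\<lambda>w. g w / (w - 0)) has_contour_integral (2 * of_real pi * \<i> * g 0)) (circlepath 0 1)"
    using assms by (intro Cauchy_integral_circlepath) auto
  then have "((\<lambda>x. g (exp (2 * of_real pi * \<i> * of_real x)) / exp (2 * of_real pi * \<i> * of_real x)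
      * (2 * of_real pi * \<i> * exp (2 * of_real pi * \<i> * of_real x)))
     has_integral (2 * of_real pi * \<i> * g 0)) {0..1}"
    unfolding has_contour_integral
    by (rule has_integral_eq[rotated])
       (simp add: vector_derivative_circlepath, simp add: circlepath)
  then have "((\<lambda>x. (2 * of_real pi * \<i>) * g (exp (2 * of_real pi * \<i> * of_real x)))
     has_integral (2 * of_real pi * \<i> * g 0)) {0..1}"
    by (simp add: mult.commute)
  moreover define c where "c = 2 * of_real pi * \<i>"
  ultimately have "((\<lambda>x. c * g (exp (c * of_real x))) has_integral (c * g 0)) {0..1}" and "c \<noteq> 0"
    by simp_all
  from has_integral_mult_right[OF this(1), of "inverse c"]
  have "((\<lambda>x. g (exp (c * of_real x))) has_integral g 0) {0..1}"
    by (simp add: mult.assoc[symmetric] \<open>c \<noteq> 0\<close>)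
  then show ?thesis by (simp add: c_def)
qed

text \<open>Rotating the variable by \<open>e \<theta>\<close> about \<open>z\<close> does not
  change the integral, so it may be averaged over \<open>\<theta>\<close>. After Fubini the inner
  integral is the average of \<open>h\<close> over a circle in direction \<open>x\<close>, which is
  \<open>h z\<close>.\<close>

lemma bump_mean_value:
  fixes h :: "complex ^ 'n \<Rightarrow> complex"
  assumes r: "0 < r" and \<Omega>: "cball z r \<subseteq> \<Omega>"
    and cont: "continuous_on \<Omega> h" and hol: "line_holomorphic_on h \<Omega>"
  shows "(\<integral>x. bump r (x - z) *\<^sub>R h x \<partial>lborel) = (\<integral>x. bump r (x :: complex ^ 'n) \<partial>lborel) *\<^sub>R h z"
proof -
  define e where "e = (\<lambda>\<theta>::real. exp (2 * of_real pi * \<i> * of_real \<theta>))"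
  have e1: "cmod (e \<theta>) = 1" for \<theta>
    by (simp add: e_def)
  have cont_e: "continuous_on S e" for S
    unfolding e_def by (intro continuous_intros)
  define F where "F = (\<lambda>(x, \<theta>). bump r x *\<^sub>R h (z + e \<theta> *s x))"
  have inS: "z + c *s x \<in> \<Omega>" if "cmod c \<le> 1" "x \<in> cball 0 r" for c x
  proof -
    have "norm (c *s x) \<le> r"
      using that mult_mono[of "cmod c" 1 "norm x" r] by (simp add: norm_scale_vec)
    then show ?thesis using \<Omega> by (auto simp: dist_norm)
  qed
  have "continuous_on (cball 0 r \<times> {0..1}) F"
    unfolding F_def case_prod_beta
    by (intro continuous_intros continuous_on_compose2[OF cont] continuous_on_compose2[OF cont_e])
       (auto intro!: inS simp: e1)
  then have "integrable lborel (\<lambda>p. indicator (cball 0 r \<times> {0..1}) p *\<^sub>R F p)"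
    by (intro borel_integrable_compact compact_Times) auto
  moreover have "(\<lambda>p. indicator (cball 0 r \<times> {0..1}) p *\<^sub>R F p) = (\<lambda>(x, \<theta>). indicator {0..1} \<theta> *\<^sub>R F (x, \<theta>))"
    using bump_eq_0[OF r] by (auto simp: fun_eq_iff indicator_def F_def)
  ultimately have intF: "integrable (lborel \<Otimes>\<^sub>M lborel) (\<lambda>(x, \<theta>). indicator {0..1} \<theta> *\<^sub>R F (x, \<theta>))"
    by (simp add: lborel_prod)
  have rot: "(\<integral>x. F (x, \<theta>) \<partial>lborel) = (\<integral>x. bump r (x - z) *\<^sub>R h x \<partial>lborel)" for \<theta>
  proof -
    have 0: "continuous_on (cball 0 r) (\<lambda>x. h (z + x))"
      by (intro continuous_on_compose2[OF cont] continuous_intros) (use \<Omega> in auto)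
    then have "integrable lborel (\<lambda>x. bump r x *\<^sub>R h (z + x))"
      using integrable_continuous_times_bump[OF r] by fastforce
    then have meas: "(\<lambda>x. bump r x *\<^sub>R h (z + x)) \<in> borel_measurable borel"
      by auto
    have "bump r (e \<theta> *s x) = bump r x" for x :: "complex ^ 'n"
      by (simp add: bump_def dot_square_norm norm_scale_vec e1)
    then have "(\<integral>x. F (x, \<theta>) \<partial>lborel) = (\<integral>x. bump r (e \<theta> *s x) *\<^sub>R h (z + e \<theta> *s x) \<partial>lborel)"
      by (simp add: F_def)
    also have "\<dots> = (\<integral>x. bump r x *\<^sub>R h (z + x) \<partial>distr lborel borel (\<lambda>x. e \<theta> *s x))"
      by (rule integral_distr[symmetric])
         (auto intro!: meas borel_measurable_continuous_onI continuous_intros)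
    also have "distr lborel borel (\<lambda>x :: complex ^ 'n. e \<theta> *s x) = lborel"
      by (rule lborel_distr_linear_isometry[OF linear_scale_vec]) (simp add: norm_scale_vec e1)
    also have "(\<integral>x. bump r x *\<^sub>R h (z + x) \<partial>lborel) = (\<integral>x. bump r ((z + x) - z) *\<^sub>R h (z + x) \<partial>lborel)"
      by simp
    also have "\<dots> = (\<integral>x. bump r (x - z) *\<^sub>R h x \<partial>distr lborel borel ((+) z))"
    proof (rule integral_distr[symmetric])
      have "continuous_on (cball z r) h"
        using cont \<Omega> continuous_on_subset by blast
      from integrable_continuous_times_bump[OF r this]
      show "(\<lambda>x. bump r (x - z) *\<^sub>R h x) \<in> borel_measurable borel" by auto
    qed auto
    finally show ?thesis by (simp add: lborel_distr_plus)
  qed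
  have circ: "(\<integral>\<theta>. indicator {0..1} \<theta> *\<^sub>R F (x, \<theta>) \<partial>lborel) = bump r x *\<^sub>R h z" for x
  proof (cases "x \<in> cball 0 r")
    case True
    have hc: "continuous_on (cball 0 1) (\<lambda>t. h (z + t *s x))"
      by (intro continuous_on_compose2[OF cont] continuous_intros) (auto intro!: inS simp: True[simplified])
    have "((\<lambda>\<theta>. h (z + e \<theta> *s x)) has_integral h z) {0..1}"
      using circle_average[of "\<lambda>t. h (z + t *s x)"] hc
        line_holomorphic_onD[OF hol, of "ball 0 1" z x] inS True unfolding e_def by auto
    then have "((\<lambda>\<theta>. F (x, \<theta>)) has_integral bump r x *\<^sub>R h z) {0..1}"
      unfolding F_def by (auto intro!: has_integral_cmul)
    moreover have "continuous_on {0..1} (\<lambda>\<theta>. F (x, \<theta>))"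
      unfolding F_def case_prod_conv
      by (intro continuous_intros continuous_on_compose2[OF cont] cont_e) (auto intro!: inS simp: e1 True[simplified])
    then have "set_integrable lborel {0..1} (\<lambda>\<theta>. F (x, \<theta>))"
      by (intro borel_integrable_atLeastAtMost') 
    ultimately show ?thesis
      using set_borel_integral_eq_integral(2)[of "{0..1}" "\<lambda>\<theta>. F (x, \<theta>)"]
      unfolding set_lebesgue_integral_def by (simp add: integral_unique)
  next
    case False
    then show ?thesis using bump_eq_0[OF r False] by (simp add: F_def)
  qed
  have "(\<integral>x. bump r (x - z) *\<^sub>R h x \<partial>lborel)
      = (\<integral>\<theta>. indicator {0..1} \<theta> *\<^sub>R (\<integral>x. bump r (x - z) *\<^sub>R h x \<partial>lborel) \<partial>(lborel :: real measure))"
    by simp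
  also have "\<dots> = (\<integral>\<theta>. (\<integral>x. indicator {0..1} \<theta> *\<^sub>R F (x, \<theta>) \<partial>lborel) \<partial>lborel)"
    by (simp add: rot)
  also have "\<dots> = (\<integral>x. (\<integral>\<theta>. indicator {0..1} \<theta> *\<^sub>R F (x, \<theta>) \<partial>lborel) \<partial>lborel)"
    by (rule lborel_pair.Fubini_integral[OF intF])
  also have "\<dots> = (\<integral>x. bump r (x :: complex ^ 'n) \<partial>lborel) *\<^sub>R h z"
    using integrable_continuous_times_bump[OF r, of "0 :: complex ^ 'n" "\<lambda>_. 1::real"]
    by (simp add: circ)
  finally show ?thesis .
qed

lemma has_derivative_bump:
  "(bump r has_derivative (\<lambda>v. - 4 * max 0 (r\<^sup>2 - x \<bullet> x) * (x \<bullet> v))) (at x)"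
proof -
  have "((\<lambda>x. r\<^sup>2 - x \<bullet> x) has_derivative (\<lambda>v. - (2 * (x \<bullet> v)))) (at x)"
    by (auto intro!: derivative_eq_intros simp: inner_commute)
  from has_derivative_compose[OF this DERIV_max_0_power2[unfolded has_field_derivative_def]]
  show ?thesis
    unfolding bump_def[abs_def] by (rule has_derivative_eq_rhs) (auto simp: fun_eq_iff)
qed

text \<open>Convolution with the bump reproduces \<open>h\<close> and can be differentiated under the integral sign.\<close>

lemma holomorphic_fun_onI:
  fixes h :: "complex ^ 'n \<Rightarrow> complex"
  assumes \<Omega>: "open \<Omega>" and cont: "continuous_on \<Omega> h" and hol: "line_holomorphic_on h \<Omega>"
  shows "holomorphic_fun_on h \<Omega>"
  unfolding holomorphic_fun_on_def
proof
  fix z assume z: "z \<in> \<Omega>"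
  obtain a b where ab: "z \<in> box a b" "cbox a b \<subseteq> \<Omega>"
    using open_contains_cbox[THEN iffD1, rule_format, OF \<Omega> z] by metis
  obtain R where R: "0 < R" "cball z R \<subseteq> box a b"
    using ab(1) open_contains_cball by (metis open_box)
  \<comment> \<open>With half the radius, the support of the bump about any \<open>w\<close> in
    \<open>ball z r\<close> lies in the box, so the convolution becomes an integral over a fixed
    domain.\<close>
  define r where "r = R / 2"
  have r: "0 < r" using R by (simp add: r_def)
  define c where "c = (\<integral>x. bump r (x :: complex ^ 'n) \<partial>lborel)"
  have c: "0 < c" unfolding c_def by (rule integral_bump_pos[OF r])
  define f where "f = (\<lambda>w x. bump r (x - w) *\<^sub>R h x)"
  define f' where "f' = (\<lambda>w x. blinfun_scaleR_left (h x) o\<^sub>L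
     ((4 * max 0 (r\<^sup>2 - (x - w) \<bullet> (x - w))) *\<^sub>R blinfun_inner_right (x - w)))"
  have box: "cbox a b \<subseteq> \<Omega>" by (rule ab(2))
  have cb: "continuous_on (cbox a b) h"
    using cont box continuous_on_subset by blast
  have sub: "cball w r \<subseteq> cbox a b" if "w \<in> ball z r" for w
  proof
    fix x assume "x \<in> cball w r"
    then have "dist z x \<le> R"
      using that dist_triangle[of z x w] by (simp add: r_def)
    then show "x \<in> cbox a b" using R box_subset_cbox by fastforce
  qed
  have eq: "integral (cbox a b) (f w) = c *\<^sub>R h w" if w: "w \<in> ball z r" for w
  proof -
    have int: "integrable lborel (f w)"
      unfolding f_def using integrable_continuous_times_bump[OF r] continuous_on_subset[OF cb sub[OF w]] .
    have "f w x = 0" if "x \<notin> cbox a b" for x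
    proof -
      have "x \<notin> cball w r" using sub[OF w] that by blast
      then have "x - w \<notin> cball 0 r" by (simp add: dist_norm norm_minus_commute)
      then show ?thesis by (simp add: f_def bump_eq_0[OF r])
    qed
    then have "(\<lambda>x. indicator (cbox a b) x *\<^sub>R f w x) = f w"
      by (auto simp: fun_eq_iff indicator_def)
    then have "integral (cbox a b) (f w) = (\<integral>x. f w x \<partial>lborel)"
      using set_borel_integral_eq_integral(2)[of "cbox a b" "f w"] int
      unfolding set_lebesgue_integral_def set_integrable_def by simp
    also have "\<dots> = c *\<^sub>R h w"
      unfolding f_def c_def using sub[OF w] box by (intro bump_mean_value[OF r _ cont hol]) auto
    finally show ?thesis .
  qed
  have zr: "z \<in> ball z r" using r by simp
  have "((\<lambda>w. integral (cbox a b) (f w)) has_derivative integral (cbox a b) (f' z)) (at z within ball z r)"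
  proof (rule leibniz_rule)
    fix w x assume "w \<in> ball z r" "x \<in> cbox a b"
    have "((\<lambda>w. x - w) has_derivative (\<lambda>v. - v)) (at w within ball z r)"
      by (auto intro!: derivative_eq_intros)
    from has_derivative_compose[OF this has_derivative_bump]
    have "((\<lambda>w. bump r (x - w) *\<^sub>R h x) has_derivative
       (\<lambda>v. (- 4 * max 0 (r\<^sup>2 - (x - w) \<bullet> (x - w)) * ((x - w) \<bullet> - v)) *\<^sub>R h x)) (at w within ball z r)"
      by (rule has_derivative_scaleR_left)
    then show "((\<lambda>w. f w x) has_derivative blinfun_apply (f' w x)) (at w within ball z r)"
      unfolding f_def f'_def by (rule has_derivative_eq_rhs) (auto simp: fun_eq_iff scaleR_blinfun.rep_eq)
  next
    fix w assume "w \<in> ball z r"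
    show "f w integrable_on cbox a b"
      unfolding f_def by (intro integrable_continuous continuous_intros cb)
  next
    have "continuous_on (ball z r \<times> cbox a b) (\<lambda>p. h (snd p))"
      by (intro continuous_on_compose2[OF cb] continuous_intros) auto
    then show "continuous_on (ball z r \<times> cbox a b) (\<lambda>(w, x). f' w x)"
      unfolding f'_def case_prod_beta
      by (intro continuous_intros bounded_linear.continuous_on[OF bounded_linear_blinfun_inner_right]
          bounded_linear.continuous_on[OF bounded_linear_blinfun_scaleR_left])
  qed (use r in auto)
  then have "((\<lambda>w. integral (cbox a b) (f w)) has_derivative integral (cbox a b) (f' z)) (at z)"
    by (subst (asm) at_within_open[OF zr open_ball])
  from has_derivative_transform_within_open[OF this open_ball zr eq]
  have "((\<lambda>w. c *\<^sub>R h w) has_derivative integral (cbox a b) (f' z)) (at z)" .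
  from has_derivative_scaleR_right[OF this, of "inverse c"]
  obtain h' where h': "(h has_derivative h') (at z)"
    using c by auto
  \<comment> \<open>So far \<open>h'\<close> is only real linear. On the complex line in direction
    \<open>v\<close> it must agree with the one-variable complex derivative.\<close>
  have "h' (c *s v) = c * h' v" for c v
  proof -
    have "0 \<in> {t. z + t *s v \<in> \<Omega>}" using z by simp
    then obtain d where d: "((\<lambda>t. h (z + t *s v)) has_field_derivative d) (at 0)"
      using hol open_line_preimage[OF \<Omega>, of z v] unfolding line_holomorphic_on_def
      by (metis holomorphic_on_open)
    have "((\<lambda>t. h (z + t *s v)) has_derivative (\<lambda>t. h' (t *s v))) (at 0)"
      using has_derivative_compose[OF has_derivative_line, of h h' z 0 v] h' by simp
    then have "(\<lambda>t. h' (t *s v)) = (*) d"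
      using d unfolding has_field_derivative_def by (rule has_derivative_unique)
    then have "h' (c *s v) = d * c" "h' (1 *s v) = d * 1" by metis+
    then show ?thesis by simp
  qed
  with h' show "\<exists>h'. (h has_derivative h') (at z) \<and> (\<forall>c v. h' (c *s v) = c * h' v)" by blast
qed

section \<open>Derivatives, closure properties and limits of holomorphic functions\<close>

lemma holomorphic_fun_onD:
  assumes "holomorphic_fun_on h \<Omega>" "z \<in> \<Omega>"
  shows "(h has_derivative frechet_derivative h (at z)) (at z)"
    and "frechet_derivative h (at z) (c *s v) = c * frechet_derivative h (at z) v"
proof -
  obtain h' where h': "(h has_derivative h') (at z)" "\<And>c v. h' (c *s v) = c * h' v"
    using assms unfolding holomorphic_fun_on_def by blast
  then show "(h has_derivative frechet_derivative h (at z)) (at z)"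
    using frechet_derivative_at by metis
  show "frechet_derivative h (at z) (c *s v) = c * frechet_derivative h (at z) v"
    using h' frechet_derivative_at by metis
qed

lemma holomorphic_fun_on_line_derivative:
  assumes "holomorphic_fun_on h \<Omega>" "z \<in> \<Omega>"
  shows "((\<lambda>t. h (z + t *s v)) has_field_derivative frechet_derivative h (at z) v) (at 0)"
proof -
  have "((\<lambda>t. h (z + t *s v)) has_derivative (\<lambda>t. frechet_derivative h (at z) (t *s v))) (at 0)"
    using has_derivative_compose[OF has_derivative_line, of h _ z 0 v UNIV] holomorphic_fun_onD(1)[OF assms]
    by simp
  then show ?thesis
    unfolding has_field_derivative_def
    by (rule has_derivative_eq_rhs) (simp add: holomorphic_fun_onD(2)[OF assms] fun_eq_iff mult.commute)
qed

text \<open>The offset \<open>N\<close> allows all the points \<open>z + v / (n + N)\<close> to be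
  kept inside a prescribed ball.\<close>

lemma difference_quotient_tendsto:
  fixes N :: nat
  assumes h: "holomorphic_fun_on h \<Omega>" "z \<in> \<Omega>" and N: "0 < N"
  shows "(\<lambda>n. of_real (real (n + N)) * (h (z + of_real (1 / real (n + N)) *s v) - h z))
    \<longlonglongrightarrow> frechet_derivative h (at z) v"
proof -
  have lim: "((\<lambda>t. (h (z + t *s v) - h z) / t) \<longlongrightarrow> frechet_derivative h (at z) v) (at 0)"
    using holomorphic_fun_on_line_derivative[OF h] by (simp add: DERIV_def)
  have "filterlim (\<lambda>n. complex_of_real (1 / real (n + N))) (at 0) sequentially"
    unfolding filterlim_at
  proof
    have "(\<lambda>n. 1 / real (n + N)) \<longlonglongrightarrow> 0"
      by (rule LIMSEQ_ignore_initial_segment[OF lim_1_over_n])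
    then show "(\<lambda>n. complex_of_real (1 / real (n + N))) \<longlonglongrightarrow> 0"
      by (metis of_real_0 tendsto_of_real)
    show "\<forall>\<^sub>F n in sequentially. complex_of_real (1 / real (n + N)) \<in> UNIV \<and> complex_of_real (1 / real (n + N)) \<noteq> 0"
      using N by (intro always_eventually allI) (simp flip: of_nat_add)
  qed
  from filterlim_compose[OF lim this] show ?thesis
    by (simp add: mult.commute)
qed

lemma holomorphic_fun_on_subset:
  "holomorphic_fun_on h \<Omega> \<Longrightarrow> \<Omega>' \<subseteq> \<Omega> \<Longrightarrow> holomorphic_fun_on h \<Omega>'"
  unfolding holomorphic_fun_on_def by blast

lemma holomorphic_fun_on_locally:
  assumes "\<And>z. z \<in> \<Omega> \<Longrightarrow> \<exists>U. z \<in> U \<and> holomorphic_fun_on h U"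
  shows "holomorphic_fun_on h \<Omega>"
  using assms unfolding holomorphic_fun_on_def by metis

lemma holomorphic_fun_on_cong:
  assumes "holomorphic_fun_on h \<Omega>" "open \<Omega>" "\<And>z. z \<in> \<Omega> \<Longrightarrow> h z = k z"
  shows "holomorphic_fun_on k \<Omega>"
  using assms unfolding holomorphic_fun_on_def
  by (metis has_derivative_transform_within_open)

lemma holomorphic_fun_on_const: "holomorphic_fun_on (\<lambda>_. c) \<Omega>"
  unfolding holomorphic_fun_on_def
  by (intro ballI exI[of _ "\<lambda>_. 0"]) auto

lemma holomorphic_fun_on_component: "holomorphic_fun_on (\<lambda>z. z $ i) \<Omega>"
  unfolding holomorphic_fun_on_def
  by (intro ballI exI[of _ "\<lambda>v. v $ i"])
     (auto intro!: bounded_linear_imp_has_derivative bounded_linear_vec_nth)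

lemma holomorphic_fun_on_add:
  assumes "holomorphic_fun_on h \<Omega>" "holomorphic_fun_on k \<Omega>"
  shows "holomorphic_fun_on (\<lambda>z. h z + k z) \<Omega>"
  unfolding holomorphic_fun_on_def
proof
  fix z assume "z \<in> \<Omega>"
  with assms obtain h' k' where
    "(h has_derivative h') (at z)" "\<forall>c v. h' (c *s v) = c * h' v"
    "(k has_derivative k') (at z)" "\<forall>c v. k' (c *s v) = c * k' v"
    unfolding holomorphic_fun_on_def by meson
  then show "\<exists>l'. ((\<lambda>z. h z + k z) has_derivative l') (at z) \<and> (\<forall>c v. l' (c *s v) = c * l' v)"
    by (intro exI[of _ "\<lambda>v. h' v + k' v"]) (auto intro!: derivative_intros simp: algebra_simps)
qed

lemma holomorphic_fun_on_mult:
  assumes "holomorphic_fun_on h \<Omega>" "holomorphic_fun_on k \<Omega>"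
  shows "holomorphic_fun_on (\<lambda>z. h z * k z) \<Omega>"
  unfolding holomorphic_fun_on_def
proof
  fix z assume "z \<in> \<Omega>"
  with assms obtain h' k' where
    "(h has_derivative h') (at z)" "\<forall>c v. h' (c *s v) = c * h' v"
    "(k has_derivative k') (at z)" "\<forall>c v. k' (c *s v) = c * k' v"
    unfolding holomorphic_fun_on_def by meson
  then show "\<exists>l'. ((\<lambda>z. h z * k z) has_derivative l') (at z) \<and> (\<forall>c v. l' (c *s v) = c * l' v)"
    by (intro exI[of _ "\<lambda>v. h z * k' v + h' v * k z"])
       (auto intro!: derivative_intros simp: algebra_simps)
qed

lemma holomorphic_fun_on_cmult:
  "holomorphic_fun_on h \<Omega> \<Longrightarrow> holomorphic_fun_on (\<lambda>z. c * h z) \<Omega>"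
  by (rule holomorphic_fun_on_mult[OF holomorphic_fun_on_const])

lemma holomorphic_fun_on_diff:
  assumes "holomorphic_fun_on h \<Omega>" "holomorphic_fun_on k \<Omega>"
  shows "holomorphic_fun_on (\<lambda>z. h z - k z) \<Omega>"
  using holomorphic_fun_on_add[OF assms(1) holomorphic_fun_on_cmult[OF assms(2), of "-1"]] by simp

lemma holomorphic_fun_on_sum:
  assumes "\<And>i. i \<in> I \<Longrightarrow> holomorphic_fun_on (h i) \<Omega>"
  shows "holomorphic_fun_on (\<lambda>z. \<Sum>i\<in>I. h i z) \<Omega>"
  using assms
  by (induction I rule: infinite_finite_induct)
     (auto intro: holomorphic_fun_on_const holomorphic_fun_on_add)

lemma holomorphic_fun_on_prod:
  assumes "\<And>i. i \<in> I \<Longrightarrow> holomorphic_fun_on (h i) \<Omega>"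
  shows "holomorphic_fun_on (\<lambda>z. \<Prod>i\<in>I. h i z) \<Omega>"
  using assms
  by (induction I rule: infinite_finite_induct)
     (auto intro: holomorphic_fun_on_const holomorphic_fun_on_mult)

lemma has_derivative_vec_components:
  fixes f :: "'a::real_normed_vector \<Rightarrow> complex ^ 'n"
  assumes "\<And>i. ((\<lambda>z. f z $ i) has_derivative f' i) F"
  shows "(f has_derivative (\<lambda>v. \<chi> i. f' i v)) F"
proof -
  have "((\<lambda>z. \<Sum>i\<in>UNIV. (f z $ i) *s axis i 1) has_derivative (\<lambda>v. \<Sum>i\<in>UNIV. f' i v *s axis i 1)) F"
    by (intro has_derivative_sum bounded_linear.has_derivative[OF
          bounded_bilinear.bounded_linear_left[OF bounded_bilinear_scale_vec]] assms)
  moreover have "(\<Sum>i\<in>UNIV. f' i v *s axis i 1) = (\<chi> i. f' i v)" for v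
    using basis_expansion[of "\<chi> i. f' i v"] by simp
  ultimately show ?thesis by (simp add: basis_expansion)
qed

lemma holomorphic_map_onD:
  fixes f :: "complex ^ 'n \<Rightarrow> complex ^ 'm"
  assumes "holomorphic_map_on f \<Omega>" "z \<in> \<Omega>"
  shows "(f has_derivative frechet_derivative f (at z)) (at z)"
    and "frechet_derivative f (at z) (c *s v) = c *s frechet_derivative f (at z) v"
    and "frechet_derivative f (at z) v $ i = frechet_derivative (\<lambda>z. f z $ i) (at z) v"
proof -
  have f: "holomorphic_fun_on (\<lambda>z. f z $ i) \<Omega>" for i
    using assms(1) by (simp add: holomorphic_map_on_def)
  have "(f has_derivative (\<lambda>v. \<chi> i. frechet_derivative (\<lambda>z. f z $ i) (at z) v)) (at z)"
    by (intro has_derivative_vec_components holomorphic_fun_onD(1)[OF f assms(2)])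
  moreover from this
  have eq: "frechet_derivative f (at z) = (\<lambda>v. \<chi> i. frechet_derivative (\<lambda>z. f z $ i) (at z) v)"
    by (rule frechet_derivative_at[symmetric])
  ultimately show "(f has_derivative frechet_derivative f (at z)) (at z)" by simp
  show "frechet_derivative f (at z) (c *s v) = c *s frechet_derivative f (at z) v"
    by (simp add: eq vec_eq_iff holomorphic_fun_onD(2)[OF f assms(2)])
  show "frechet_derivative f (at z) v $ i = frechet_derivative (\<lambda>z. f z $ i) (at z) v"
    by (simp add: eq)
qed

lemma holomorphic_map_onI:
  fixes f :: "complex ^ 'n \<Rightarrow> complex ^ 'm"
  assumes "\<And>z. z \<in> \<Omega> \<Longrightarrow> \<exists>f'. (f has_derivative f') (at z) \<and> (\<forall>c v. f' (c *s v) = c *s f' v)"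
  shows "holomorphic_map_on f \<Omega>"
  unfolding holomorphic_map_on_def holomorphic_fun_on_def
proof (intro allI ballI)
  fix i z assume "z \<in> \<Omega>"
  then obtain f' where f': "(f has_derivative f') (at z)" "\<forall>c v. f' (c *s v) = c *s f' v"
    using assms by blast
  then show "\<exists>h'. ((\<lambda>z. f z $ i) has_derivative h') (at z) \<and> (\<forall>c v. h' (c *s v) = c * h' v)"
    by (intro exI[of _ "\<lambda>v. f' v $ i"])
       (auto intro!: bounded_linear.has_derivative[OF bounded_linear_vec_nth])
qed

lemma holomorphic_map_on_continuous_on:
  fixes f :: "complex ^ 'n \<Rightarrow> complex ^ 'm"
  assumes "holomorphic_map_on f \<Omega>"
  shows "continuous_on \<Omega> f"
  by (meson assms continuous_at_imp_continuous_on has_derivative_continuous holomorphic_map_onD(1))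

lemma holomorphic_fun_on_compose:
  fixes f :: "complex ^ 'n \<Rightarrow> complex ^ 'm"
  assumes f: "holomorphic_map_on f \<Omega>" and h: "holomorphic_fun_on h \<Omega>'" and sub: "f ` \<Omega> \<subseteq> \<Omega>'"
  shows "holomorphic_fun_on (\<lambda>z. h (f z)) \<Omega>"
  unfolding holomorphic_fun_on_def
proof
  fix z assume z: "z \<in> \<Omega>"
  then have fz: "f z \<in> \<Omega>'" using sub by auto
  show "\<exists>h'. ((\<lambda>z. h (f z)) has_derivative h') (at z) \<and> (\<forall>c v. h' (c *s v) = c * h' v)"
    by (rule exI[of _ "\<lambda>v. frechet_derivative h (at (f z)) (frechet_derivative f (at z) v)"])
       (simp add: has_derivative_compose[OF holomorphic_map_onD(1)[OF f z] holomorphic_fun_onD(1)[OF h fz]]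
         holomorphic_map_onD(2)[OF f z] holomorphic_fun_onD(2)[OF h fz])
qed

text \<open>Cauchy's estimate on a circle of radius \<open>R / 4\<close> about \<open>w\<close> in
  the normalized direction of \<open>v\<close>; starting from the half ball, this circle stays in
  \<open>ball z R\<close>.\<close>

lemma holomorphic_fun_on_derivative_bound:
  fixes h :: "complex ^ 'n \<Rightarrow> complex"
  assumes h: "holomorphic_fun_on h (ball z R)" and R: "0 < R"
    and B: "\<And>w. w \<in> ball z R \<Longrightarrow> cmod (h w) \<le> B" and w: "w \<in> ball z (R / 2)"
  shows "cmod (frechet_derivative h (at w) v) \<le> 4 * B / R * norm v"
proof (cases "v = 0")
  case True
  have "w \<in> ball z R" using w R by auto
  then show ?thesis
    using True linear_0[OF has_derivative_linear[OF holomorphic_fun_onD(1)[OF h]]] by simp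
next
  case False
  define u where "u = complex_of_real (1 / norm v) *s v"
  have u: "norm u = 1" using False by (simp add: u_def norm_scale_vec norm_divide)
  have v: "v = complex_of_real (norm v) *s u"
    using False by (simp add: u_def vec_eq_iff)
  have wR: "w \<in> ball z R" using w R by auto
  have inR: "w + t *s u \<in> ball z R" if "cmod t \<le> R / 4" for t
  proof -
    have "dist z (w + t *s u) \<le> dist z w + cmod t"
      using norm_triangle_ineq4[of "z - w" "t *s u"] u by (simp add: dist_norm norm_scale_vec algebra_simps)
    then show ?thesis using that w R by auto
  qed
  define g where "g = (\<lambda>t. h (w + t *s u))"
  have g: "g holomorphic_on cball 0 (R / 4)"
    unfolding g_def using inR
    by (intro line_holomorphic_onD[OF holomorphic_fun_on_line_holomorphic_on[OF h]]) auto
  have "norm ((deriv ^^ 1) g 0) \<le> fact 1 * B / (R / 4) ^ 1"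
  proof (rule Cauchy_inequality)
    show "g holomorphic_on ball 0 (R / 4)" using g holomorphic_on_subset ball_subset_cball by blast
    show "continuous_on (cball 0 (R / 4)) g" using g by (rule holomorphic_on_imp_continuous_on)
    show "0 < R / 4" using R by simp
    show "cmod (g t) \<le> B" if "cmod (0 - t) = R / 4" for t
      unfolding g_def using that by (intro B inR) simp
  qed
  moreover have "(g has_field_derivative frechet_derivative h (at w) u) (at 0)"
    unfolding g_def by (rule holomorphic_fun_on_line_derivative[OF h wR])
  then have "deriv g 0 = frechet_derivative h (at w) u" by (rule DERIV_imp_deriv)
  ultimately have "cmod (frechet_derivative h (at w) u) \<le> 4 * B / R" by (simp add: field_simps)
  then show ?thesis
    by (subst v, subst holomorphic_fun_onD(2)[OF h wR])
       (use mult_left_mono[of "cmod (frechet_derivative h (at w) u)" "4 * B / R" "norm v"] in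
         \<open>simp add: norm_mult mult.commute\<close>)
qed

lemma holomorphic_fun_on_lipschitz:
  fixes h :: "complex ^ 'n \<Rightarrow> complex"
  assumes h: "holomorphic_fun_on h (ball z R)" and R: "0 < R"
    and B: "\<And>w. w \<in> ball z R \<Longrightarrow> cmod (h w) \<le> B"
    and w: "w \<in> ball z (R / 2)" "w' \<in> ball z (R / 2)"
  shows "cmod (h w - h w') \<le> 4 * B / R * norm (w - w')"
proof (rule differentiable_bound[OF convex_ball _ _ w])
  fix x assume x: "x \<in> ball z (R / 2)"
  then have "x \<in> ball z R" using R by auto
  then show "(h has_derivative frechet_derivative h (at x)) (at x within ball z (R / 2))"
    using holomorphic_fun_onD(1)[OF h] has_derivative_at_withinI by blast
  show "onorm (frechet_derivative h (at x)) \<le> 4 * B / R"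
    using holomorphic_fun_on_derivative_bound[OF h R B x] by (rule onorm_le)
qed

text \<open>The local bounds give Lipschitz estimates uniform in \<open>n\<close>, which pass to the
  limit and make \<open>k\<close> continuous. On each complex line Montel's theorem yields a
  holomorphic limit of a subsequence, which has to be \<open>k\<close>.\<close>

lemma holomorphic_fun_on_limit:
  fixes h :: "nat \<Rightarrow> complex ^ 'n \<Rightarrow> complex"
  assumes \<Omega>: "open \<Omega>" and h: "\<And>n. holomorphic_fun_on (h n) \<Omega>"
    and bdd: "\<And>z. z \<in> \<Omega> \<Longrightarrow> \<exists>R>0. \<exists>B. \<forall>n. \<forall>w\<in>ball z R \<inter> \<Omega>. cmod (h n w) \<le> B"
    and lim: "\<And>z. z \<in> \<Omega> \<Longrightarrow> (\<lambda>n. h n z) \<longlonglongrightarrow> k z"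
  shows "holomorphic_fun_on k \<Omega>"
proof (rule holomorphic_fun_onI[OF \<Omega>])
  show "continuous_on \<Omega> k"
  proof (rule continuous_at_imp_continuous_on, rule)
    fix z assume z: "z \<in> \<Omega>"
    obtain R0 B where R0: "R0 > 0" "\<And>n w. w \<in> ball z R0 \<inter> \<Omega> \<Longrightarrow> cmod (h n w) \<le> B"
      using bdd[OF z] by blast
    obtain R1 where R1: "R1 > 0" "ball z R1 \<subseteq> \<Omega>" using \<Omega> z open_contains_ball by blast
    define R where "R = min R0 R1"
    have R: "0 < R" "ball z R \<subseteq> \<Omega>" "ball z R \<subseteq> ball z R0" using R0 R1 by (auto simp: R_def)
    have L: "cmod (k w - k w') \<le> 4 * B / R * norm (w - w')" 
      if w: "w \<in> ball z (R / 2)" "w' \<in> ball z (R / 2)" for w w'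
    proof (rule LIMSEQ_le_const2)
      have "w \<in> \<Omega>" "w' \<in> \<Omega>" using w R by auto
      then show "(\<lambda>n. cmod (h n w - h n w')) \<longlonglongrightarrow> cmod (k w - k w')"
        by (intro tendsto_intros lim)
      show "\<exists>N. \<forall>n\<ge>N. cmod (h n w - h n w') \<le> 4 * B / R * norm (w - w')"
        using holomorphic_fun_on_lipschitz[OF holomorphic_fun_on_subset[OF h R(2)] R(1) _ w] R0 R
        by blast
    qed
    have "((\<lambda>w. k w - k z) \<longlongrightarrow> 0) (at z)"
    proof (rule Lim_null_comparison)
      show "\<forall>\<^sub>F w in at z. cmod (k w - k z) \<le> 4 * B / R * norm (w - z)"
        unfolding eventually_at using L R
        by (intro exI[of _ "R / 2"]) (auto simp: dist_commute)
      show "((\<lambda>w. 4 * B / R * norm (w - z)) \<longlongrightarrow> 0) (at z)"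
        using R(1) by (auto intro!: tendsto_eq_intros)
    qed
    then show "isCont k z" by (simp add: isCont_def LIM_zero_iff)
  qed
next
  show "line_holomorphic_on k \<Omega>"
    unfolding line_holomorphic_on_def
  proof (intro allI)
    fix z v
    define T where "T = {t. z + t *s v \<in> \<Omega>}"
    have T: "open T" unfolding T_def by (rule open_line_preimage[OF \<Omega>])
    define \<F> where "\<F> = (\<lambda>n t. h n (z + t *s v))"
    have hol: "\<F> n holomorphic_on T" for n
      unfolding \<F>_def T_def
      by (rule line_holomorphic_onD[OF holomorphic_fun_on_line_holomorphic_on[OF h]]) auto
    \<comment> \<open>Montel's theorem asks for bounds on compact sets; a finite subcover provides
      them from the bounds near each point.\<close>
    have bd: "\<exists>B. \<forall>h\<in>range \<F>. \<forall>t\<in>K. cmod (h t) \<le> B" if K: "compact K" "K \<subseteq> T" for K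
    proof -
      have "\<exists>U B. open U \<and> t \<in> U \<and> (\<forall>n. \<forall>s\<in>U \<inter> T. cmod (\<F> n s) \<le> B)" if t: "t \<in> T" for t
      proof -
        obtain R B where R: "R > 0" "\<And>n w. w \<in> ball (z + t *s v) R \<inter> \<Omega> \<Longrightarrow> cmod (h n w) \<le> B"
          using bdd t unfolding T_def by blast
        have "open {s. z + s *s v \<in> ball (z + t *s v) R}"
          by (rule open_line_preimage) simp
        then show ?thesis
          by (intro exI[of _ "{s. z + s *s v \<in> ball (z + t *s v) R}"] exI[of _ B] conjI)
             (auto intro!: R(2) simp: \<F>_def T_def R(1))
      qed
      then obtain U B where U: "\<And>t. t \<in> T \<Longrightarrow> open (U t) \<and> t \<in> U t"
        and B: "\<And>t n s. t \<in> T \<Longrightarrow> s \<in> U t \<Longrightarrow> s \<in> T \<Longrightarrow> cmod (\<F> n s) \<le> (B t :: real)"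
        by (metis (no_types, lifting) IntI)
      obtain C where C: "C \<subseteq> K" "finite C" "K \<subseteq> (\<Union>c\<in>C. U c)"
        using compactE_image[OF K(1), of K U] U K(2) by blast
      have "cmod (\<F> n s) \<le> Max (B ` C)" if s: "s \<in> K" for n s
      proof -
        obtain c where c: "c \<in> C" "s \<in> U c" using C s by blast
        then have "cmod (\<F> n s) \<le> B c" using B C K s by blast
        also have "\<dots> \<le> Max (B ` C)" using c C by auto
        finally show ?thesis .
      qed
      then show ?thesis by blast
    qed
    obtain g r where g: "g holomorphic_on T" "strict_mono (r :: nat \<Rightarrow> nat)"
      "\<And>t. t \<in> T \<Longrightarrow> (\<lambda>n. \<F> (r n) t) \<longlonglongrightarrow> g t"
    proof (rule Montel[OF T _ bd order_refl])
      show "f holomorphic_on T" if "f \<in> range \<F>" for f using hol that by auto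
    next
      fix g r assume "g holomorphic_on T" "strict_mono (r :: nat \<Rightarrow> nat)"
        "\<And>t. t \<in> T \<Longrightarrow> (\<lambda>n. \<F> (r n) t) \<longlonglongrightarrow> g t"
      then show thesis by (rule that)
    qed
    have "g t = k (z + t *s v)" if "t \<in> T" for t
    proof -
      have "(\<lambda>n. \<F> n t) \<longlonglongrightarrow> k (z + t *s v)"
        unfolding \<F>_def using lim that T_def by simp
      from LIMSEQ_subseq_LIMSEQ[OF this g(2)] show ?thesis
        using g(3)[OF that] LIMSEQ_unique unfolding comp_def by blast
    qed
    then show "(\<lambda>t. k (z + t *s v)) holomorphic_on {t. z + t *s v \<in> \<Omega>}"
      unfolding T_def[symmetric] by (rule holomorphic_transform[OF g(1)])
  qed
qed

text \<open>The difference quotients in direction \<open>v\<close> are holomorphic and, by the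
  Lipschitz estimate, bounded independently of the step, so their limit is holomorphic.\<close>

lemma holomorphic_fun_on_derivative:
  fixes h :: "complex ^ 'n \<Rightarrow> complex"
  assumes \<Omega>: "open \<Omega>" and h: "holomorphic_fun_on h \<Omega>"
  shows "holomorphic_fun_on (\<lambda>z. frechet_derivative h (at z) v) \<Omega>"
proof (rule holomorphic_fun_on_locally)
  fix z assume z: "z \<in> \<Omega>"
  have "isCont h z"
    using holomorphic_fun_onD(1)[OF h z] has_derivative_continuous by blast
  then obtain R0 where R0: "R0 > 0" "\<And>w. dist w z < R0 \<Longrightarrow> dist (h w) (h z) < 1"
    unfolding continuous_at_eps_delta by (metis zero_less_one)
  obtain R1 where R1: "R1 > 0" "ball z R1 \<subseteq> \<Omega>" using \<Omega> z open_contains_ball by blast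
  define R where "R = min R0 R1"
  have R: "0 < R" "ball z R \<subseteq> \<Omega>" using R0 R1 by (auto simp: R_def)
  have B: "cmod (h w) \<le> cmod (h z) + 1" if "w \<in> ball z R" for w
  proof -
    have "dist (h w) (h z) < 1" using that R0(2)[of w] by (simp add: R_def dist_commute)
    then show ?thesis using norm_triangle_sub[of "h w" "h z"] by (simp add: dist_norm)
  qed
  \<comment> \<open>This \<open>N\<close> makes every step shorter than \<open>R / 4\<close>, so
    that points of the quarter ball are moved within the half ball, where the Lipschitz estimate
    holds.\<close>
  obtain N :: nat where N: "4 * norm v / R < N" using reals_Archimedean2 by blast
  define m where "m = (\<lambda>n. real (n + N))"
  have "0 \<le> 4 * norm v / R" using R by simp
  then have N0: "0 < N" using N by (cases N) auto
  then have m: "0 < m n" for n unfolding m_def by simp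
  have vm: "norm v / m n < R / 4" for n
  proof -
    have "4 * norm v / R < m n" using N unfolding m_def by linarith
    then show ?thesis using R m[of n] by (simp add: field_simps)
  qed
  define q where "q = (\<lambda>n w. of_real (m n) * (h (w + of_real (1 / m n) *s v) - h w))"
  have in2: "w + of_real (1 / m n) *s v \<in> ball z (R / 2)" if "w \<in> ball z (R / 4)" for n w
  proof -
    have "dist z (w + of_real (1 / m n) *s v) \<le> dist z w + norm v / m n"
      using norm_triangle_ineq4[of "z - w" "of_real (1 / m n) *s v"] m[of n]
      by (simp add: dist_norm norm_scale_vec algebra_simps norm_divide)
    then show ?thesis using that vm[of n] unfolding mem_ball by linarith
  qed
  have "holomorphic_fun_on (\<lambda>w. frechet_derivative h (at w) v) (ball z (R / 4))"
  proof (rule holomorphic_fun_on_limit[of _ q])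
    fix n
    have "holomorphic_map_on (\<lambda>w. w + of_real (1 / m n) *s v) (ball z (R / 4))"
      unfolding holomorphic_map_on_def
      by (auto intro!: holomorphic_fun_on_add holomorphic_fun_on_const holomorphic_fun_on_component)
    then have "holomorphic_fun_on (\<lambda>w. h (w + of_real (1 / m n) *s v)) (ball z (R / 4))"
    proof (rule holomorphic_fun_on_compose[OF _ h])
      have "ball z (R / 2) \<subseteq> \<Omega>" using R by (auto simp: subset_iff)
      then show "(\<lambda>w. w + of_real (1 / m n) *s v) ` ball z (R / 4) \<subseteq> \<Omega>"
        using in2 by blast
    qed
    moreover have "holomorphic_fun_on h (ball z (R / 4))"
      by (rule holomorphic_fun_on_subset[OF h]) (use R in auto)
    ultimately show "holomorphic_fun_on (q n) (ball z (R / 4))"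
      unfolding q_def by (intro holomorphic_fun_on_cmult holomorphic_fun_on_diff)
  next
    have "cmod (q n w) \<le> 4 * (cmod (h z) + 1) / R * norm v" if w: "w \<in> ball z (R / 4)" for n w
    proof -
      have "w \<in> ball z (R / 2)" using w R by auto
      from holomorphic_fun_on_lipschitz[OF holomorphic_fun_on_subset[OF h R(2)] R(1) B in2[OF w, of n] this]
      have "cmod (h (w + of_real (1 / m n) *s v) - h w) \<le> 4 * (cmod (h z) + 1) / R * (norm v / m n)"
        using m[of n] by (simp add: norm_scale_vec norm_divide)
      then have "m n * cmod (h (w + of_real (1 / m n) *s v) - h w)
          \<le> m n * (4 * (cmod (h z) + 1) / R * (norm v / m n))"
        using m[of n] by (intro mult_left_mono) auto
      then show ?thesis using m[of n] by (simp add: q_def norm_mult)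
    qed
    then show "\<exists>r>0. \<exists>B. \<forall>n. \<forall>w\<in>ball x r \<inter> ball z (R / 4). cmod (q n w) \<le> B" if "x \<in> ball z (R / 4)" for x
      by (intro exI[of _ 1] conjI exI[of _ "4 * (cmod (h z) + 1) / R * norm v"]) auto
  next
    fix w assume "w \<in> ball z (R / 4)"
    then have w: "w \<in> \<Omega>" using R by auto
    show "(\<lambda>n. q n w) \<longlonglongrightarrow> frechet_derivative h (at w) v"
      unfolding q_def m_def by (rule difference_quotient_tendsto[OF h w N0])
  qed simp
  then show "\<exists>U. z \<in> U \<and> holomorphic_fun_on (\<lambda>z. frechet_derivative h (at z) v) U"
    using R by (metis centre_in_ball divide_pos_pos zero_less_numeral)
qed

text \<open>The interior of the zero set is also closed in \<open>\<Omega>\<close>: near a limit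
  point \<open>p\<close> choose a point \<open>q\<close> of it. Every point of a ball about
  \<open>p\<close> lies on a complex line through \<open>q\<close>, and along that line the zeros
  accumulate at \<open>q\<close>, so that one-variable continuation applies.\<close>

lemma holomorphic_fun_on_identity:
  fixes h :: "complex ^ 'n \<Rightarrow> complex"
  assumes \<Omega>: "open \<Omega>" "connected \<Omega>" and h: "holomorphic_fun_on h \<Omega>"
    and U: "open U" "U \<noteq> {}" "U \<subseteq> \<Omega>" "\<And>z. z \<in> U \<Longrightarrow> h z = 0" and z: "z \<in> \<Omega>"
  shows "h z = 0"
proof -
  define Z where "Z = interior {z \<in> \<Omega>. h z = 0}"
  have "U \<subseteq> Z" unfolding Z_def using U by (intro interior_maximal) auto
  have "closedin (top_of_set \<Omega>) Z"
  proof (rule closedin_limpt[THEN iffD2], intro conjI allI impI)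
    show ZO: "Z \<subseteq> \<Omega>" unfolding Z_def using interior_subset by blast
    fix p assume p: "p islimpt Z \<and> p \<in> \<Omega>"
    then obtain r where r: "r > 0" "ball p r \<subseteq> \<Omega>" using \<Omega> open_contains_ball by blast
    obtain q where q: "q \<in> Z" "q \<in> ball p r"
      using p r(1) unfolding islimpt_approachable by (metis dist_commute mem_ball)
    obtain s where s: "s > 0" "ball q s \<subseteq> Z"
      using q(1) unfolding Z_def by (meson interior_subset open_contains_ball open_interior)
    have "h x = 0" if x: "x \<in> ball p r" for x
    proof -
      define v where "v = x - q"
      define T where "T = {t. q + t *s v \<in> ball p r}"
      have T: "open T" unfolding T_def by (rule open_line_preimage) simp
      \<comment> \<open>Continuation needs a connected slice; it is the preimage of a translated
        ball under a linear map.\<close>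
      have "convex ((\<lambda>t. t *s v) -` ((\<lambda>y. - q + y) ` ball p r))"
        by (intro convex_linear_vimage convex_translation)
           (auto intro: bounded_linear.linear bounded_bilinear.bounded_linear_left[OF bounded_bilinear_scale_vec])
      moreover have "(\<lambda>t. t *s v) -` ((\<lambda>y. - q + y) ` ball p r) = T"
        unfolding T_def image_def vimage_def by (auto simp: algebra_simps)
      ultimately have "convex T" by metis
      then have cT: "connected T" by (rule convex_connected)
      have hol: "(\<lambda>t. h (q + t *s v)) holomorphic_on T"
        unfolding T_def using r
        by (intro line_holomorphic_onD[OF holomorphic_fun_on_line_holomorphic_on[OF h]]) auto
      have 1: "1 \<in> T" using x by (simp add: T_def v_def)
      have 0: "0 \<in> T" using q by (simp add: T_def)
      have O: "open {t. q + t *s v \<in> ball q s}" by (rule open_line_preimage) simp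
      have "h (q + 1 *s v) = 0"
      proof (rule analytic_continuation[OF hol T cT, of "{t. q + t *s v \<in> ball q s} \<inter> T" 0, OF _ 0 _ _ 1])
        show "0 islimpt {t. q + t *s v \<in> ball q s} \<inter> T"
          using 0 s O T by (intro interior_limit_point) (simp add: interior_open open_Int)
        fix t assume "t \<in> {t. q + t *s v \<in> ball q s} \<inter> T"
        then show "h (q + t *s v) = 0"
          using s(2) interior_subset unfolding Z_def by blast
      qed auto
      then show ?thesis by (simp add: v_def)
    qed
    then have "ball p r \<subseteq> Z"
      unfolding Z_def using r(2) by (intro interior_maximal) auto
    then show "p \<in> Z" using r(1) by auto
  qed
  moreover have "openin (top_of_set \<Omega>) Z"
    unfolding Z_def using interior_subset by (intro open_subset) (auto simp: subset_iff)
  ultimately have "Z = {} \<or> Z = \<Omega>"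
    using \<Omega>(2) connected_clopen by blast
  then have "Z = \<Omega>" using \<open>U \<subseteq> Z\<close> U(2) by blast
  then show ?thesis using z interior_subset unfolding Z_def by blast
qed

section \<open>Rado's theorem\<close>

lemma continuous_on_compact_bounded:
  assumes "compact S" "continuous_on S f"
  shows "\<exists>B. \<forall>x\<in>S. norm (f x) \<le> B"
  using compact_imp_bounded[OF compact_continuous_image[OF assms(2,1)]] by (simp add: bounded_iff)

text \<open>The constants \<open>a\<close> and \<open>U\<close> disappear on taking
  \<open>n\<close>-th roots. This is how the factor \<open>u\<close> is removed from the maximum
  principle below.\<close>

lemma le_if_mult_power_le:
  fixes a x y U :: real
  assumes a: "0 < a" and y: "0 \<le> y" and le: "\<And>n. a * x ^ n \<le> U * y ^ n"
  shows "x \<le> y"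
proof (rule ccontr)
  assume "\<not> x \<le> y"
  then have x: "y < x" "0 < x" using y by auto
  have "(\<lambda>n. U * (y / x) ^ n) \<longlonglongrightarrow> U * 0"
    using x y by (intro tendsto_intros LIMSEQ_power_zero) simp
  moreover have "a \<le> U * (y / x) ^ n" for n
    using le[of n] x by (simp add: power_divide field_simps)
  ultimately have "a \<le> U * 0"
    by (intro LIMSEQ_le_const) auto
  then show False using a by simp
qed

text \<open>The factor \<open>u\<close> vanishes on the part of the boundary of \<open>{u \<noteq> 0}\<close> inside the disc; its
  influence is removed by taking powers of \<open>F\<close>.\<close>

lemma maximum_modulus_nonzero_set:
  fixes u F :: "complex \<Rightarrow> complex"
  defines "S \<equiv> {z \<in> ball 0 1. u z \<noteq> 0}"
  assumes u: "continuous_on (cball 0 1) u" "u holomorphic_on S"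
    and F: "continuous_on (closure S) F" "F holomorphic_on S"
    and M: "\<And>z. z \<in> sphere 0 1 \<Longrightarrow> z \<in> closure S \<Longrightarrow> cmod (F z) \<le> M" "0 \<le> M" and \<alpha>: "\<alpha> \<in> S"
  shows "cmod (F \<alpha>) \<le> M"
proof -
  have "open S"
    unfolding S_def using continuous_on_subset[OF u(1) ball_subset_cball]
    by (intro open_Collect_nonzero) auto
  have clS: "closure S \<subseteq> cball 0 1"
    by (rule closure_minimal) (auto simp: S_def)
  obtain U where U: "\<And>z. z \<in> cball 0 1 \<Longrightarrow> cmod (u z) \<le> U"
    using continuous_on_compact_bounded[OF compact_cball u(1)] by blast
  have U0: "0 \<le> U" using order_trans[OF norm_ge_zero U[of 0]] by simp
  have "cmod (u \<alpha>) * cmod (F \<alpha>) ^ n \<le> U * M ^ n" for n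
  proof -
    have "cmod (u \<alpha> * F \<alpha> ^ n) \<le> U * M ^ n"
    proof (rule maximum_modulus_frontier[where S = S and f = "\<lambda>z. u z * F z ^ n"])
      show "(\<lambda>z. u z * F z ^ n) holomorphic_on interior S"
        using \<open>open S\<close> u(2) F(2) by (auto simp: interior_open intro!: holomorphic_intros)
      show "continuous_on (closure S) (\<lambda>z. u z * F z ^ n)"
        using continuous_on_subset[OF u(1) clS] F(1) by (intro continuous_intros)
      show "bounded S" unfolding S_def by (rule bounded_subset[OF bounded_ball[of 0 1]]) auto
      show "\<alpha> \<in> S" by (rule \<alpha>)
      fix z assume "z \<in> frontier S"
      then have z: "z \<in> closure S" "z \<notin> S" using \<open>open S\<close> by (auto simp: frontier_def interior_open)
      then have zc: "z \<in> cball 0 1" using clS by blast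
      show "cmod (u z * F z ^ n) \<le> U * M ^ n"
      proof (cases "z \<in> sphere 0 1")
        case True
        then show ?thesis
          using U[OF zc] M(1)[OF True z(1)] U0 M(2)
          by (auto simp: norm_mult norm_power intro!: mult_mono power_mono)
      next
        case False
        then have "u z = 0" using z zc by (auto simp: S_def)
        then show ?thesis using U0 M(2) by simp
      qed
    qed
    then show ?thesis by (simp add: norm_mult norm_power)
  qed
  moreover have "0 < cmod (u \<alpha>)" using \<alpha> by (simp add: S_def)
  ultimately show ?thesis using le_if_mult_power_le M(2) by blast
qed

text \<open>Otherwise there are a point \<open>\<beta>\<close> of the disc outside the closure of
  \<open>S\<close> and a point \<open>\<alpha>\<close> of \<open>S\<close>, both near a common
  boundary point. Then \<open>1 / (z - \<beta>)\<close> is larger at \<open>\<alpha>\<close> than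
  the maximum principle permits.\<close>

lemma nonzero_set_dense:
  fixes u :: "complex \<Rightarrow> complex"
  defines "S \<equiv> {z \<in> ball 0 1. u z \<noteq> 0}"
  assumes u: "continuous_on (cball 0 1) u" "u holomorphic_on S" and ne: "S \<noteq> {}"
  shows "ball 0 1 \<subseteq> closure S"
proof (rule ccontr)
  assume not: "\<not> ball 0 1 \<subseteq> closure S"
  define V where "V = ball 0 1 - closure S"
  have SB: "S \<subseteq> ball 0 1" by (auto simp: S_def)
  have V: "open V" "V \<noteq> {}" "V \<subseteq> ball 0 1" using not by (auto simp: V_def)
  have "ball 0 1 \<inter> frontier V \<noteq> {}"
  proof (rule connected_Int_frontier)
    show "ball 0 1 \<inter> V \<noteq> {}" using V by auto
    show "ball 0 1 - V \<noteq> {}"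
      using ne SB closure_subset[of S] by (auto simp: V_def)
  qed simp
  then obtain p where p: "p \<in> ball 0 1" "p \<in> closure V" "p \<notin> V"
    using V(1) by (auto simp: frontier_def interior_open)
  then have pS: "p \<in> closure S" by (simp add: V_def)
  \<comment> \<open>A third of the distance from \<open>p\<close> to the unit circle:
    \<open>\<alpha>\<close> and \<open>\<beta>\<close> are less than \<open>2 * d\<close> apart,
    while \<open>\<beta>\<close> is more than \<open>2 * d\<close> away from the circle.\<close>
  define d where "d = (1 - cmod p) / 3"
  have d: "0 < d" using p by (simp add: d_def)
  obtain \<beta> where \<beta>: "\<beta> \<in> V" "dist \<beta> p < d" using p(2) d closure_approachable by blast
  obtain \<alpha> where \<alpha>: "\<alpha> \<in> S" "dist \<alpha> p < d" using pS d closure_approachable by blast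
  have \<beta>cl: "\<beta> \<notin> closure S" using \<beta> by (simp add: V_def)
  have \<beta>1: "cmod \<beta> < 1" using \<beta>(1) V(3) by auto
  have "cmod (1 / (\<alpha> - \<beta>)) \<le> 1 / (1 - cmod \<beta>)"
  proof (rule maximum_modulus_nonzero_set[where F = "\<lambda>z. 1 / (z - \<beta>)", OF u[unfolded S_def]])
    show "continuous_on (closure {z \<in> ball 0 1. u z \<noteq> 0}) (\<lambda>z. 1 / (z - \<beta>))"
      using \<beta>cl unfolding S_def by (auto intro!: continuous_intros)
    show "(\<lambda>z. 1 / (z - \<beta>)) holomorphic_on {z \<in> ball 0 1. u z \<noteq> 0}"
      using \<beta>cl closure_subset[of S] unfolding S_def by (auto intro!: holomorphic_intros)
    show "cmod (1 / (z - \<beta>)) \<le> 1 / (1 - cmod \<beta>)" if "z \<in> sphere 0 1" for z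
    proof -
      have "1 - cmod \<beta> \<le> cmod (z - \<beta>)" using that norm_triangle_ineq2[of z \<beta>] by simp
      then show ?thesis using \<beta>1 by (auto simp: norm_divide intro!: divide_left_mono mult_pos_pos)
    qed
  qed (use \<beta>1 \<alpha>(1) S_def in auto)
  moreover have "\<alpha> \<noteq> \<beta>" using \<alpha>(1) \<beta>cl closure_subset by blast
  ultimately have "1 - cmod \<beta> \<le> cmod (\<alpha> - \<beta>)"
    using \<beta>1 by (simp add: norm_divide field_simps)
  moreover have "cmod (\<alpha> - \<beta>) < 2 * d"
    using \<alpha>(2) \<beta>(2) dist_triangle[of \<alpha> \<beta> p] by (simp add: dist_commute dist_norm)
  moreover have "cmod \<beta> < cmod p + d"
    using \<beta>(2) norm_triangle_sub[of \<beta> p] by (simp add: dist_norm)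
  moreover have "3 * d = 1 - cmod p" by (simp add: d_def)
  ultimately show False by linarith
qed

text \<open>On the unit circle conjugation is inversion, so products of real parts of monomials are
  again sums of such real parts. The real parts of complex polynomials thus form an algebra there
  that contains all real polynomial functions, and Stone-Weierstrass applies.\<close>

lemma continuous_on_circle_approx_Re_poly:
  fixes f :: "complex \<Rightarrow> real"
  assumes "continuous_on (sphere 0 1) f" "0 < e"
  obtains p where "\<And>z. z \<in> sphere 0 1 \<Longrightarrow> \<bar>f z - Re (poly p z)\<bar> < e"
proof -
  define R where "R = {g. \<exists>p. \<forall>z\<in>sphere 0 1. g z = Re (poly p z)}"
  have add: "(\<lambda>z. g z + h z) \<in> R" if "g \<in> R" "h \<in> R" for g h
  proof -
    obtain p q where "\<forall>z\<in>sphere 0 1. g z = Re (poly p z)" "\<forall>z\<in>sphere 0 1. h z = Re (poly q z)"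
      using \<open>g \<in> R\<close> \<open>h \<in> R\<close> unfolding R_def by blast
    then show ?thesis unfolding R_def by (auto intro!: exI[of _ "p + q"])
  qed
  have const: "(\<lambda>z. c) \<in> R" for c
    unfolding R_def by (auto intro!: exI[of _ "[:of_real c:]"])
  have cong: "h \<in> R" if "g \<in> R" "\<And>z. z \<in> sphere 0 1 \<Longrightarrow> h z = g z" for g h
    using that unfolding R_def by auto
  have sum: "(\<lambda>z. \<Sum>i\<in>I. g i z) \<in> R" if "finite I" "\<And>i. i \<in> I \<Longrightarrow> g i \<in> R" for g and I :: "nat set"
    using that by (induction I rule: finite_induct) (auto intro: add const)
  have mono: "(\<lambda>z. Re (a * z ^ k)) \<in> R" for a k
    unfolding R_def by (auto intro!: exI[of _ "monom a k"] simp: poly_monom)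
  have prod1: "(\<lambda>z. Re (a * z ^ k) * Re (b * z ^ l)) \<in> R" if "l \<le> k" for a b k l
  proof (rule cong)
    show "(\<lambda>z. Re (a * b / 2 * z ^ (k + l)) + Re (a * cnj b / 2 * z ^ (k - l))) \<in> R"
      by (intro add mono)
    fix z :: complex assume z: "z \<in> sphere 0 1"
    have "z * cnj z = 1" using z complex_norm_square[of z] by simp
    moreover have "z ^ k = z ^ (k - l) * z ^ l"
      using that by (simp add: power_add[symmetric])
    ultimately have "z ^ k * cnj z ^ l = z ^ (k - l)"
      by (simp add: mult.assoc power_mult_distrib[symmetric])
    then have "a * z ^ k * cnj (b * z ^ l) = a * cnj b * z ^ (k - l)"
      by (simp add: mult_ac)
    moreover have "Re A * Re B = Re (A * B / 2) + Re (A * cnj B / 2)" for A B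
      by (simp add: field_simps)
    moreover have "a * z ^ k * (b * z ^ l) / 2 = a * b / 2 * z ^ (k + l)"
      by (simp add: power_add)
    moreover have "a * cnj b * z ^ (k - l) / 2 = a * cnj b / 2 * z ^ (k - l)"
      by simp
    ultimately show "Re (a * z ^ k) * Re (b * z ^ l)
        = Re (a * b / 2 * z ^ (k + l)) + Re (a * cnj b / 2 * z ^ (k - l))"
      by metis
  qed
  have prod: "(\<lambda>z. Re (a * z ^ k) * Re (b * z ^ l)) \<in> R" for a b k l
    using prod1[of l k a b] prod1[of k l b a] by (cases "l \<le> k") (simp_all add: mult.commute)
  have mult: "(\<lambda>z. g z * h z) \<in> R" if "g \<in> R" "h \<in> R" for g h
  proof -
    obtain p q where pq: "\<forall>z\<in>sphere 0 1. g z = Re (poly p z)" "\<forall>z\<in>sphere 0 1. h z = Re (poly q z)"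
      using \<open>g \<in> R\<close> \<open>h \<in> R\<close> unfolding R_def by blast
    have "(\<lambda>z. \<Sum>i\<le>degree p. \<Sum>j\<le>degree q. Re (coeff p i * z ^ i) * Re (coeff q j * z ^ j)) \<in> R"
      by (intro sum prod) auto
    then show ?thesis
      by (rule cong) (simp add: pq poly_altdef sum_product)
  qed
  have "g \<in> R" if "real_polynomial_function g" for g
    using that
  proof induction
    case (linear g)
    \<comment> \<open>A real linear functional on the plane has the form
      \<open>z \<mapsto> Re (z * c)\<close>.\<close>
    define c where "c = of_real (g 1) - \<i> * of_real (g \<i>)"
    have "g z = Re (z * c)" for z
    proof -
      have "g z = g (Re z *\<^sub>R 1 + Im z *\<^sub>R \<i>)"
        by (rule arg_cong[of _ _ g]) (simp add: complex_eq_iff)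
      also have "\<dots> = Re z * g 1 + Im z * g \<i>"
        using linear by (simp add: linear_simps)
      finally show ?thesis by (simp add: c_def algebra_simps)
    qed
    then show ?case
      unfolding R_def by (intro CollectI exI[of _ "[:0, c:]"]) simp
  qed (auto intro: add mult const)
  moreover have "\<exists>g. real_polynomial_function g \<and> (\<forall>z\<in>sphere 0 1. \<bar>f z - g z\<bar> < e)"
    by (rule Stone_Weierstrass_real_polynomial_function[OF compact_sphere assms]) blast
  then obtain g where g: "real_polynomial_function g" "\<And>z. z \<in> sphere 0 1 \<Longrightarrow> \<bar>f z - g z\<bar> < e"
    by blast
  ultimately obtain p where p: "\<forall>z\<in>sphere 0 1. g z = Re (poly p z)"
    unfolding R_def by blast
  show ?thesis
    by (rule that[of p]) (use g(2) p in simp)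
qed

lemma holomorphic_on_poly: "(\<lambda>z. poly p z) holomorphic_on S"
  unfolding poly_altdef by (intro holomorphic_intros)

text \<open>In effect, \<open>Re u\<close> is shown to solve the Dirichlet problem for its own
  values on the circle. The approximation by real parts of polynomials passes from the circle to
  \<open>S\<close> by the maximum principle for nonzero sets, and then to the disc by density of
  \<open>S\<close>.\<close>

lemma Re_eq_Re_holomorphic:
  fixes u :: "complex \<Rightarrow> complex"
  defines "S \<equiv> {z \<in> ball 0 1. u z \<noteq> 0}"
  assumes u: "continuous_on (cball 0 1) u" "u holomorphic_on S" and ne: "S \<noteq> {}"
  obtains P where "P holomorphic_on ball 0 1" "\<And>z. z \<in> ball 0 1 \<Longrightarrow> Re (P z) = Re (u z)"
proof -
  have SB: "S \<subseteq> ball 0 1" by (auto simp: S_def)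
  then have clS: "closure S \<subseteq> cball 0 1"
    by (intro closure_minimal) (use order_trans[OF _ ball_subset_cball] in auto)
  have dense: "ball 0 1 \<subseteq> closure S"
    using nonzero_set_dense[of u] u ne unfolding S_def by simp
  have "\<exists>p. \<forall>z\<in>sphere 0 1. \<bar>Re (u z) - Re (poly p z)\<bar> < 1 / real (Suc n)" for n
  proof -
    have "continuous_on (sphere 0 1) (\<lambda>z. Re (u z))"
      using continuous_on_subset[OF u(1) sphere_cball] by (intro continuous_intros)
    then show ?thesis
      by (rule continuous_on_circle_approx_Re_poly[of _ "1 / real (Suc n)"]) (simp, blast)
  qed
  then obtain p where p: "\<And>n z. z \<in> sphere 0 1 \<Longrightarrow> \<bar>Re (u z) - Re (poly (p n) z)\<bar> < 1 / real (Suc n)"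
    by metis
  have cont_p: "continuous_on A (\<lambda>z. poly (p n) z)" for n A
    by (rule holomorphic_on_imp_continuous_on[OF holomorphic_on_poly])
  have approxS: "\<bar>Re (u z) - Re (poly (p n) z)\<bar> \<le> 1 / real (Suc n)" if z: "z \<in> S" for n z
  proof -
    \<comment> \<open>The two signs bound the difference of the real parts from above and from
      below.\<close>
    have "cmod (exp (\<sigma> * (poly (p n) z - u z))) \<le> exp (1 / real (Suc n))" if \<sigma>: "\<sigma> = 1 \<or> \<sigma> = - 1" for \<sigma>
    proof (rule maximum_modulus_nonzero_set[where F = "\<lambda>z. exp (\<sigma> * (poly (p n) z - u z))", OF u[unfolded S_def]])
      show "continuous_on (closure {z \<in> ball 0 1. u z \<noteq> 0}) (\<lambda>z. exp (\<sigma> * (poly (p n) z - u z)))"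
        using continuous_on_subset[OF u(1) clS] unfolding S_def
        by (intro continuous_intros cont_p)
      show "(\<lambda>z. exp (\<sigma> * (poly (p n) z - u z))) holomorphic_on {z \<in> ball 0 1. u z \<noteq> 0}"
        using u(2) unfolding S_def by (intro holomorphic_intros holomorphic_on_poly)
      show "cmod (exp (\<sigma> * (poly (p n) z - u z))) \<le> exp (1 / real (Suc n))" if "z \<in> sphere 0 1" for z
        using p[OF that, of n] \<sigma> by (auto simp: norm_exp_eq_Re)
    qed (use z S_def in auto)
    from this[of 1] this[of "-1"] show ?thesis by (auto simp: norm_exp_eq_Re)
  qed
  have approx: "\<bar>Re (u z) - Re (poly (p n) z)\<bar> \<le> 1 / real (Suc n)" if z: "z \<in> ball 0 1" for n z
  proof -
    have "z \<in> closure S" using z dense by blast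
    then show ?thesis
    proof (rule continuous_le_on_closure[rotated])
      show "continuous_on (closure S) (\<lambda>z. \<bar>Re (u z) - Re (poly (p n) z)\<bar>)"
        using continuous_on_subset[OF u(1) clS] by (intro continuous_intros cont_p)
    qed (rule approxS)
  qed
  \<comment> \<open>The imaginary parts of the polynomials are not controlled. The modulus of the
    exponential depends on the real part alone, so the exponentials form a bounded family; the
    logarithm of their limit is \<open>P\<close>.\<close>
  define \<F> where "\<F> = (\<lambda>n z. exp (poly (p n) z))"
  have lim: "(\<lambda>n. cmod (\<F> n z)) \<longlonglongrightarrow> exp (Re (u z))" if z: "z \<in> ball 0 1" for z
  proof -
    have "(\<lambda>n. Re (poly (p n) z) - Re (u z)) \<longlonglongrightarrow> 0"
      using approx[OF z]
      by (intro Lim_null_comparison[OF _ LIMSEQ_inverse_real_of_nat] always_eventually allI)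
         (simp add: abs_minus_commute inverse_eq_divide)
    then have "(\<lambda>n. Re (poly (p n) z)) \<longlonglongrightarrow> Re (u z)" by (simp add: LIM_zero_iff)
    then show ?thesis unfolding \<F>_def norm_exp_eq_Re by (rule tendsto_exp)
  qed
  obtain U where U: "\<And>z. z \<in> cball 0 1 \<Longrightarrow> cmod (u z) \<le> U"
    using continuous_on_compact_bounded[OF compact_cball u(1)] by blast
  have bd: "cmod (\<F> n z) \<le> exp (U + 1)" if z: "z \<in> ball 0 1" for n z
  proof -
    have "Re (u z) \<le> U" using U[of z] z complex_Re_le_cmod[of "u z"] by auto
    moreover have "1 / real (Suc n) \<le> 1" by simp
    ultimately have "Re (poly (p n) z) \<le> U + 1" using approx[OF z, of n] by linarith
    then show ?thesis unfolding \<F>_def norm_exp_eq_Re by simp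
  qed
  obtain E r where E: "E holomorphic_on ball 0 1" "strict_mono (r :: nat \<Rightarrow> nat)"
    "\<And>z. z \<in> ball 0 1 \<Longrightarrow> (\<lambda>n. \<F> (r n) z) \<longlonglongrightarrow> E z"
  proof (rule Montel[of "ball 0 1" "range \<F>" \<F>])
    show "f holomorphic_on ball 0 1" if "f \<in> range \<F>" for f
      using that unfolding \<F>_def by (auto intro!: holomorphic_intros holomorphic_on_poly)
    show "\<exists>B. \<forall>h\<in>range \<F>. \<forall>z\<in>K. cmod (h z) \<le> B" if "K \<subseteq> ball 0 1" for K
      using bd that by (intro exI[of _ "exp (U + 1)"]) blast
  next
    fix g r assume "g holomorphic_on ball 0 1" "strict_mono (r :: nat \<Rightarrow> nat)"
      "\<And>t. t \<in> ball 0 1 \<Longrightarrow> (\<lambda>n. \<F> (r n) t) \<longlonglongrightarrow> g t"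
    then show thesis by (rule that)
  qed auto
  have normE: "cmod (E z) = exp (Re (u z))" if z: "z \<in> ball 0 1" for z
    using LIMSEQ_unique[OF tendsto_norm[OF E(3)[OF z]]]
      LIMSEQ_subseq_LIMSEQ[OF lim[OF z] E(2)] unfolding comp_def by blast
  obtain P where P: "P holomorphic_on ball 0 1" "\<And>z. z \<in> ball 0 1 \<Longrightarrow> exp (P z) = E z"
  proof (rule holomorphic_logarithm_exists[of "ball 0 1" E 0])
    show "E z \<noteq> 0" if "z \<in> ball 0 1" for z using normE[OF that] by auto
  qed (use E in auto)
  show thesis
  proof (rule that[OF P(1)])
    fix z :: complex assume z: "z \<in> ball 0 1"
    have "exp (Re (P z)) = exp (Re (u z))"
      using normE[OF z] P(2)[OF z] by (metis norm_exp_eq_Re)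
    then show "Re (P z) = Re (u z)" by simp
  qed
qed

text \<open>The real derivative of \<open>Re f\<close> is \<open>h \<mapsto> Re (d * h)\<close>;
  test it on \<open>cnj d\<close>.\<close>

lemma has_field_derivative_Re_eq_0:
  fixes f :: "complex \<Rightarrow> complex"
  assumes "open S" "z \<in> S" "(f has_field_derivative d) (at z)" "\<And>w. w \<in> S \<Longrightarrow> Re (f w) = 0"
  shows "d = 0"
proof -
  have "((\<lambda>w. Re (f w)) has_derivative (\<lambda>h. Re (d * h))) (at z)"
    using assms(3) unfolding has_field_derivative_def by (rule has_derivative_Re)
  moreover have "((\<lambda>w. Re (f w)) has_derivative (\<lambda>h. 0)) (at z)"
    by (rule has_derivative_transform_within_open[OF has_derivative_const[of 0] assms(1,2)])
       (simp add: assms(4))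
  ultimately have "(\<lambda>h. Re (d * h)) = (\<lambda>h. 0)" by (rule has_derivative_unique)
  then have "Re (d * cnj d) = 0" by metis
  then show ?thesis by (simp add: complex_eq_iff sum_squares_eq_zero_iff)
qed

text \<open>\<open>P\<close> has the real part of \<open>u\<close>, and \<open>Re Q\<close> is
  \<open>Im u\<close>. On \<open>S\<close> the derivatives of \<open>Q\<close> and
  \<open>- \<i> * P\<close> agree, so \<open>Q + \<i> * P\<close> is constant on the disc by
  analytic continuation. Its real part \<open>Im u - Im P\<close> is then constant, so that
  \<open>u\<close> differs from \<open>P\<close> by an imaginary constant.\<close>

lemma Rado_unit_disc:
  fixes u :: "complex \<Rightarrow> complex"
  assumes u: "continuous_on (cball 0 1) u" "u holomorphic_on {z \<in> ball 0 1. u z \<noteq> 0}"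
  shows "u holomorphic_on ball 0 1"
proof (cases "{z \<in> ball 0 1. u z \<noteq> 0} = {}")
  case True
  then have "u z = 0" if "z \<in> ball 0 1" for z using that by auto
  then show ?thesis using holomorphic_transform[OF holomorphic_on_const] by metis
next
  case False
  define S where "S = {z \<in> ball 0 1. u z \<noteq> 0}"
  have uS: "u holomorphic_on S" using u(2) by (simp add: S_def)
  have S: "S \<noteq> {}" "S \<subseteq> ball 0 1" using False by (auto simp: S_def)
  have "open S"
    unfolding S_def using continuous_on_subset[OF u(1) ball_subset_cball]
    by (intro open_Collect_nonzero) auto
  obtain P where P: "P holomorphic_on ball 0 1" "\<And>z. z \<in> ball 0 1 \<Longrightarrow> Re (P z) = Re (u z)"
    using Re_eq_Re_holomorphic[of u] u False by blast
  obtain Q where Q: "Q holomorphic_on ball 0 1" "\<And>z. z \<in> ball 0 1 \<Longrightarrow> Re (Q z) = Re (- \<i> * u z)"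
  proof (rule Re_eq_Re_holomorphic[of "\<lambda>z. - \<i> * u z"])
    show "continuous_on (cball 0 1) (\<lambda>z. - \<i> * u z)" by (intro continuous_intros u)
    show "(\<lambda>z. - \<i> * u z) holomorphic_on {z \<in> ball 0 1. - \<i> * u z \<noteq> 0}"
      using u(2) by (auto intro!: holomorphic_intros)
    show "{z \<in> ball 0 1. - \<i> * u z \<noteq> 0} \<noteq> {}" using False by auto
  next
    fix Q assume "Q holomorphic_on ball 0 1" "\<And>z. z \<in> ball 0 1 \<Longrightarrow> Re (Q z) = Re (- \<i> * u z)"
    then show thesis by (rule that)
  qed
  have dS: "deriv P z = deriv u z" "deriv Q z = - \<i> * deriv u z" if z: "z \<in> S" for z
  proof -
    have zB: "z \<in> ball 0 1" using z S by blast
    have du: "(u has_field_derivative deriv u z) (at z)" by (rule holomorphic_derivI[OF uS \<open>open S\<close> z])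
    have dP: "(P has_field_derivative deriv P z) (at z)" by (rule holomorphic_derivI[OF P(1) open_ball zB])
    have dQ: "(Q has_field_derivative deriv Q z) (at z)" by (rule holomorphic_derivI[OF Q(1) open_ball zB])
    have "deriv P z - deriv u z = 0"
      by (rule has_field_derivative_Re_eq_0[OF \<open>open S\<close> z DERIV_diff[OF dP du]]) (use P(2) S in auto)
    then show "deriv P z = deriv u z" by simp
    have "deriv Q z - (- \<i>) * deriv u z = 0"
      by (rule has_field_derivative_Re_eq_0[OF \<open>open S\<close> z DERIV_diff[OF dQ DERIV_cmult[OF du]]]) (use Q(2) S in auto)
    then show "deriv Q z = - \<i> * deriv u z" by (simp add: eq_neg_iff_add_eq_0)
  qed
  define W where "W = (\<lambda>z. Q z + \<i> * P z)"
  have W: "W holomorphic_on ball 0 1" unfolding W_def by (intro holomorphic_intros P Q)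
  have dW: "deriv W z = deriv Q z + \<i> * deriv P z" if z: "z \<in> ball 0 1" for z
    unfolding W_def
    by (intro DERIV_imp_deriv DERIV_add DERIV_cmult holomorphic_derivI[OF P(1) open_ball z]
        holomorphic_derivI[OF Q(1) open_ball z])
  obtain s where s: "s \<in> S" using S by blast
  have "deriv W z = 0" if z: "z \<in> ball 0 1" for z
  proof (rule analytic_continuation[of "deriv W" "ball 0 1" S s])
    show "deriv W holomorphic_on ball 0 1" using W by (intro holomorphic_deriv) auto
    show "s islimpt S" using s \<open>open S\<close> by (simp add: interior_limit_point interior_open)
    show "deriv W z = 0" if "z \<in> S" for z
      using dW[of z] dS[OF that] that S by auto
  qed (use S s z in auto)
  then have "\<exists>c. \<forall>z\<in>ball 0 1. W z = c"
    using holomorphic_derivI[OF W open_ball]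
    by (intro has_field_derivative_zero_constant) (auto intro: has_field_derivative_at_within simp: dest!: spec)
  then obtain c where c: "\<And>z. z \<in> ball 0 1 \<Longrightarrow> W z = c" by blast
  show ?thesis
  proof (rule holomorphic_transform[of "\<lambda>z. P z + \<i> * of_real (Re c)"])
    show "(\<lambda>z. P z + \<i> * of_real (Re c)) holomorphic_on ball 0 1" by (intro holomorphic_intros P)
    fix z :: complex assume z: "z \<in> ball 0 1"
    have "Re (W z) = Re c" using c[OF z] by simp
    then show "P z + \<i> * of_real (Re c) = u z"
      using P(2)[OF z] Q(2)[OF z] by (simp add: W_def complex_eq_iff)
  qed
qed

theorem Rado:
  fixes u :: "complex \<Rightarrow> complex"
  assumes T: "open T" and u: "continuous_on T u" "u holomorphic_on {z \<in> T. u z \<noteq> 0}"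
  shows "u holomorphic_on T"
proof -
  have "\<exists>r>0. u holomorphic_on ball a r" if a: "a \<in> T" for a
  proof -
    obtain r where r: "r > 0" "cball a r \<subseteq> T" using T a open_contains_cball by blast
    have in_cball: "a + of_real r * z \<in> cball a r" if "z \<in> cball 0 1" for z
      using that r by (simp add: dist_norm norm_mult)
    have "(\<lambda>z. u (a + of_real r * z)) holomorphic_on ball 0 1"
    proof (rule Rado_unit_disc)
      show "continuous_on (cball 0 1) (\<lambda>z. u (a + of_real r * z))"
        using in_cball r by (intro continuous_on_compose2[OF u(1)] continuous_intros) blast
      have "(u \<circ> (\<lambda>z. a + of_real r * z)) holomorphic_on {z \<in> ball 0 1. u (a + of_real r * z) \<noteq> 0}"
        using in_cball r ball_subset_cball
        by (intro holomorphic_on_compose_gen[OF _ u(2)] holomorphic_intros) blast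
      then show "(\<lambda>z. u (a + of_real r * z)) holomorphic_on {z \<in> ball 0 1. u (a + of_real r * z) \<noteq> 0}"
        by (simp add: comp_def)
    qed
    moreover have "(\<lambda>z. (z - a) / of_real r) ` ball a r \<subseteq> ball 0 1"
      using r by (auto simp: dist_norm norm_divide norm_minus_commute)
    ultimately have "((\<lambda>z. u (a + of_real r * z)) \<circ> (\<lambda>z. (z - a) / of_real r)) holomorphic_on ball a r"
      using r(1) by (intro holomorphic_on_compose_gen[where t = "ball 0 1"]) (auto intro!: holomorphic_intros)
    then have "u holomorphic_on ball a r"
      using r(1) by (simp add: comp_def)
    then show ?thesis using r(1) by blast
  qed
  then show ?thesis
    unfolding holomorphic_on_def
    by (metis at_within_open centre_in_ball field_differentiable_at_within open_ball)
qed

section \<open>Fisher information under push-forward\<close>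

text \<open>The density \<open>d\<close> shows that the choice in \<open>signed_RN_deriv\<close> is
  made from a nonempty set, and integrable densities are unique almost everywhere.\<close>

lemma signed_RN_deriv_AE_eq:
  assumes M: "finite_measure M" and d: "integrable M d" and \<sigma>: "\<And>A. A \<in> sets M \<Longrightarrow> \<sigma> A = (LINT x:A|M. d x)"
  shows "integrable M (signed_RN_deriv M \<sigma>)" and "AE x in M. signed_RN_deriv M \<sigma> x = d x"
proof -
  have *: "integrable M (signed_RN_deriv M \<sigma>) \<and>
      (\<forall>A\<in>sets M. \<sigma> A = (LINT x:A|M. signed_RN_deriv M \<sigma> x))"
    unfolding signed_RN_deriv_def
    by (rule someI[of "\<lambda>d. integrable M d \<and> (\<forall>A\<in>sets M. \<sigma> A = (LINT x:A|M. d x))" d])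
       (use d \<sigma> in auto)
  then show "integrable M (signed_RN_deriv M \<sigma>)" by blast
  show "AE x in M. signed_RN_deriv M \<sigma> x = d x"
    by (rule sigma_finite_measure.density_unique_banach)
       (use * d \<sigma> M finite_measure.axioms(1) in auto)
qed

lemma fisher_metric_eq:
  assumes M: "finite_measure M" and d: "integrable M d" and \<sigma>: "\<And>A. A \<in> sets M \<Longrightarrow> \<sigma> A = (LINT x:A|M. d x)"
  shows "fisher_metric M \<sigma> \<sigma> = (\<integral>x. (d x)\<^sup>2 \<partial>M)"
  unfolding fisher_metric_def
proof (rule integral_cong_AE)
  have "signed_RN_deriv M \<sigma> \<in> borel_measurable M" "d \<in> borel_measurable M"
    using signed_RN_deriv_AE_eq(1)[OF M d \<sigma>] d by auto
  then show "(\<lambda>x. signed_RN_deriv M \<sigma> x * signed_RN_deriv M \<sigma> x) \<in> borel_measurable M"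
    and "(\<lambda>x. (d x)\<^sup>2) \<in> borel_measurable M"
    by measurable
  show "AE x in M. signed_RN_deriv M \<sigma> x * signed_RN_deriv M \<sigma> x = (d x)\<^sup>2"
  proof -
    have "AE x in M. signed_RN_deriv M \<sigma> x = d x" by (rule signed_RN_deriv_AE_eq(2)[OF M d \<sigma>])
    then show ?thesis by eventually_elim (simp add: power2_eq_square)
  qed
qed

text \<open>Preimages of null sets of the push-forward are null, so absolute continuity survives and
  Radon-Nikodym supplies \<open>q\<close>; finiteness of the measures makes it real valued.\<close>

lemma distr_density_eq_density_distr:
  fixes p :: "'a \<Rightarrow> real"
  assumes M: "finite_measure M" and f [measurable]: "f \<in> measurable M N"
    and p: "integrable M p" "\<And>x. 0 \<le> p x"
  shows "\<exists>q\<in>borel_measurable N. (\<forall>y. 0 \<le> (q y :: real)) \<and>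
    distr (density M p) N f = density (distr M N f) q"
proof -
  interpret M: finite_measure M by (rule M)
  interpret D: finite_measure "distr M N f" by (rule M.finite_measure_distr[OF f])
  have [measurable]: "p \<in> borel_measurable M" using p by auto
  define \<nu> where "\<nu> = distr (density M p) N f"
  have "emeasure (density M p) (space M) = (\<integral>\<^sup>+x. ennreal (p x) \<partial>M)"
    by (simp add: emeasure_density)
  also have "\<dots> = ennreal (\<integral>x. p x \<partial>M)"
    by (rule nn_integral_eq_integral) (use p in auto)
  finally have fin: "finite_measure (density M p)"
    by (intro finite_measureI) (simp add: less_top)
  then have fin\<nu>: "finite_measure \<nu>"
    unfolding \<nu>_def by (rule finite_measure.finite_measure_distr) simp
  have ac: "absolutely_continuous (distr M N f) \<nu>"
    unfolding absolutely_continuous_def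
  proof
    fix B assume B: "B \<in> null_sets (distr M N f)"
    then have [measurable]: "B \<in> sets N" by auto
    have "f -` B \<inter> space M \<in> null_sets M"
      using B by (simp add: null_sets_distr_iff)
    then have "f -` B \<inter> space M \<in> null_sets (density M p)"
      using absolutely_continuousI_density[of p M] by (auto simp: absolutely_continuous_def)
    then have "emeasure \<nu> B = 0"
      by (simp add: \<nu>_def emeasure_distr null_setsD1)
    then show "B \<in> null_sets \<nu>" by (intro null_setsI) (simp_all add: \<nu>_def)
  qed
  have sets: "sets \<nu> = sets (distr M N f)" by (simp add: \<nu>_def)
  have "\<exists>q\<in>borel_measurable (distr M N f).
      (AE x in distr M N f. RN_deriv (distr M N f) \<nu> x = ennreal (q x)) \<and> (\<forall>x. 0 \<le> q x)"
    by (rule D.real_RN_deriv[OF fin\<nu> ac sets]) blast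
  then obtain q where q: "q \<in> borel_measurable (distr M N f)"
      "AE x in distr M N f. RN_deriv (distr M N f) \<nu> x = ennreal (q x)" "\<And>x. 0 \<le> q x"
    by blast
  have "\<nu> = density (distr M N f) (RN_deriv (distr M N f) \<nu>)"
    using D.density_RN_deriv[OF ac sets] by simp
  also have "\<dots> = density (distr M N f) q"
    using q by (intro density_cong) auto
  finally show ?thesis
    using q unfolding \<nu>_def by auto
qed

text \<open>The positive and negative parts of \<open>d\<close> are densities of finite measures,
  whose push-forwards have densities \<open>qp\<close> and \<open>qn\<close>. The test functions are
  all bounded \<open>\<phi>\<close>, not just indicators, since truncations of \<open>e\<close>
  itself are to be inserted later.\<close>

lemma pushforward_density_ex:
  fixes d :: "'a \<Rightarrow> real"
  assumes M: "finite_measure M" and f [measurable]: "f \<in> measurable M N" and d: "integrable M d"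
  shows "\<exists>e\<in>borel_measurable N. integrable M (\<lambda>x. e (f x)) \<and>
    (\<forall>\<phi>\<in>borel_measurable N. \<forall>B. (\<forall>y. \<bar>\<phi> y\<bar> \<le> B) \<longrightarrow>
       (\<integral>x. d x * \<phi> (f x) \<partial>M) = (\<integral>x. e (f x) * \<phi> (f x) \<partial>M))"
proof -
  have ex: "\<exists>q. q \<in> borel_measurable N \<and> integrable M (\<lambda>x. q (f x)) \<and>
      (\<forall>\<phi> B. \<phi> \<in> borel_measurable N \<longrightarrow> (\<forall>y. \<bar>\<phi> y\<bar> \<le> B) \<longrightarrow>
         (\<integral>x. p x * \<phi> (f x) \<partial>M) = (\<integral>x. q (f x) * \<phi> (f x) \<partial>M))"
    if p: "integrable M p" "\<And>x. 0 \<le> p x" for p :: "'a \<Rightarrow> real"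
  proof -
    have mp [measurable]: "p \<in> borel_measurable M" using p by auto
    obtain q :: "'b \<Rightarrow> real" where mq [measurable]: "q \<in> borel_measurable N" and q: "\<And>y. 0 \<le> q y"
      and eq: "distr (density M p) N f = density (distr M N f) q"
      using distr_density_eq_density_distr[OF M f p] by blast
    have f': "f \<in> measurable (density M p) N" by simp
    have int: "(\<integral>x. p x * \<phi> (f x) \<partial>M) = (\<integral>x. q (f x) * \<phi> (f x) \<partial>M)"
      if [measurable]: "\<phi> \<in> borel_measurable N" for \<phi>
    proof -
      have "(\<integral>x. p x * \<phi> (f x) \<partial>M) = integral\<^sup>L (density M p) (\<lambda>x. \<phi> (f x))"
        using p by (subst integral_density) auto
      also have "\<dots> = integral\<^sup>L (distr (density M p) N f) \<phi>"
        by (subst integral_distr[OF f']) auto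
      also have "\<dots> = (\<integral>y. q y * \<phi> y \<partial>distr M N f)"
        unfolding eq using q by (subst integral_density) auto
      also have "\<dots> = (\<integral>x. q (f x) * \<phi> (f x) \<partial>M)"
        by (subst integral_distr) auto
      finally show ?thesis .
    qed
    have "integrable (density M p) (\<lambda>x. 1 :: real)"
      using p by (subst integrable_density) auto
    then have "integrable (distr (density M p) N f) (\<lambda>x. 1 :: real)"
      by (simp only: integrable_distr_eq[OF f' borel_measurable_const])
    then have "integrable (distr M N f) q"
      unfolding eq using q by (subst (asm) integrable_density) auto
    then have "integrable M (\<lambda>x. q (f x))"
      by (subst (asm) integrable_distr_eq) auto
    then show ?thesis
      by (intro exI[of _ q] conjI allI impI mq int)
  qed
  have int\<phi>: "integrable M (\<lambda>x. g x * \<phi> (f x))"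
    if "integrable M g" "\<phi> \<in> borel_measurable N" "\<And>y. \<bar>\<phi> y\<bar> \<le> B" for g \<phi> and B :: real
  proof (rule Bochner_Integration.integrable_bound[of _ "\<lambda>x. B * g x"])
    show "integrable M (\<lambda>x. B * g x)" using that by simp
    show "(\<lambda>x. g x * \<phi> (f x)) \<in> borel_measurable M" using that by auto
    have "0 \<le> B" using that(3)[of undefined] by linarith
    then show "AE x in M. norm (g x * \<phi> (f x)) \<le> norm (B * g x)"
      using mult_right_mono[OF that(3) abs_ge_zero] by (intro AE_I2) (simp add: abs_mult mult.commute)
  qed
  define dp dn where "dp = (\<lambda>x. max 0 (d x))" and "dn = (\<lambda>x. max 0 (- d x))"
  have dpn: "integrable M dp" "integrable M dn" "\<And>x. 0 \<le> dp x" "\<And>x. 0 \<le> dn x"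
    unfolding dp_def dn_def using d by (auto intro!: integrable_max)
  have d_eq: "d x = dp x - dn x" for x by (auto simp: dp_def dn_def)
  obtain qp where qp: "qp \<in> borel_measurable N" "integrable M (\<lambda>x. qp (f x))"
    "\<And>\<phi> B. \<phi> \<in> borel_measurable N \<Longrightarrow> \<forall>y. \<bar>\<phi> y\<bar> \<le> B \<Longrightarrow>
         (\<integral>x. dp x * \<phi> (f x) \<partial>M) = (\<integral>x. qp (f x) * \<phi> (f x) \<partial>M)"
    using ex[OF dpn(1,3)] by metis
  obtain qn where qn: "qn \<in> borel_measurable N" "integrable M (\<lambda>x. qn (f x))"
    "\<And>\<phi> B. \<phi> \<in> borel_measurable N \<Longrightarrow> \<forall>y. \<bar>\<phi> y\<bar> \<le> B \<Longrightarrow>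
         (\<integral>x. dn x * \<phi> (f x) \<partial>M) = (\<integral>x. qn (f x) * \<phi> (f x) \<partial>M)"
    using ex[OF dpn(2,4)] by metis
  show ?thesis
  proof (intro bexI[of _ "\<lambda>y. qp y - qn y"] conjI ballI allI impI)
    show "(\<lambda>y. qp y - qn y) \<in> borel_measurable N" using qp qn by measurable
    show "integrable M (\<lambda>x. qp (f x) - qn (f x))" using qp qn by simp
    fix \<phi> :: "'b \<Rightarrow> real" and B assume "\<phi> \<in> borel_measurable N" and "\<forall>y. \<bar>\<phi> y\<bar> \<le> B"
    note \<phi> = this(1) spec[OF this(2)]
    have "(\<integral>x. d x * \<phi> (f x) \<partial>M) = (\<integral>x. dp x * \<phi> (f x) \<partial>M) - (\<integral>x. dn x * \<phi> (f x) \<partial>M)"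
      unfolding d_eq left_diff_distrib
      using int\<phi>[OF dpn(1) \<phi>] int\<phi>[OF dpn(2) \<phi>] by simp
    also have "\<dots> = (\<integral>x. qp (f x) * \<phi> (f x) \<partial>M) - (\<integral>x. qn (f x) * \<phi> (f x) \<partial>M)"
      by (simp only: qp(3)[OF \<phi>(1) \<open>\<forall>y. \<bar>\<phi> y\<bar> \<le> B\<close>] qn(3)[OF \<phi>(1) \<open>\<forall>y. \<bar>\<phi> y\<bar> \<le> B\<close>])
    also have "\<dots> = (\<integral>x. (qp (f x) - qn (f x)) * \<phi> (f x) \<partial>M)"
      unfolding left_diff_distrib using int\<phi>[OF qp(2) \<phi>] int\<phi>[OF qn(2) \<phi>] by simp
    finally show "(\<integral>x. d x * \<phi> (f x) \<partial>M) = (\<integral>x. (qp (f x) - qn (f x)) * \<phi> (f x) \<partial>M)" .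
  qed
qed

lemma integrable_mult_L2:
  fixes g h :: "'a \<Rightarrow> real"
  assumes [measurable]: "g \<in> borel_measurable M" "h \<in> borel_measurable M"
    and "integrable M (\<lambda>x. (g x)\<^sup>2)" "integrable M (\<lambda>x. (h x)\<^sup>2)"
  shows "integrable M (\<lambda>x. g x * h x)"
proof (rule Bochner_Integration.integrable_bound[of _ "\<lambda>x. (g x)\<^sup>2 + (h x)\<^sup>2"])
  have "\<bar>a * b\<bar> \<le> a\<^sup>2 + b\<^sup>2" for a b :: real
  proof -
    have "2 * (\<bar>a\<bar> * \<bar>b\<bar>) \<le> a\<^sup>2 + b\<^sup>2"
      using sum_squares_bound[of "\<bar>a\<bar>" "\<bar>b\<bar>"] by simp
    moreover have "0 \<le> \<bar>a\<bar> * \<bar>b\<bar>" by simp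
    ultimately show ?thesis by (simp only: abs_mult)
  qed
  then show "AE x in M. norm (g x * h x) \<le> norm ((g x)\<^sup>2 + (h x)\<^sup>2)"
    by (simp add: sum_power2_ge_zero)
qed (use assms in auto)

text \<open>\<open>e \<circ> f\<close> is the conditional expectation of \<open>d\<close> given \<open>f\<close>; truncating \<open>e\<close> shows that it is the
  orthogonal projection of \<open>d\<close> in \<open>L\<^sup>2\<close>.\<close>

lemma AE_eq_pushforward_density:
  fixes d :: "'a \<Rightarrow> real" and e :: "'b \<Rightarrow> real"
  assumes f [measurable]: "f \<in> measurable M N" and M: "finite_measure M"
    and d: "integrable M d" "integrable M (\<lambda>x. (d x)\<^sup>2)"
    and e [measurable]: "e \<in> borel_measurable N" and ie: "integrable M (\<lambda>x. e (f x))"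
    and de: "\<And>\<phi> B. \<phi> \<in> borel_measurable N \<Longrightarrow> (\<And>y. \<bar>\<phi> y\<bar> \<le> B) \<Longrightarrow>
       (\<integral>x. d x * \<phi> (f x) \<partial>M) = (\<integral>x. e (f x) * \<phi> (f x) \<partial>M)"
    and eq: "(\<integral>x. (e (f x))\<^sup>2 \<partial>M) = (\<integral>x. (d x)\<^sup>2 \<partial>M)"
  shows "AE x in M. d x = e (f x)"
proof -
  interpret M: finite_measure M by (rule M)
  have [measurable]: "d \<in> borel_measurable M" using d by auto
  \<comment> \<open>Square integrability of \<open>e \<circ> f\<close> is not known yet, so
    \<open>e\<close> is cut off to become a bounded test function. Cutting off to 0 instead of to
    \<open>k\<close> gives \<open>(\<phi> k y)\<^sup>2 = e y * \<phi> k y\<close>.\<close>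
  define \<phi> where "\<phi> = (\<lambda>k y. if \<bar>e y\<bar> \<le> real k then e y else 0)"
  have m\<phi> [measurable]: "\<phi> k \<in> borel_measurable N" for k
    unfolding \<phi>_def by measurable
  have b\<phi>: "\<bar>\<phi> k y\<bar> \<le> real k" for k y by (auto simp: \<phi>_def)
  have sq: "(\<phi> k y)\<^sup>2 = e y * \<phi> k y" for k y by (auto simp: \<phi>_def power2_eq_square)
  have i\<phi>: "integrable M (\<lambda>x. (\<phi> k (f x))\<^sup>2)" for k
    by (rule M.integrable_const_bound[where B = "(real k)\<^sup>2"])
       (auto intro!: AE_I2 simp: power2_le_iff_abs_le b\<phi>)
  have id\<phi>: "integrable M (\<lambda>x. d x * \<phi> k (f x))" for k
    by (rule integrable_mult_L2) (use d i\<phi> in auto)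
  have d\<phi>: "(\<integral>x. d x * \<phi> k (f x) \<partial>M) = (\<integral>x. (\<phi> k (f x))\<^sup>2 \<partial>M)" for k
    using de[OF m\<phi> b\<phi>, of k] by (simp add: sq)
  \<comment> \<open>Bessel's inequality, uniform in \<open>k\<close>; monotone convergence then
    shows that \<open>e \<circ> f\<close> is square integrable.\<close>
  have le: "(\<integral>x. (\<phi> k (f x))\<^sup>2 \<partial>M) \<le> (\<integral>x. (d x)\<^sup>2 \<partial>M)" for k
  proof -
    have "0 \<le> (\<integral>x. (d x - \<phi> k (f x))\<^sup>2 \<partial>M)" by simp
    also have "\<dots> = (\<integral>x. (d x)\<^sup>2 + (\<phi> k (f x))\<^sup>2 - 2 * (d x * \<phi> k (f x)) \<partial>M)"
      by (simp add: power2_diff mult.assoc)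
    also have "\<dots> = (\<integral>x. (d x)\<^sup>2 \<partial>M) - (\<integral>x. (\<phi> k (f x))\<^sup>2 \<partial>M)"
      using d i\<phi> id\<phi> by (simp add: d\<phi>)
    finally show ?thesis by simp
  qed
  have mono: "mono (\<lambda>k. (\<phi> k y)\<^sup>2)" for y
    by (rule monoI) (auto simp: \<phi>_def)
  have lim: "(\<lambda>k. \<phi> k y) \<longlonglongrightarrow> e y" for y
  proof (rule tendsto_eventually)
    obtain K :: nat where "\<bar>e y\<bar> \<le> real K" using real_arch_simple by blast
    then show "\<forall>\<^sub>F k in sequentially. \<phi> k y = e y"
      unfolding eventually_sequentially \<phi>_def by (intro exI[of _ K]) auto
  qed
  have "convergent (\<lambda>k. \<integral>x. (\<phi> k (f x))\<^sup>2 \<partial>M)"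
  proof (rule Bseq_mono_convergent)
    show "Bseq (\<lambda>k. \<integral>x. (\<phi> k (f x))\<^sup>2 \<partial>M)"
      by (rule BseqI'[of _ "\<integral>x. (d x)\<^sup>2 \<partial>M"]) (use le in simp)
    show "\<forall>m n. m \<le> n \<longrightarrow> (\<integral>x. (\<phi> m (f x))\<^sup>2 \<partial>M) \<le> (\<integral>x. (\<phi> n (f x))\<^sup>2 \<partial>M)"
      using mono by (intro allI impI integral_mono i\<phi>) (auto simp: mono_def)
  qed
  then obtain x where x: "(\<lambda>k. \<integral>x. (\<phi> k (f x))\<^sup>2 \<partial>M) \<longlonglongrightarrow> x" by (auto simp: convergent_def)
  have "AE x in M. (\<lambda>k. (\<phi> k (f x))\<^sup>2) \<longlonglongrightarrow> (e (f x))\<^sup>2"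
    by (intro AE_I2 tendsto_power lim)
  then have e2: "integrable M (\<lambda>x. (e (f x))\<^sup>2)" and x_eq: "(\<integral>x. (e (f x))\<^sup>2 \<partial>M) = x"
    using integral_monotone_convergence_nonneg[OF i\<phi> _ _ _ x, of "\<lambda>x. (e (f x))\<^sup>2"] mono
    by auto
  have de2: "integrable M (\<lambda>x. d x * e (f x))"
    by (rule integrable_mult_L2) (use d e2 in auto)
  have "(\<lambda>k. \<integral>x. d x * \<phi> k (f x) \<partial>M) \<longlonglongrightarrow> (\<integral>x. d x * e (f x) \<partial>M)"
  proof (rule integral_dominated_convergence[where w = "\<lambda>x. \<bar>d x * e (f x)\<bar>"])
    show "AE x in M. (\<lambda>k. d x * \<phi> k (f x)) \<longlonglongrightarrow> d x * e (f x)"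
      by (intro AE_I2 tendsto_intros lim)
    show "AE x in M. norm (d x * \<phi> k (f x)) \<le> \<bar>d x * e (f x)\<bar>" for k
      by (intro AE_I2) (auto simp: \<phi>_def)
  qed (use de2 in auto)
  then have "(\<integral>x. d x * e (f x) \<partial>M) = (\<integral>x. (e (f x))\<^sup>2 \<partial>M)"
    using x x_eq LIMSEQ_unique unfolding d\<phi> by blast
  \<comment> \<open>Pythagoras: the projection has the same norm as \<open>d\<close>, so the
    difference has norm 0.\<close>
  then have "(\<integral>x. (d x)\<^sup>2 + (e (f x))\<^sup>2 - 2 * (d x * e (f x)) \<partial>M) = 0"
    using d e2 de2 eq by simp
  then have 0: "(\<integral>x. (d x - e (f x))\<^sup>2 \<partial>M) = 0"
    by (simp add: power2_diff mult.assoc)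
  have "integrable M (\<lambda>x. (d x - e (f x))\<^sup>2)"
    using d e2 de2 by (simp add: power2_diff mult.assoc)
  then have "AE x in M. (d x - e (f x))\<^sup>2 = 0"
    using 0 by (subst (asm) integral_nonneg_eq_0_iff_AE) auto
  then show ?thesis by simp
qed

text \<open>The push-forward has as its density the projection of \<open>d\<close> onto functions of
  \<open>f\<close>. Equality of the Fisher metrics is thus the case in which a projection preserves
  the norm, that is, fixes \<open>d\<close>.\<close>

theorem fisher_metric_distr_eq_iff:
  fixes d :: "'a \<Rightarrow> real"
  assumes M: "finite_measure M" and f [measurable]: "f \<in> measurable M N"
    and d: "integrable M d" "integrable M (\<lambda>x. (d x)\<^sup>2)"
    and \<sigma>: "\<And>A. A \<in> sets M \<Longrightarrow> \<sigma> A = (LINT x:A|M. d x)"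
  shows "fisher_metric (distr M N f) (signed_distr M f \<sigma>) (signed_distr M f \<sigma>) = fisher_metric M \<sigma> \<sigma>
    \<longleftrightarrow> (\<exists>e\<in>borel_measurable N. AE x in M. d x = e (f x))" (is "?F = _ \<longleftrightarrow> _")
proof -
  have md [measurable]: "d \<in> borel_measurable M" using d by auto
  have push: "?F = (\<integral>x. (e (f x))\<^sup>2 \<partial>M)"
    if e [measurable]: "e \<in> borel_measurable N" and ie: "integrable M (\<lambda>x. e (f x))"
      and B: "\<And>B. B \<in> sets N \<Longrightarrow> (\<integral>x. d x * indicator B (f x) \<partial>M) = (\<integral>x. e (f x) * indicator B (f x) \<partial>M)" for e
  proof -
    have "?F = (\<integral>y. (e y)\<^sup>2 \<partial>distr M N f)"
    proof (rule fisher_metric_eq)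
      show "finite_measure (distr M N f)" using finite_measure.finite_measure_distr[OF M f] .
      show "integrable (distr M N f) e" using ie by (subst integrable_distr_eq) auto
      fix A assume "A \<in> sets (distr M N f)"
      then have A [measurable]: "A \<in> sets N" by simp
      have "signed_distr M f \<sigma> A = (LINT x:(f -` A \<inter> space M)|M. d x)"
        unfolding signed_distr_def by (rule \<sigma>) measurable
      also have "\<dots> = (\<integral>x. d x * indicator A (f x) \<partial>M)"
        unfolding set_lebesgue_integral_def
        by (intro Bochner_Integration.integral_cong) (auto simp: indicator_def)
      also have "\<dots> = (\<integral>x. e (f x) * indicator A (f x) \<partial>M)" by (rule B[OF A])
      also have "\<dots> = (LINT y:A|distr M N f. e y)"
        unfolding set_lebesgue_integral_def by (subst integral_distr) (auto simp: mult.commute)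
      finally show "signed_distr M f \<sigma> A = (LINT y:A|distr M N f. e y)" .
    qed
    also have "\<dots> = (\<integral>x. (e (f x))\<^sup>2 \<partial>M)" by (subst integral_distr) auto
    finally show ?thesis .
  qed
  have base: "fisher_metric M \<sigma> \<sigma> = (\<integral>x. (d x)\<^sup>2 \<partial>M)" by (rule fisher_metric_eq[OF M d(1) \<sigma>])
  show ?thesis
  proof
    assume "\<exists>e\<in>borel_measurable N. AE x in M. d x = e (f x)"
    then obtain e where e [measurable]: "e \<in> borel_measurable N" and AE: "AE x in M. d x = e (f x)" by blast
    have "integrable M (\<lambda>x. e (f x))"
      using integrable_cong_AE[OF md _ AE] d(1) by simp
    moreover have "(\<integral>x. d x * indicator B (f x) \<partial>M) = (\<integral>x. e (f x) * indicator B (f x) \<partial>M)" if [measurable]: "B \<in> sets N" for B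
    proof (rule integral_cong_AE)
      show "AE x in M. d x * indicator B (f x) = e (f x) * indicator B (f x)"
        using AE by eventually_elim simp
    qed measurable
    ultimately have "?F = (\<integral>x. (e (f x))\<^sup>2 \<partial>M)"
      by (intro push e)
    also have "\<dots> = (\<integral>x. (d x)\<^sup>2 \<partial>M)"
      by (rule integral_cong_AE) (use AE in \<open>auto elim: eventually_mono\<close>)
    finally show "?F = fisher_metric M \<sigma> \<sigma>"
      by (simp add: base)
  next
    assume eq: "?F = fisher_metric M \<sigma> \<sigma>"
    obtain e where e: "e \<in> borel_measurable N" "integrable M (\<lambda>x. e (f x))"
      and de: "\<And>\<phi> B. \<phi> \<in> borel_measurable N \<Longrightarrow> (\<And>y. \<bar>\<phi> y\<bar> \<le> B) \<Longrightarrow>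
         (\<integral>x. d x * \<phi> (f x) \<partial>M) = (\<integral>x. e (f x) * \<phi> (f x) \<partial>M)"
      using pushforward_density_ex[OF M f d(1)] by blast
    have "(\<integral>x. d x * indicator B (f x) \<partial>M) = (\<integral>x. e (f x) * indicator B (f x) \<partial>M)" if "B \<in> sets N" for B
      by (rule de[of _ 1]) (use that in \<open>auto simp: indicator_def\<close>)
    from push[OF e this] have "(\<integral>x. (e (f x))\<^sup>2 \<partial>M) = (\<integral>x. (d x)\<^sup>2 \<partial>M)"
      using eq base by simp
    with f M d e de have "AE x in M. d x = e (f x)" by (rule AE_eq_pushforward_density)
    then show "\<exists>e\<in>borel_measurable N. AE x in M. d x = e (f x)" using e(1) by blast
  qed
qed

section \<open>The Bergman kernel and its scores\<close>

lemma Cauchy_Schwarz_integral: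
  fixes f g :: "'a \<Rightarrow> real"
  assumes [measurable]: "f \<in> borel_measurable M" "g \<in> borel_measurable M"
    and f: "integrable M (\<lambda>x. (f x)\<^sup>2)" and g: "integrable M (\<lambda>x. (g x)\<^sup>2)"
  shows "(\<integral>x. f x * g x \<partial>M)\<^sup>2 \<le> (\<integral>x. (f x)\<^sup>2 \<partial>M) * (\<integral>x. (g x)\<^sup>2 \<partial>M)"
proof -
  define A B C where "A = (\<integral>x. (f x)\<^sup>2 \<partial>M)" and "B = (\<integral>x. f x * g x \<partial>M)" and "C = (\<integral>x. (g x)\<^sup>2 \<partial>M)"
  have fg: "integrable M (\<lambda>x. f x * g x)" by (rule integrable_mult_L2) (use f g in auto)
  have quad: "0 \<le> A - 2 * t * B + t\<^sup>2 * C" for t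
  proof -
    have "0 \<le> (\<integral>x. (f x - t * g x)\<^sup>2 \<partial>M)" by simp
    also have "\<dots> = (\<integral>x. (f x)\<^sup>2 - 2 * t * (f x * g x) + t\<^sup>2 * (g x)\<^sup>2 \<partial>M)"
      by (intro Bochner_Integration.integral_cong refl) (simp add: power2_eq_square algebra_simps)
    also have "\<dots> = A - 2 * t * B + t\<^sup>2 * C"
      using f g fg by (simp add: A_def B_def C_def)
    finally show ?thesis .
  qed
  have C: "0 \<le> C" by (simp add: C_def)
  have "B\<^sup>2 \<le> A * C"
  proof (cases "C = 0")
    case True
    have "B = 0"
    proof (rule ccontr)
      assume "B \<noteq> 0"
      then show False using quad[of "(A + 1) / (2 * B)"] True by (simp add: field_simps)
    qed
    then show ?thesis using True by simp
  next
    case False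
    then have C: "0 < C" using C by simp
    have "0 \<le> C * (A - 2 * (B / C) * B + (B / C)\<^sup>2 * C)"
      by (rule mult_nonneg_nonneg[OF less_imp_le[OF C] quad])
    also have "\<dots> = A * C - B\<^sup>2"
      using C by (simp add: power2_eq_square field_simps)
    finally show ?thesis by simp
  qed
  then show ?thesis by (simp add: A_def B_def C_def)
qed

lemma borel_measurable_cnj [measurable (raw)]:
  "f \<in> borel_measurable M \<Longrightarrow> (\<lambda>x. cnj (f x)) \<in> borel_measurable M"
  by (rule measurable_compose[OF _ borel_measurable_continuous_onI[OF continuous_on_cnj[OF continuous_on_id]]])

lemma has_derivative_quadratic_remainder:
  fixes f :: "'a::real_normed_vector \<Rightarrow> real"
  assumes "R > 0" "\<And>w. w \<in> ball z R \<Longrightarrow> \<bar>f w\<bar> \<le> C * (norm (w - z))\<^sup>2"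
  shows "(f has_derivative (\<lambda>v. 0)) (at z)"
proof -
  have f0: "f z = 0" using assms(2)[of z] assms(1) by simp
  have "((\<lambda>w. (f w - f z - 0) /\<^sub>R norm (w - z)) \<longlongrightarrow> 0) (at z)"
  proof (rule Lim_null_comparison)
    show "\<forall>\<^sub>F w in at z. norm ((f w - f z - 0) /\<^sub>R norm (w - z)) \<le> C * norm (w - z)"
      unfolding eventually_at
    proof (intro exI[of _ R] conjI ballI impI)
      fix w assume w: "w \<noteq> z \<and> dist w z < R"
      then have "\<bar>f w\<bar> \<le> C * (norm (w - z))\<^sup>2" by (intro assms(2)) (simp add: dist_commute)
      then show "norm ((f w - f z - 0) /\<^sub>R norm (w - z)) \<le> C * norm (w - z)"
        using w by (simp add: f0 field_simps power2_eq_square)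
    qed (rule assms(1))
    show "((\<lambda>w. C * norm (w - z)) \<longlongrightarrow> 0) (at z)"
      by (auto intro!: tendsto_eq_intros)
  qed
  then show ?thesis by (simp add: has_derivative_at_within)
qed

section \<open>The Bergman space, its inner product and point evaluations\<close>

locale bergman_domain =
  fixes \<Omega> :: "(complex ^ 'n) set"
  assumes dom: "bounded_domain \<Omega>"
begin

lemma open_dom: "open \<Omega>" and connected_dom: "connected \<Omega>"   and bounded_dom: "bounded \<Omega>"
  using dom by (auto simp: bounded_domain_def)

lemma space_dV [simp]: "space (dV \<Omega>) = \<Omega>"
  by (simp add: dV_def space_restrict_space)

lemma borel_measurable_dV:
  "continuous_on \<Omega> h \<Longrightarrow> h \<in> borel_measurable (dV \<Omega>)"
  unfolding dV_def
  using borel_measurable_continuous_on_restrict[of \<Omega> h]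
  by (simp add: measurable_def space_restrict_space sets_restrict_space)

lemma finite_measure_dV: "finite_measure (dV \<Omega>)"
proof (rule finite_measureI)
  have "emeasure (dV \<Omega>) \<Omega> = emeasure lborel \<Omega>"
    unfolding dV_def using open_dom by (subst emeasure_restrict_space) auto
  then show "emeasure (dV \<Omega>) (space (dV \<Omega>)) \<noteq> \<infinity>"
    using emeasure_bounded_finite[OF bounded_dom] by simp
qed

abbreviation "A2 \<equiv> bergman_space \<Omega>"

definition "N2 h = (\<integral>\<xi>. (cmod (h \<xi>))\<^sup>2 \<partial>dV \<Omega>)"

definition "ip h g = (\<integral>\<xi>. h \<xi> * cnj (g \<xi>) \<partial>dV \<Omega>)"

lemma N2_nonneg: "0 \<le> N2 h"
  by (simp add: N2_def)

lemma A2_holomorphic: "h \<in> A2 \<Longrightarrow> holomorphic_fun_on h \<Omega>"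
  and A2_integrable: "h \<in> A2 \<Longrightarrow> integrable (dV \<Omega>) (\<lambda>\<xi>. (cmod (h \<xi>))\<^sup>2)"
  by (auto simp: bergman_space_def)

lemma A2_measurable: "h \<in> A2 \<Longrightarrow> h \<in> borel_measurable (dV \<Omega>)"
  by (intro borel_measurable_dV holomorphic_fun_on_continuous_on A2_holomorphic)

lemma A2_integrable_mult_cnj:
  assumes "h \<in> A2" "g \<in> A2"
  shows "integrable (dV \<Omega>) (\<lambda>\<xi>. h \<xi> * cnj (g \<xi>))"
proof -
  note [measurable] = A2_measurable[OF assms(1)] A2_measurable[OF assms(2)]
  have "integrable (dV \<Omega>) (\<lambda>\<xi>. cmod (h \<xi>) * cmod (g \<xi>))"
    by (rule integrable_mult_L2) (use assms A2_integrable in auto)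
  then show ?thesis
    by (rule Bochner_Integration.integrable_bound) (auto simp: norm_mult)
qed

lemma A2_bounded_holomorphic:
  assumes "holomorphic_fun_on h \<Omega>" "\<And>\<xi>. \<xi> \<in> \<Omega> \<Longrightarrow> cmod (h \<xi>) \<le> B"
  shows "h \<in> A2"
proof -
  interpret finite_measure "dV \<Omega>" by (rule finite_measure_dV)
  have [measurable]: "h \<in> borel_measurable (dV \<Omega>)"
    by (intro borel_measurable_dV holomorphic_fun_on_continuous_on assms)
  have "integrable (dV \<Omega>) (\<lambda>\<xi>. (cmod (h \<xi>))\<^sup>2)"
    by (rule integrable_const_bound[where B = "B\<^sup>2"])
       (auto intro!: AE_I2 power_mono assms)
  then show ?thesis using assms by (simp add: bergman_space_def)
qed

lemma A2_const: "(\<lambda>_. c) \<in> A2"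
  by (rule A2_bounded_holomorphic[OF holomorphic_fun_on_const order_refl])

lemma A2_component: "(\<lambda>z. z $ i) \<in> A2"
proof -
  obtain B where "\<And>z. z \<in> \<Omega> \<Longrightarrow> norm z \<le> B" using bounded_dom bounded_iff by metis
  then show ?thesis
    by (intro A2_bounded_holomorphic[where B = B, OF holomorphic_fun_on_component])
       (meson Finite_Cartesian_Product.norm_nth_le order_trans)
qed

lemma A2_add:
  assumes "h \<in> A2" "g \<in> A2"
  shows "(\<lambda>\<xi>. h \<xi> + g \<xi>) \<in> A2"
proof -
  note [measurable] = A2_measurable[OF assms(1)] A2_measurable[OF assms(2)]
  have "integrable (dV \<Omega>) (\<lambda>\<xi>. (cmod (h \<xi> + g \<xi>))\<^sup>2)"
  proof (rule Bochner_Integration.integrable_bound[of _ "\<lambda>\<xi>. 2 * (cmod (h \<xi>))\<^sup>2 + 2 * (cmod (g \<xi>))\<^sup>2"])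
    have "(cmod (a + b))\<^sup>2 \<le> 2 * (cmod a)\<^sup>2 + 2 * (cmod b)\<^sup>2" for a b
    proof -
      have "(cmod (a + b))\<^sup>2 \<le> (cmod a + cmod b)\<^sup>2" by (intro power_mono norm_triangle_ineq) simp
      also have "\<dots> \<le> 2 * (cmod a)\<^sup>2 + 2 * (cmod b)\<^sup>2"
        using sum_squares_bound[of "cmod a" "cmod b"] by (simp add: power2_sum)
      finally show ?thesis .
    qed
    then show "AE \<xi> in dV \<Omega>. norm ((cmod (h \<xi> + g \<xi>))\<^sup>2) \<le> norm (2 * (cmod (h \<xi>))\<^sup>2 + 2 * (cmod (g \<xi>))\<^sup>2)"
      by simp
  qed (use assms A2_integrable in auto)
  then show ?thesis
    using assms by (simp add: bergman_space_def holomorphic_fun_on_add)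
qed

lemma A2_cmult: "h \<in> A2 \<Longrightarrow> (\<lambda>\<xi>. c * h \<xi>) \<in> A2"
  by (simp add: bergman_space_def holomorphic_fun_on_cmult norm_mult power_mult_distrib)

lemma A2_diff: "h \<in> A2 \<Longrightarrow> g \<in> A2 \<Longrightarrow> (\<lambda>\<xi>. h \<xi> - g \<xi>) \<in> A2"
  using A2_add[OF _ A2_cmult[of g "-1"]] by simp

lemma ip_add_left: "h \<in> A2 \<Longrightarrow> k \<in> A2 \<Longrightarrow> g \<in> A2 \<Longrightarrow> ip (\<lambda>\<xi>. h \<xi> + k \<xi>) g = ip h g + ip k g"
  unfolding ip_def distrib_right by (simp add: A2_integrable_mult_cnj)

lemma ip_cmult_left: "ip (\<lambda>\<xi>. c * h \<xi>) g = c * ip h g"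
  unfolding ip_def by (simp add: mult.assoc)

lemma ip_diff_left: "h \<in> A2 \<Longrightarrow> k \<in> A2 \<Longrightarrow> g \<in> A2 \<Longrightarrow> ip (\<lambda>\<xi>. h \<xi> - k \<xi>) g = ip h g - ip k g"
  unfolding ip_def left_diff_distrib by (simp add: A2_integrable_mult_cnj)

lemma ip_cnj: "cnj (ip h g) = ip g h"
  unfolding ip_def using Bochner_Integration.integral_cnj[of "dV \<Omega>" "\<lambda>\<xi>. h \<xi> * cnj (g \<xi>)"]
  by (simp add: mult.commute del: Bochner_Integration.integral_cnj)

lemma ip_cmult_right: "ip h (\<lambda>\<xi>. c * g \<xi>) = cnj c * ip h g"
  using ip_cnj[of "\<lambda>\<xi>. c * g \<xi>" h] ip_cnj[of g h] by (simp add: ip_cmult_left flip: ip_cnj[of h])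

lemma ip_add_right:
  assumes "h \<in> A2" "k \<in> A2" "g \<in> A2"
  shows "ip g (\<lambda>\<xi>. h \<xi> + k \<xi>) = ip g h + ip g k"
  using ip_cnj[of "\<lambda>\<xi>. h \<xi> + k \<xi>" g] ip_cnj[of h g] ip_cnj[of k g] ip_add_left[OF assms]
  by (metis complex_cnj_add)

lemma ip_diff_right:
  assumes "h \<in> A2" "k \<in> A2" "g \<in> A2"
  shows "ip g (\<lambda>\<xi>. h \<xi> - k \<xi>) = ip g h - ip g k"
  using ip_cnj[of "\<lambda>\<xi>. h \<xi> - k \<xi>" g] ip_cnj[of h g] ip_cnj[of k g] ip_diff_left[OF assms]
  by (metis complex_cnj_diff)

lemma ip_self: "ip h h = of_real (N2 h)"
  unfolding ip_def N2_def
  by (subst integral_complex_of_real[symmetric]) (simp only: complex_norm_square)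

lemma N2_cmult: "N2 (\<lambda>\<xi>. c * h \<xi>) = (cmod c)\<^sup>2 * N2 h"
  by (simp add: N2_def norm_mult power_mult_distrib)

lemma N2_add:
  assumes "g \<in> A2" "h \<in> A2"
  shows "N2 (\<lambda>\<xi>. g \<xi> + h \<xi>) = N2 g + 2 * Re (ip h g) + N2 h"
proof -
  have "of_real (N2 (\<lambda>\<xi>. g \<xi> + h \<xi>)) = ip g g + ip h g + (ip g h + ip h h)"
    using assms by (simp add: ip_self[symmetric] ip_add_left ip_add_right A2_add)
  also have "\<dots> = of_real (N2 g) + (ip h g + cnj (ip h g)) + of_real (N2 h)"
    by (simp add: ip_self ip_cnj)
  also have "\<dots> = of_real (N2 g + 2 * Re (ip h g) + N2 h)"
    by (simp add: complex_add_cnj)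
  finally show ?thesis using of_real_eq_iff by blast
qed

lemma N2_diff:
  assumes "g \<in> A2" "h \<in> A2"
  shows "N2 (\<lambda>\<xi>. g \<xi> - h \<xi>) = N2 g - 2 * Re (ip h g) + N2 h"
proof -
  have "(\<lambda>\<xi>. g \<xi> - h \<xi>) = (\<lambda>\<xi>. g \<xi> + (- 1) * h \<xi>)" by simp
  then show ?thesis
    by (simp only: N2_add[OF assms(1) A2_cmult[OF assms(2)]] ip_cmult_left N2_cmult) simp
qed

lemma norm_ip_le:
  assumes "h \<in> A2" "g \<in> A2"
  shows "cmod (ip h g) \<le> sqrt (N2 h) * sqrt (N2 g)"
proof -
  note [measurable] = A2_measurable[OF assms(1)] A2_measurable[OF assms(2)]
  have "cmod (ip h g) \<le> (\<integral>\<xi>. cmod (h \<xi>) * cmod (g \<xi>) \<partial>dV \<Omega>)"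
    unfolding ip_def using integral_norm_bound[of "dV \<Omega>" "\<lambda>\<xi>. h \<xi> * cnj (g \<xi>)"]
    by (simp add: norm_mult)
  also have "\<dots> \<le> sqrt (N2 h * N2 g)"
    unfolding N2_def using assms A2_integrable
    by (intro real_le_rsqrt Cauchy_Schwarz_integral) auto
  finally show ?thesis by (simp add: real_sqrt_mult)
qed

text \<open>Cauchy-Schwarz applied to the bump mean value.\<close>

lemma evaluation_bound:
  assumes z: "z \<in> \<Omega>"
  shows "\<exists>R>0. \<exists>C\<ge>0. ball z R \<subseteq> \<Omega> \<and> (\<forall>h\<in>A2. \<forall>w\<in>ball z R. cmod (h w) \<le> C * sqrt (N2 h))"
proof -
  interpret finite_measure "dV \<Omega>" by (rule finite_measure_dV)
  obtain R where R: "R > 0" "cball z R \<subseteq> \<Omega>" using open_dom z open_contains_cball by blast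
  define r where "r = R / 2"
  have r: "0 < r" using R by (simp add: r_def)
  define c where "c = (\<integral>x. bump r (x :: complex ^ 'n) \<partial>lborel)"
  have c: "0 < c" unfolding c_def by (rule integral_bump_pos[OF r])
  define V where "V = measure (dV \<Omega>) \<Omega>"
  have V: "0 \<le> V" by (simp add: V_def)
  \<comment> \<open>In the constant, \<open>r ^ 4\<close> bounds the bump, \<open>V\<close> is the
    volume of the domain, and \<open>c\<close> is the mass of the bump.\<close>
  have "cmod (h w) \<le> (r ^ 4 * sqrt V / c) * sqrt (N2 h)" if h: "h \<in> A2" and w: "w \<in> ball z r" for h w
  proof -
    have sub: "cball w r \<subseteq> \<Omega>"
    proof
      fix x assume "x \<in> cball w r"
      then have "dist z x \<le> R"
        using w dist_triangle[of z x w] by (simp add: r_def)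
      then show "x \<in> \<Omega>" using R by auto
    qed
    note hol = A2_holomorphic[OF h]
    have [measurable]: "h \<in> borel_measurable (dV \<Omega>)" by (rule A2_measurable[OF h])
    have [measurable]: "(\<lambda>x. bump r (x - w)) \<in> borel_measurable (dV \<Omega>)"
      by (intro borel_measurable_dV continuous_intros)
    have b4: "(bump r (x - w))\<^sup>2 \<le> (r ^ 4)\<^sup>2" for x
    proof -
      have "max 0 (r\<^sup>2 - (x - w) \<bullet> (x - w)) \<le> r\<^sup>2" by simp
      then have "bump r (x - w) \<le> (r\<^sup>2)\<^sup>2" unfolding bump_def by (intro power_mono) auto
      then show ?thesis by (intro power_mono bump_nonneg) (simp add: power_mult[symmetric])
    qed
    have int: "integrable (dV \<Omega>) (\<lambda>x. (bump r (x - w))\<^sup>2)"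
      by (rule integrable_const_bound[where B = "(r ^ 4)\<^sup>2"]) (use b4 in auto)
    have "(\<integral>x. (bump r (x - w))\<^sup>2 \<partial>dV \<Omega>) \<le> (\<integral>x. (r ^ 4)\<^sup>2 \<partial>dV \<Omega>)"
      by (intro integral_mono int b4) simp
    then have b: "(\<integral>x. (bump r (x - w))\<^sup>2 \<partial>dV \<Omega>) \<le> (r ^ 4)\<^sup>2 * V"
      by (simp add: V_def mult.commute)
    have "c * cmod (h w) = cmod (c *\<^sub>R h w)" using c by simp
    also have "c *\<^sub>R h w = (\<integral>x. bump r (x - w) *\<^sub>R h x \<partial>lborel)"
      unfolding c_def
      by (rule bump_mean_value[OF r sub holomorphic_fun_on_continuous_on[OF hol]
            holomorphic_fun_on_line_holomorphic_on[OF hol], symmetric])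
    also have "\<dots> = (\<integral>x. indicator \<Omega> x *\<^sub>R (bump r (x - w) *\<^sub>R h x) \<partial>lborel)"
    proof (rule Bochner_Integration.integral_cong[OF refl])
      fix x
      show "bump r (x - w) *\<^sub>R h x = indicator \<Omega> x *\<^sub>R (bump r (x - w) *\<^sub>R h x)"
      proof (cases "x \<in> \<Omega>")
        case False
        then have "x \<notin> cball w r" using sub by blast
        then have "x - w \<notin> cball 0 r" by (simp add: dist_norm norm_minus_commute)
        then have "bump r (x - w) = 0" by (rule bump_eq_0[OF r])
        then show ?thesis by simp
      qed simp
    qed
    also have "\<dots> = (\<integral>x. bump r (x - w) *\<^sub>R h x \<partial>dV \<Omega>)"
      unfolding dV_def by (subst integral_restrict_space) (use open_dom in auto)
    also have "cmod \<dots> \<le> (\<integral>x. bump r (x - w) * cmod (h x) \<partial>dV \<Omega>)"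
      using integral_norm_bound[of "dV \<Omega>" "\<lambda>x. bump r (x - w) *\<^sub>R h x"] by (simp add: bump_nonneg)
    also have "\<dots> \<le> sqrt ((\<integral>x. (bump r (x - w))\<^sup>2 \<partial>dV \<Omega>) * N2 h)"
      unfolding N2_def using int A2_integrable[OF h]
      by (intro real_le_rsqrt Cauchy_Schwarz_integral) auto
    also have "\<dots> \<le> sqrt ((r ^ 4)\<^sup>2 * V * N2 h)"
      using b N2_nonneg by (intro real_sqrt_le_mono mult_right_mono)
    also have "\<dots> = r ^ 4 * sqrt V * sqrt (N2 h)"
      using r by (simp only: real_sqrt_mult real_sqrt_abs) simp
    finally show ?thesis using c by (simp add: field_simps)
  qed
  moreover have "ball z r \<subseteq> \<Omega>" using R by (auto simp: r_def subset_iff)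
  ultimately show ?thesis
    using r c V by (intro exI[of _ r] conjI exI[of _ "r ^ 4 * sqrt V / c"]) auto
qed

lemma A2_lipschitz:
  assumes z: "z \<in> \<Omega>"
  shows "\<exists>R>0. \<exists>C\<ge>0. ball z R \<subseteq> \<Omega> \<and>
    (\<forall>h\<in>A2. \<forall>w\<in>ball z R. \<forall>w'\<in>ball z R. cmod (h w - h w') \<le> C * sqrt (N2 h) * norm (w - w'))"
proof -
  obtain R C where R: "R > 0" "ball z R \<subseteq> \<Omega>" and C: "C \<ge> 0"
    and ev: "\<And>h w. h \<in> A2 \<Longrightarrow> w \<in> ball z R \<Longrightarrow> cmod (h w) \<le> C * sqrt (N2 h)"
    using evaluation_bound[OF z] by blast
  have "cmod (h w - h w') \<le> 4 * C / R * sqrt (N2 h) * norm (w - w')"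
    if h: "h \<in> A2" and w: "w \<in> ball z (R / 2)" "w' \<in> ball z (R / 2)" for h w w'
    using holomorphic_fun_on_lipschitz[OF holomorphic_fun_on_subset[OF A2_holomorphic[OF h] R(2)] R(1) ev[OF h] w]
    by simp
  moreover have "ball z (R / 2) \<subseteq> \<Omega>" using R by (auto simp: subset_iff)
  ultimately show ?thesis
    using R C by (intro exI[of _ "R / 2"] conjI exI[of _ "4 * C / R"]) auto
qed

text \<open>This takes the place of completeness. By the evaluation bound the functions are locally
  uniformly bounded, so the pointwise limit is holomorphic; Fatou's lemma bounds its norm.\<close>

lemma A2_limit:
  assumes h: "\<And>n. h n \<in> A2" and B: "\<And>n. N2 (h n) \<le> B"
    and lim: "\<And>z. z \<in> \<Omega> \<Longrightarrow> (\<lambda>n. h n z) \<longlonglongrightarrow> k z"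
  shows "k \<in> A2" and "N2 k \<le> B"
proof -
  have B0: "0 \<le> B" using N2_nonneg[of "h 0"] B[of 0] by simp
  have k: "holomorphic_fun_on k \<Omega>"
  proof (rule holomorphic_fun_on_limit[OF open_dom A2_holomorphic[OF h] _ lim])
    fix z assume "z \<in> \<Omega>"
    then obtain R C where R: "R > 0" and C: "C \<ge> 0"
      and ev: "\<And>h w. h \<in> A2 \<Longrightarrow> w \<in> ball z R \<Longrightarrow> cmod (h w) \<le> C * sqrt (N2 h)"
      using evaluation_bound by blast
    have "cmod (h n w) \<le> C * sqrt B" if "w \<in> ball z R" for n w
      using ev[OF h that, of n] mult_left_mono[OF real_sqrt_le_mono[OF B[of n]] C] by linarith
    then show "\<exists>R>0. \<exists>B. \<forall>n. \<forall>w\<in>ball z R \<inter> \<Omega>. cmod (h n w) \<le> B"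
      using R by blast
  qed
  have mk [measurable]: "k \<in> borel_measurable (dV \<Omega>)"
    by (intro borel_measurable_dV holomorphic_fun_on_continuous_on k)
  have [measurable]: "h n \<in> borel_measurable (dV \<Omega>)" for n by (rule A2_measurable[OF h])
  have "(\<integral>\<^sup>+\<xi>. ennreal ((cmod (k \<xi>))\<^sup>2) \<partial>dV \<Omega>) = (\<integral>\<^sup>+\<xi>. liminf (\<lambda>n. ennreal ((cmod (h n \<xi>))\<^sup>2)) \<partial>dV \<Omega>)"
  proof (rule nn_integral_cong)
    fix \<xi> assume "\<xi> \<in> space (dV \<Omega>)"
    then have "(\<lambda>n. ennreal ((cmod (h n \<xi>))\<^sup>2)) \<longlonglongrightarrow> ennreal ((cmod (k \<xi>))\<^sup>2)"
      using lim[of \<xi>] by (intro tendsto_intros) auto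
    then show "ennreal ((cmod (k \<xi>))\<^sup>2) = liminf (\<lambda>n. ennreal ((cmod (h n \<xi>))\<^sup>2))"
      by (rule lim_imp_Liminf[OF sequentially_bot, symmetric])
  qed
  also have "\<dots> \<le> liminf (\<lambda>n. \<integral>\<^sup>+\<xi>. ennreal ((cmod (h n \<xi>))\<^sup>2) \<partial>dV \<Omega>)"
    by (rule nn_integral_liminf) measurable
  also have "\<dots> = liminf (\<lambda>n. ennreal (N2 (h n)))"
    unfolding N2_def using A2_integrable[OF h] by (simp add: nn_integral_eq_integral)
  also have "\<dots> \<le> liminf (\<lambda>n. ennreal B)"
    using B by (intro Liminf_mono always_eventually allI ennreal_leI)
  also have "\<dots> = ennreal B" by (rule Liminf_const[OF sequentially_bot])
  finally have le: "(\<integral>\<^sup>+\<xi>. ennreal ((cmod (k \<xi>))\<^sup>2) \<partial>dV \<Omega>) \<le> ennreal B" .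
  also have "\<dots> < \<infinity>" by simp
  finally have int: "integrable (dV \<Omega>) (\<lambda>\<xi>. (cmod (k \<xi>))\<^sup>2)"
    by (intro integrableI_bounded) auto
  then show "k \<in> A2" using k by (simp add: bergman_space_def)
  show "N2 k \<le> B"
    using le int B0 unfolding N2_def by (simp add: nn_integral_eq_integral)
qed

text \<open>The representing element of the evaluation at \<open>z\<close> is a multiple of the element of least norm
  among those with value 1 at \<open>z\<close>.\<close>

lemma least_norm_element:
  assumes z: "z \<in> \<Omega>"
  obtains g where "g \<in> A2" "g z = 1" "\<And>h. h \<in> A2 \<Longrightarrow> h z = 1 \<Longrightarrow> N2 g \<le> N2 h"
proof -
  define S where "S = {h \<in> A2. h z = 1}"
  define m where "m = Inf (N2 ` S)"
  have S1: "(\<lambda>_. 1) \<in> S" by (simp add: S_def A2_const)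
  have bdd: "bdd_below (N2 ` S)" by (intro bdd_belowI[of _ 0]) (auto simp: N2_nonneg)
  have m_le: "m \<le> N2 h" if "h \<in> S" for h
    unfolding m_def using bdd that by (intro cInf_lower) auto
  have "\<exists>h\<in>S. N2 h < m + 1 / real (Suc n)" for n
    using cInf_lessD[of "N2 ` S" "m + 1 / real (Suc n)"] S1 unfolding m_def by auto
  then obtain h where h: "\<And>n. h n \<in> S" "\<And>n. N2 (h n) < m + 1 / real (Suc n)" by metis
  have hA: "h n \<in> A2" for n using h(1) by (simp add: S_def)
  \<comment> \<open>Parallelogram law: the midpoint of \<open>h i\<close> and \<open>h j\<close>
    also has value 1 at \<open>z\<close>, so its squared norm is at least \<open>m\<close>.\<close>
  have diff: "N2 (\<lambda>\<xi>. h i \<xi> - h j \<xi>) \<le> 2 / real (Suc i) + 2 / real (Suc j)" for i j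
  proof -
    have "(\<lambda>\<xi>. (1/2) * (h i \<xi> + h j \<xi>)) \<in> S"
      using h(1)[of i] h(1)[of j] A2_cmult[OF A2_add[OF hA[of i] hA[of j]], of "1/2"]
      unfolding S_def by simp
    from m_le[OF this] have "4 * m \<le> N2 (\<lambda>\<xi>. h i \<xi> + h j \<xi>)"
      by (simp only: N2_cmult) (simp add: power2_eq_square)
    then show ?thesis
      using h(2)[of i] h(2)[of j] by (simp add: N2_add[OF hA hA] N2_diff[OF hA hA])
  qed
  have "convergent (\<lambda>n. h n w)" if w: "w \<in> \<Omega>" for w
  proof -
    obtain C where C: "C \<ge> 0" "\<And>h. h \<in> A2 \<Longrightarrow> cmod (h w) \<le> C * sqrt (N2 h)"
      using evaluation_bound[OF w] by (metis centre_in_ball)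
    have "Cauchy (\<lambda>n. h n w)"
    proof (rule metric_CauchyI)
      fix e :: real assume e: "0 < e"
      \<comment> \<open>Squared norms below \<open>e'\<close> give values at \<open>w\<close> less
        than \<open>e\<close> apart; \<open>C + 1\<close> stays positive if
        \<open>C = 0\<close>.\<close>
      define e' where "e' = (e / (C + 1))\<^sup>2"
      have e': "0 < e'" using e C by (simp add: e'_def)
      obtain N :: nat where N: "4 / e' < N" using reals_Archimedean2 by blast
      show "\<exists>M. \<forall>i\<ge>M. \<forall>j\<ge>M. dist (h i w) (h j w) < e"
      proof (intro exI allI impI)
        fix i j assume ij: "N \<le> i" "N \<le> j"
        have small: "2 / real (Suc k) < e' / 2" if "N \<le> k" for k
        proof -
          have "4 / e' < real (Suc k)" using N that by linarith
          then show ?thesis using e' by (simp add: field_simps)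
        qed
        have "N2 (\<lambda>\<xi>. h i \<xi> - h j \<xi>) < e'"
          using diff[of i j] small[OF ij(1)] small[OF ij(2)] by linarith
        then have "sqrt (N2 (\<lambda>\<xi>. h i \<xi> - h j \<xi>)) < e / (C + 1)"
          using e C real_sqrt_less_mono unfolding e'_def by fastforce
        then have "(C + 1) * sqrt (N2 (\<lambda>\<xi>. h i \<xi> - h j \<xi>)) < e"
          using C by (simp add: field_simps)
        moreover have "C * sqrt (N2 (\<lambda>\<xi>. h i \<xi> - h j \<xi>)) \<le> (C + 1) * sqrt (N2 (\<lambda>\<xi>. h i \<xi> - h j \<xi>))"
          by (intro mult_right_mono) (simp_all add: N2_nonneg)
        ultimately show "dist (h i w) (h j w) < e"
          using C(2)[OF A2_diff[OF hA hA], of i j] by (simp add: dist_norm)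
      qed
    qed
    then show ?thesis by (rule Cauchy_convergent)
  qed
  then obtain g where g: "\<And>w. w \<in> \<Omega> \<Longrightarrow> (\<lambda>n. h n w) \<longlonglongrightarrow> g w"
    unfolding convergent_def by metis
  have tail: "g \<in> A2 \<and> N2 g \<le> m + 1 / real (Suc N)" for N
  proof -
    have "N2 (h (n + N)) \<le> m + 1 / real (Suc N)" for n
    proof -
      have "1 / real (Suc (n + N)) \<le> 1 / real (Suc N)" by (simp add: frac_le)
      then show ?thesis using h(2)[of "n + N"] by linarith
    qed
    from A2_limit[OF hA this LIMSEQ_ignore_initial_segment[OF g]] show ?thesis by blast
  qed
  have "g z = 1"
    using g[OF z] h(1) LIMSEQ_unique[OF _ tendsto_const[of 1]] by (simp add: S_def)
  moreover have "N2 g \<le> m"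
  proof (rule LIMSEQ_le_const)
    show "(\<lambda>N. m + 1 / real (Suc N)) \<longlonglongrightarrow> m"
      using tendsto_add[OF tendsto_const LIMSEQ_inverse_real_of_nat, of m] by (simp add: inverse_eq_divide)
  qed (use tail in blast)
  ultimately show thesis
    using that[of g] tail m_le order_trans unfolding S_def by blast
qed

text \<open>First variation: adding multiples of \<open>h\<close> keeps the value 1 at
  \<open>z\<close>, and a short step along \<open>- cnj (ip h g)\<close> would lower the
  norm.\<close>

lemma least_norm_orthogonal:
  assumes g: "g \<in> A2" "g z = 1" and least: "\<And>h. h \<in> A2 \<Longrightarrow> h z = 1 \<Longrightarrow> N2 g \<le> N2 h"
    and h: "h \<in> A2" "h z = 0"
  shows "ip h g = 0"
proof (rule ccontr)
  assume "ip h g \<noteq> 0"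
  then have P: "0 < (cmod (ip h g))\<^sup>2" by simp
  \<comment> \<open>The step length satisfies \<open>s * N2 h < 1\<close>, so the quadratic term
    cannot outweigh the linear one.\<close>
  define s where "s = 1 / (N2 h + 1)"
  have s: "0 < s" "s * N2 h < 1"
    using N2_nonneg[of h] by (simp_all add: s_def field_simps add_nonneg_pos)
  define t where "t = - of_real s * cnj (ip h g)"
  have "N2 g \<le> N2 (\<lambda>\<xi>. g \<xi> + t * h \<xi>)"
    by (rule least) (use g h in \<open>auto intro: A2_add A2_cmult\<close>)
  also have "\<dots> = N2 g + 2 * Re (t * ip h g) + (cmod t)\<^sup>2 * N2 h"
    by (simp only: N2_add[OF g(1) A2_cmult[OF h(1)]] ip_cmult_left N2_cmult)
  also have "t * ip h g = of_real (- s * (cmod (ip h g))\<^sup>2)"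
    unfolding t_def of_real_mult complex_norm_square by simp
  also have "(cmod t)\<^sup>2 = s\<^sup>2 * (cmod (ip h g))\<^sup>2"
    using s by (simp add: t_def norm_mult power_mult_distrib)
  finally have "0 \<le> s * (cmod (ip h g))\<^sup>2 * (s * N2 h - 2)"
    by (simp add: algebra_simps power2_eq_square)
  moreover have "s * (cmod (ip h g))\<^sup>2 * (s * N2 h - 2) < 0"
    using s P by (intro mult_pos_neg) auto
  ultimately show False by simp
qed

text \<open>The function \<open>h - h z * g\<close> vanishes at \<open>z\<close>, so it is
  orthogonal to \<open>g\<close>; division by \<open>N2 g\<close> then normalizes
  \<open>g\<close>.\<close>

lemma representing_element_ex:
  assumes z: "z \<in> \<Omega>"
  shows "\<exists>g. g \<in> A2 \<and> (\<forall>h\<in>A2. h z = ip h g)"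
proof -
  obtain g where g: "g \<in> A2" "g z = 1" and least: "\<And>h. h \<in> A2 \<Longrightarrow> h z = 1 \<Longrightarrow> N2 g \<le> N2 h"
    using least_norm_element[OF z] by metis
  have "N2 g \<noteq> 0"
  proof
    assume "N2 g = 0"
    moreover obtain C where "\<And>h. h \<in> A2 \<Longrightarrow> cmod (h z) \<le> C * sqrt (N2 h)"
      using evaluation_bound[OF z] by (metis centre_in_ball)
    ultimately show False using g by fastforce
  qed
  define k where "k = (\<lambda>\<xi>. of_real (1 / N2 g) * g \<xi>)"
  have "h z = ip h k" if h: "h \<in> A2" for h
  proof -
    have "ip (\<lambda>\<xi>. h \<xi> - h z * g \<xi>) g = 0"
      by (rule least_norm_orthogonal[OF g least]) (use g h in \<open>auto intro: A2_diff A2_cmult\<close>)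
    then have "ip h g = h z * of_real (N2 g)"
      by (simp add: ip_diff_left[OF h A2_cmult[OF g(1)] g(1)] ip_cmult_left ip_self)
    then show ?thesis
      using \<open>N2 g \<noteq> 0\<close> by (simp only: k_def ip_cmult_right) simp
  qed
  moreover have "k \<in> A2" unfolding k_def by (rule A2_cmult[OF g(1)])
  ultimately show ?thesis by blast
qed

section \<open>The kernel near and on the diagonal\<close>

abbreviation "K \<equiv> bergman_kernel \<Omega>"

lemma kernel_in_A2: "w \<in> \<Omega> \<Longrightarrow> (\<lambda>z. K z w) \<in> A2"
  and kernel_reproducing: "w \<in> \<Omega> \<Longrightarrow> h \<in> A2 \<Longrightarrow> ip h (\<lambda>z. K z w) = h w"
proof -
  assume w: "w \<in> \<Omega>"
  define g where "g = (SOME g. g \<in> A2 \<and> (\<forall>h\<in>A2. h w = (\<integral>\<xi>. h \<xi> * cnj (g \<xi>) \<partial>dV \<Omega>)))"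
  have "(\<lambda>z. K z w) = g"
    by (simp add: fun_eq_iff bergman_kernel_def g_def)
  moreover have "g \<in> A2 \<and> (\<forall>h\<in>A2. h w = (\<integral>\<xi>. h \<xi> * cnj (g \<xi>) \<partial>dV \<Omega>))"
    unfolding g_def using representing_element_ex[OF w] unfolding ip_def by (rule someI_ex)
  ultimately show "(\<lambda>z. K z w) \<in> A2" and "h \<in> A2 \<Longrightarrow> ip h (\<lambda>z. K z w) = h w"
    by (auto simp: ip_def)
qed

lemma kernel_cnj:
  assumes "z \<in> \<Omega>" "w \<in> \<Omega>"
  shows "cnj (K z w) = K w z"
  using kernel_reproducing[OF assms(1) kernel_in_A2[OF assms(2)]]
    kernel_reproducing[OF assms(2) kernel_in_A2[OF assms(1)]] ip_cnj by metis

lemma kernel_diagonal: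
  assumes "z \<in> \<Omega>"
  shows "K z z = of_real (N2 (\<lambda>w. K w z))"
  using kernel_reproducing[OF assms kernel_in_A2[OF assms]] by (simp add: ip_self)

text \<open>A vanishing diagonal value would make evaluation at \<open>z\<close> the zero
  functional, but the constant 1 belongs to \<open>A2\<close>.\<close>

lemma kernel_diagonal_pos:
  assumes z: "z \<in> \<Omega>"
  shows "0 < Re (K z z)"
proof -
  have "N2 (\<lambda>w. K w z) \<noteq> 0"
    using norm_ip_le[OF A2_const kernel_in_A2[OF z], of 1] kernel_reproducing[OF z A2_const, of 1] by auto
  then show ?thesis
    using kernel_diagonal[OF z] N2_nonneg[of "\<lambda>w. K w z"] by simp
qed

text \<open>For \<open>h = K(\<cdot>, w) - K(\<cdot>, z)\<close> the reproducing property gives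
  \<open>N2 h = h w - h z\<close>. The Lipschitz estimate bounds this by a multiple of
  \<open>sqrt (N2 h)\<close>, which can be cancelled; inserting the outcome once more yields the
  quadratic bound.\<close>

lemma kernel_lipschitz:
  assumes z: "z \<in> \<Omega>"
  shows "\<exists>R>0. \<exists>C\<ge>0. ball z R \<subseteq> \<Omega> \<and>
    (\<forall>w\<in>ball z R. sqrt (N2 (\<lambda>\<xi>. K \<xi> w - K \<xi> z)) \<le> C * norm (w - z)) \<and>
    (\<forall>w\<in>ball z R. cmod ((K w w - K w z) - (K z w - K z z)) \<le> C * (norm (w - z))\<^sup>2)"
proof -
  obtain R C where R: "R > 0" "ball z R \<subseteq> \<Omega>" and C: "C \<ge> 0"
    and L: "\<And>h w w'. h \<in> A2 \<Longrightarrow> w \<in> ball z R \<Longrightarrow> w' \<in> ball z R \<Longrightarrow>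
      cmod (h w - h w') \<le> C * sqrt (N2 h) * norm (w - w')"
    using A2_lipschitz[OF z] by blast
  have zz: "z \<in> ball z R" using R by simp
  have 1: "sqrt (N2 (\<lambda>\<xi>. K \<xi> w - K \<xi> z)) \<le> C * norm (w - z)" if w: "w \<in> ball z R" for w
  proof -
    have wO: "w \<in> \<Omega>" using w R by auto
    define h where "h = (\<lambda>\<xi>. K \<xi> w - K \<xi> z)"
    have h: "h \<in> A2" unfolding h_def by (intro A2_diff kernel_in_A2 wO z)
    have "of_real (N2 h) = ip h (\<lambda>\<xi>. K \<xi> w - K \<xi> z)" by (simp add: ip_self h_def)
    also have "\<dots> = h w - h z"
      by (simp add: ip_diff_right[OF kernel_in_A2[OF wO] kernel_in_A2[OF z] h] kernel_reproducing h wO z)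
    finally have "cmod (of_real (N2 h)) \<le> C * sqrt (N2 h) * norm (w - z)"
      using L[OF h w zz] by simp
    then have "sqrt (N2 h) * sqrt (N2 h) \<le> (C * norm (w - z)) * sqrt (N2 h)"
      using N2_nonneg[of h] by (simp add: mult_ac)
    then have "sqrt (N2 h) \<le> C * norm (w - z)" if "N2 h \<noteq> 0"
      using that N2_nonneg[of h] by (simp only: mult_le_cancel_right) (auto simp: less_le)
    then show ?thesis
      unfolding h_def[symmetric] using C by (cases "N2 h = 0") simp_all
  qed
  have 2: "cmod ((K w w - K w z) - (K z w - K z z)) \<le> C\<^sup>2 * (norm (w - z))\<^sup>2" if w: "w \<in> ball z R" for w
  proof -
    have wO: "w \<in> \<Omega>" using w R by auto
    have "cmod ((K w w - K w z) - (K z w - K z z)) \<le> C * sqrt (N2 (\<lambda>\<xi>. K \<xi> w - K \<xi> z)) * norm (w - z)"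
      using L[OF A2_diff[OF kernel_in_A2[OF wO] kernel_in_A2[OF z]] w zz] by simp
    also have "\<dots> \<le> C * (C * norm (w - z)) * norm (w - z)"
      using 1[OF w] C by (intro mult_right_mono mult_left_mono) auto
    finally show ?thesis by (simp add: power2_eq_square mult_ac)
  qed
  define C' where "C' = max C (C\<^sup>2)"
  have "C * norm (w - z) \<le> C' * norm (w - z)" "C\<^sup>2 * (norm (w - z))\<^sup>2 \<le> C' * (norm (w - z))\<^sup>2" for w
    unfolding C'_def by (intro mult_right_mono; simp)+
  note le1 = order_trans[OF 1 this(1)] and le2 = order_trans[OF 2 this(2)]
  show ?thesis
    by (rule exI[of _ R], intro conjI R(1), rule exI[of _ C'], intro conjI ballI R(2) le1 le2)
       (simp add: C'_def C le_max_iff_disj)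
qed

lemma has_derivative_kernel:
  assumes "z \<in> \<Omega>" "\<xi> \<in> \<Omega>"
  shows "((\<lambda>w. K w \<xi>) has_derivative frechet_derivative (\<lambda>w. K w \<xi>) (at z)) (at z)"
    and "frechet_derivative (\<lambda>w. K w \<xi>) (at z) (c *s v) = c * frechet_derivative (\<lambda>w. K w \<xi>) (at z) v"
  using holomorphic_fun_onD[OF A2_holomorphic[OF kernel_in_A2[OF assms(2)]] assms(1)] by auto

text \<open>By Hermitian symmetry \<open>K w w\<close> differs from
  \<open>2 * Re (K w z) - Re (K z z)\<close> only by a mixed second difference, which is
  quadratically small. This replaces a chain rule for the kernel in both variables.\<close>

lemma has_derivative_kernel_diagonal:
  assumes z: "z \<in> \<Omega>"
  shows "((\<lambda>w. Re (K w w)) has_derivative (\<lambda>v. 2 * Re (frechet_derivative (\<lambda>w. K w z) (at z) v))) (at z)"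
proof -
  obtain R C where R: "R > 0" "ball z R \<subseteq> \<Omega>"
    and C: "\<And>w. w \<in> ball z R \<Longrightarrow> cmod ((K w w - K w z) - (K z w - K z z)) \<le> C * (norm (w - z))\<^sup>2"
    using kernel_lipschitz[OF z] by blast
  define q where "q = (\<lambda>w. Re (K w w) - 2 * Re (K w z) + Re (K z z))"
  have "\<bar>q w\<bar> \<le> C * (norm (w - z))\<^sup>2" if w: "w \<in> ball z R" for w
  proof -
    have "w \<in> \<Omega>" using w R by auto
    then have "K z w = cnj (K w z)" using kernel_cnj z by metis
    then have "q w = Re ((K w w - K w z) - (K z w - K z z))" by (simp add: q_def)
    then show ?thesis using C[OF w] abs_Re_le_cmod order_trans by metis
  qed
  then have "(q has_derivative (\<lambda>v. 0)) (at z)"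
    by (rule has_derivative_quadratic_remainder[OF R(1)])
  moreover have "((\<lambda>w. 2 * Re (K w z) - Re (K z z)) has_derivative
      (\<lambda>v. 2 * Re (frechet_derivative (\<lambda>w. K w z) (at z) v))) (at z)"
    using has_derivative_Re[OF has_derivative_kernel(1)[OF z z]]
    using has_derivative_diff[OF has_derivative_mult_right[of _ _ _ 2] has_derivative_const] by fastforce
  ultimately have "((\<lambda>w. q w + (2 * Re (K w z) - Re (K z z))) has_derivative
      (\<lambda>v. 0 + 2 * Re (frechet_derivative (\<lambda>w. K w z) (at z) v))) (at z)"
    by (rule has_derivative_add)
  then show ?thesis by (simp add: q_def)
qed

section \<open>Scores of the Bergman model\<close>

definition "DK z v \<xi> = frechet_derivative (\<lambda>w. K w \<xi>) (at z) v"

text \<open>The derivative of \<open>ln (bergman_density \<Omega> z \<xi>)\<close> in \<open>z\<close>. At the zeros of the kernel the first term is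
  0 by the convention \<open>x / 0 = 0\<close>, which is harmless because the density vanishes to second order there.\<close>

definition "score z v \<xi> = 2 * Re (DK z v \<xi> / K z \<xi>) - 2 * Re (DK z v z) / Re (K z z)"

lemma bergman_density_nonneg:
  assumes "z \<in> \<Omega>"
  shows "0 \<le> bergman_density \<Omega> z \<xi>"
  using kernel_diagonal_pos[OF assms] by (simp add: bergman_density_def)

lemma frechet_derivative_bergman_density:
  assumes z: "z \<in> \<Omega>" and \<xi>: "\<xi> \<in> \<Omega>"
  shows "frechet_derivative (\<lambda>w. bergman_density \<Omega> w \<xi>) (at z) v = bergman_density \<Omega> z \<xi> * score z v \<xi>"
proof -
  have pos: "Re (K z z) \<noteq> 0" using kernel_diagonal_pos[OF z] by simp
  note dK = has_derivative_kernel(1)[OF z \<xi>]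
  have "((\<lambda>w. (Re (K w \<xi>))\<^sup>2 + (Im (K w \<xi>))\<^sup>2) has_derivative
     (\<lambda>v. 2 * Re (K z \<xi>) * Re (DK z v \<xi>) + 2 * Im (K z \<xi>) * Im (DK z v \<xi>))) (at z)"
    unfolding DK_def
    by (rule has_derivative_eq_rhs,
        rule has_derivative_add[OF has_derivative_power[OF has_derivative_Re[OF dK]]
          has_derivative_power[OF has_derivative_Im[OF dK]]])
       (simp add: fun_eq_iff algebra_simps)
  then have "((\<lambda>w. (cmod (K w \<xi>))\<^sup>2) has_derivative
     (\<lambda>v. 2 * Re (K z \<xi>) * Re (DK z v \<xi>) + 2 * Im (K z \<xi>) * Im (DK z v \<xi>))) (at z)"
    by (simp add: cmod_power2)
  from has_derivative_divide'[OF this has_derivative_kernel_diagonal[OF z] pos]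
  have "((\<lambda>w. bergman_density \<Omega> w \<xi>) has_derivative (\<lambda>v. ((2 * Re (K z \<xi>) * Re (DK z v \<xi>) + 2 * Im (K z \<xi>) * Im (DK z v \<xi>))
      * Re (K z z) - (cmod (K z \<xi>))\<^sup>2 * (2 * Re (DK z v z))) / (Re (K z z) * Re (K z z)))) (at z)"
    unfolding bergman_density_def DK_def .
  from fun_cong[OF frechet_derivative_at[OF this], of v, symmetric]
  have eq: "frechet_derivative (\<lambda>w. bergman_density \<Omega> w \<xi>) (at z) v
     = ((2 * Re (K z \<xi>) * Re (DK z v \<xi>) + 2 * Im (K z \<xi>) * Im (DK z v \<xi>))
      * Re (K z z) - (cmod (K z \<xi>))\<^sup>2 * (2 * Re (DK z v z))) / (Re (K z z) * Re (K z z))" .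
  \<comment> \<open>The squared modulus clears the quotient; at zeros of the kernel both sides are
    0.\<close>
  have "(cmod (K z \<xi>))\<^sup>2 * Re (DK z v \<xi> / K z \<xi>) = Re (K z \<xi>) * Re (DK z v \<xi>) + Im (K z \<xi>) * Im (DK z v \<xi>)"
  proof (cases "K z \<xi> = 0")
    case False
    then have "(cmod (K z \<xi>))\<^sup>2 \<noteq> 0" by simp
    then show ?thesis by (simp add: Re_divide cmod_power2 mult.commute)
  qed simp
  then have "2 * Re (K z \<xi>) * Re (DK z v \<xi>) + 2 * Im (K z \<xi>) * Im (DK z v \<xi>) = (cmod (K z \<xi>))\<^sup>2 * (2 * Re (DK z v \<xi> / K z \<xi>))"
    by simp
  moreover have "(N * (2 * s) * \<kappa> - N * (2 * a)) / (\<kappa> * \<kappa>) = N / \<kappa> * (2 * s - 2 * a / \<kappa>)"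
    if "\<kappa> \<noteq> 0" for N s a \<kappa> :: real
    using that by (simp add: field_simps)
  ultimately show ?thesis
    unfolding eq unfolding bergman_density_def score_def using pos by simp
qed

text \<open>\<open>cnj (DK z v)\<close> is the limit of the difference quotients of \<open>t \<mapsto> K (\<cdot>, z + t v)\<close>, which are bounded in \<open>A2\<close>.\<close>

lemma cnj_DK_in_A2:
  assumes z: "z \<in> \<Omega>"
  shows "(\<lambda>\<xi>. cnj (DK z v \<xi>)) \<in> A2"
proof -
  obtain R C where R: "R > 0" "ball z R \<subseteq> \<Omega>" and C: "C \<ge> 0"
    and L: "\<And>w. w \<in> ball z R \<Longrightarrow> sqrt (N2 (\<lambda>\<xi>. K \<xi> w - K \<xi> z)) \<le> C * norm (w - z)"
    using kernel_lipschitz[OF z] by blast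
  obtain N :: nat where N: "norm v / R < N" using reals_Archimedean2 by blast
  define m where "m = (\<lambda>n. real (n + N))"
  have "0 \<le> norm v / R" using R by simp
  then have N0: "0 < N" using N by (cases N) auto
  then have m: "0 < m n" for n unfolding m_def by simp
  have vm: "norm v / m n < R" for n
  proof -
    have "norm v / R < m n" using N unfolding m_def by linarith
    then show ?thesis using R m[of n] by (simp add: field_simps)
  qed
  define w where "w = (\<lambda>n. z + of_real (1 / m n) *s v)"
  have nw: "norm (w n - z) = norm v / m n" for n
    using m[of n] by (simp add: w_def norm_scale_vec norm_divide)
  have wR: "w n \<in> ball z R" for n
    using vm[of n] nw[of n] by (simp add: dist_norm norm_minus_commute)
  then have wO: "w n \<in> \<Omega>" for n using R by blast
  define q where "q = (\<lambda>n \<xi>. of_real (m n) * (K \<xi> (w n) - K \<xi> z))"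
  have qA: "q n \<in> A2" for n
    unfolding q_def by (intro A2_cmult A2_diff kernel_in_A2 wO z)
  have "N2 (q n) \<le> (C * norm v)\<^sup>2" for n
  proof -
    have "m n * sqrt (N2 (\<lambda>\<xi>. K \<xi> (w n) - K \<xi> z)) \<le> m n * (C * (norm v / m n))"
      using L[OF wR, of n] m[of n] nw[of n] by (intro mult_left_mono) auto
    then have "m n * sqrt (N2 (\<lambda>\<xi>. K \<xi> (w n) - K \<xi> z)) \<le> C * norm v" using m[of n] by simp
    then have "(m n * sqrt (N2 (\<lambda>\<xi>. K \<xi> (w n) - K \<xi> z)))\<^sup>2 \<le> (C * norm v)\<^sup>2"
      using m[of n] N2_nonneg by (intro power_mono) (auto simp: less_imp_le)
    then show ?thesis
      using N2_nonneg by (simp only: q_def N2_cmult) (simp add: power_mult_distrib)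
  qed
  moreover have "(\<lambda>n. q n \<xi>) \<longlonglongrightarrow> cnj (DK z v \<xi>)" if \<xi>: "\<xi> \<in> \<Omega>" for \<xi>
  proof -
    from tendsto_cnj[OF difference_quotient_tendsto[OF A2_holomorphic[OF kernel_in_A2[OF \<xi>]] z N0, of v]]
    have "(\<lambda>n. cnj (of_real (m n) * (K (w n) \<xi> - K z \<xi>))) \<longlonglongrightarrow> cnj (DK z v \<xi>)"
      unfolding w_def m_def DK_def .
    moreover have "cnj (of_real (m n) * (K (w n) \<xi> - K z \<xi>)) = q n \<xi>" for n
      using kernel_cnj[OF wO \<xi>, of n] kernel_cnj[OF z \<xi>] by (simp add: q_def)
    ultimately show ?thesis by simp
  qed
  ultimately show ?thesis by (rule A2_limit(1)[OF qA])
qed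

lemma continuous_on_DK: "z \<in> \<Omega> \<Longrightarrow> continuous_on \<Omega> (DK z v)"
  using continuous_on_cnj[OF holomorphic_fun_on_continuous_on[OF A2_holomorphic[OF cnj_DK_in_A2]]]
  by simp

lemma continuous_on_kernel_right:
  assumes z: "z \<in> \<Omega>"
  shows "continuous_on \<Omega> (K z)"
proof -
  have "continuous_on \<Omega> (\<lambda>\<xi>. cnj (K \<xi> z))"
    by (intro continuous_on_cnj holomorphic_fun_on_continuous_on A2_holomorphic kernel_in_A2 z)
  then show ?thesis
    by (rule continuous_on_eq) (simp add: kernel_cnj z)
qed

lemma measurable_kernel [measurable]:
  assumes z: "z \<in> \<Omega>"
  shows "K z \<in> borel_measurable (dV \<Omega>)" and "DK z v \<in> borel_measurable (dV \<Omega>)"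
    and "score z v \<in> borel_measurable (dV \<Omega>)" and "bergman_density \<Omega> z \<in> borel_measurable (dV \<Omega>)"
proof -
  show [measurable]: "K z \<in> borel_measurable (dV \<Omega>)" "DK z v \<in> borel_measurable (dV \<Omega>)"
    by (intro borel_measurable_dV continuous_on_kernel_right continuous_on_DK z)+
  show "score z v \<in> borel_measurable (dV \<Omega>)" "bergman_density \<Omega> z \<in> borel_measurable (dV \<Omega>)"
    unfolding score_def[abs_def] bergman_density_def[abs_def] by measurable
qed

lemma integrable_kernel_right:
  assumes z: "z \<in> \<Omega>"
  shows "integrable (dV \<Omega>) (\<lambda>\<xi>. (cmod (K z \<xi>))\<^sup>2)" "(\<integral>\<xi>. (cmod (K z \<xi>))\<^sup>2 \<partial>dV \<Omega>) = Re (K z z)"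
proof -
  have eq: "cmod (K z \<xi>) = cmod (K \<xi> z)" if "\<xi> \<in> space (dV \<Omega>)" for \<xi>
    using that kernel_cnj[OF z, of \<xi>] by (metis complex_mod_cnj space_dV)
  show "integrable (dV \<Omega>) (\<lambda>\<xi>. (cmod (K z \<xi>))\<^sup>2)"
    using A2_integrable[OF kernel_in_A2[OF z]]
    by (subst Bochner_Integration.integrable_cong[OF refl]) (use eq in auto)
  show "(\<integral>\<xi>. (cmod (K z \<xi>))\<^sup>2 \<partial>dV \<Omega>) = Re (K z z)"
    unfolding kernel_diagonal[OF z] N2_def
    by (subst Bochner_Integration.integral_cong[OF refl]) (use eq in auto)
qed

lemma finite_measure_bergman_model:
  assumes z: "z \<in> \<Omega>"
  shows "finite_measure (bergman_model \<Omega> z)"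
proof (rule finite_measureI)
  note [measurable] = measurable_kernel[OF z]
  have "emeasure (bergman_model \<Omega> z) \<Omega> = (\<integral>\<^sup>+\<xi>. ennreal (bergman_density \<Omega> z \<xi>) \<partial>dV \<Omega>)"
    unfolding bergman_model_def using sets.top[of "dV \<Omega>"]
    by (subst emeasure_density) (auto intro!: nn_integral_cong simp: indicator_def)
  also have "\<dots> = ennreal (\<integral>\<xi>. bergman_density \<Omega> z \<xi> \<partial>dV \<Omega>)"
    by (intro nn_integral_eq_integral)
       (auto simp: bergman_density_nonneg[OF z], simp add: bergman_density_def integrable_kernel_right(1)[OF z])
  finally show "emeasure (bergman_model \<Omega> z) (space (bergman_model \<Omega> z)) \<noteq> \<infinity>"
    by (simp add: bergman_model_def)
qed

text \<open>The factor \<open>(cmod (K z \<xi>))\<^sup>2\<close> of the density cancels the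
  denominator of the score. What remains is bounded by squares of the kernel and of its derivative,
  and both are integrable.\<close>

lemma integrable_score_power2:
  assumes z: "z \<in> \<Omega>"
  shows "integrable (bergman_model \<Omega> z) (\<lambda>\<xi>. (score z v \<xi>)\<^sup>2)"
proof -
  note [measurable] = measurable_kernel[OF z]
  define \<kappa> a where "\<kappa> = Re (K z z)" and "a = 2 * Re (DK z v z) / Re (K z z)"
  have \<kappa>: "0 < \<kappa>" unfolding \<kappa>_def by (rule kernel_diagonal_pos[OF z])
  have D2: "integrable (dV \<Omega>) (\<lambda>\<xi>. (cmod (DK z v \<xi>))\<^sup>2)"
    using A2_integrable[OF cnj_DK_in_A2[OF z, of v]] by simp
  have "integrable (dV \<Omega>) (\<lambda>\<xi>. bergman_density \<Omega> z \<xi> *\<^sub>R (score z v \<xi>)\<^sup>2)"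
  proof (rule Bochner_Integration.integrable_bound[of _ "\<lambda>\<xi>. (8 * (cmod (DK z v \<xi>))\<^sup>2 + 2 * a\<^sup>2 * (cmod (K z \<xi>))\<^sup>2) / \<kappa>"])
    show "integrable (dV \<Omega>) (\<lambda>\<xi>. (8 * (cmod (DK z v \<xi>))\<^sup>2 + 2 * a\<^sup>2 * (cmod (K z \<xi>))\<^sup>2) / \<kappa>)"
      using D2 integrable_kernel_right(1)[OF z] by simp
    show "(\<lambda>\<xi>. bergman_density \<Omega> z \<xi> *\<^sub>R (score z v \<xi>)\<^sup>2) \<in> borel_measurable (dV \<Omega>)" by measurable
    have "bergman_density \<Omega> z \<xi> * (score z v \<xi>)\<^sup>2 \<le> (8 * (cmod (DK z v \<xi>))\<^sup>2 + 2 * a\<^sup>2 * (cmod (K z \<xi>))\<^sup>2) / \<kappa>" for \<xi>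
    proof -
      define k D where "k = K z \<xi>" and "D = DK z v \<xi>"
      have "(cmod k)\<^sup>2 * (2 * Re (D / k) - a)\<^sup>2 \<le> 8 * (cmod D)\<^sup>2 + 2 * a\<^sup>2 * (cmod k)\<^sup>2"
      proof (cases "k = 0")
        case False
        have "(2 * Re (D / k) - a)\<^sup>2 \<le> 2 * (2 * Re (D / k))\<^sup>2 + 2 * a\<^sup>2"
          using sum_squares_bound[of "2 * Re (D / k)" "- a"] by (simp add: power2_diff)
        also have "\<dots> \<le> 8 * (cmod (D / k))\<^sup>2 + 2 * a\<^sup>2"
          using power_mono[OF abs_Re_le_cmod[of "D / k"], of 2] by (simp add: power_mult_distrib)
        finally have "(cmod k)\<^sup>2 * (2 * Re (D / k) - a)\<^sup>2 \<le> (cmod k)\<^sup>2 * (8 * (cmod (D / k))\<^sup>2 + 2 * a\<^sup>2)"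
          by (intro mult_left_mono) auto
        also have "\<dots> = 8 * (cmod D)\<^sup>2 + 2 * a\<^sup>2 * (cmod k)\<^sup>2"
          using False by (simp add: norm_divide field_simps)
        finally show ?thesis .
      qed simp
      then show ?thesis
        using \<kappa> by (simp add: bergman_density_def score_def k_def D_def \<kappa>_def a_def divide_right_mono)
    qed
    then show "AE \<xi> in dV \<Omega>. norm (bergman_density \<Omega> z \<xi> *\<^sub>R (score z v \<xi>)\<^sup>2)
        \<le> norm ((8 * (cmod (DK z v \<xi>))\<^sup>2 + 2 * a\<^sup>2 * (cmod (K z \<xi>))\<^sup>2) / \<kappa>)"
      using bergman_density_nonneg[OF z] \<kappa> by (intro AE_I2) (simp add: abs_mult)
  qed
  then show ?thesis
    unfolding bergman_model_def using bergman_density_nonneg[OF z]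
    by (subst integrable_density) auto
qed

text \<open>The model measure ignores exactly the zeros of \<open>K z\<close>, so that almost
  everywhere in the model becomes almost everywhere in \<open>dV \<Omega>\<close> off these
  zeros.\<close>

lemma bergman_sufficient_iff:
  assumes f: "f \<in> measurable (dV \<Omega>) N"
  shows "sufficient_for \<Omega> (bergman_model \<Omega>) (bergman_model_deriv \<Omega>) N f \<longleftrightarrow>
    (\<forall>z\<in>\<Omega>. \<forall>v. \<exists>e\<in>borel_measurable N. AE \<xi> in dV \<Omega>. K z \<xi> \<noteq> 0 \<longrightarrow> score z v \<xi> = e (f \<xi>))"
  unfolding sufficient_for_def
proof (intro ball_cong iff_allI refl)
  fix z v assume z: "z \<in> \<Omega>"
  note [measurable] = measurable_kernel[OF z] f
  have sets: "sets (bergman_model \<Omega> z) = sets (dV \<Omega>)" by (simp add: bergman_model_def)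
  have fm [measurable]: "f \<in> measurable (bergman_model \<Omega> z) N"
    unfolding bergman_model_def using f by simp
  have sm: "score z v \<in> borel_measurable (bergman_model \<Omega> z)"
    unfolding bergman_model_def by simp
  have "integrable (bergman_model \<Omega> z) (\<lambda>\<xi>. score z v \<xi> * 1)"
    by (rule integrable_mult_L2[OF sm _ integrable_score_power2[OF z]])
       (simp_all add: finite_measure.integrable_const[OF finite_measure_bergman_model[OF z]])
  then have int: "integrable (bergman_model \<Omega> z) (score z v)" by simp
  have "bergman_model_deriv \<Omega> z v A = (LINT \<xi>:A|bergman_model \<Omega> z. score z v \<xi>)"
    if "A \<in> sets (bergman_model \<Omega> z)" for A
  proof -
    have [measurable]: "A \<in> sets (dV \<Omega>)" using that sets by simp
    have "bergman_model_deriv \<Omega> z v A = (\<integral>\<xi>. bergman_density \<Omega> z \<xi> *\<^sub>R (indicator A \<xi> *\<^sub>R score z v \<xi>) \<partial>dV \<Omega>)"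
      unfolding bergman_model_deriv_def set_lebesgue_integral_def
      by (intro Bochner_Integration.integral_cong refl)
         (simp add: frechet_derivative_bergman_density[OF z])
    also have "\<dots> = (LINT \<xi>:A|bergman_model \<Omega> z. score z v \<xi>)"
      unfolding bergman_model_def set_lebesgue_integral_def
      using bergman_density_nonneg[OF z] by (subst integral_density) auto
    finally show ?thesis .
  qed
  from fisher_metric_distr_eq_iff[OF finite_measure_bergman_model[OF z] fm int integrable_score_power2[OF z] this]
  have "fisher_metric (distr (bergman_model \<Omega> z) N f)
       (signed_distr (bergman_model \<Omega> z) f (bergman_model_deriv \<Omega> z v))
       (signed_distr (bergman_model \<Omega> z) f (bergman_model_deriv \<Omega> z v)) =
      fisher_metric (bergman_model \<Omega> z) (bergman_model_deriv \<Omega> z v) (bergman_model_deriv \<Omega> z v)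
    \<longleftrightarrow> (\<exists>e\<in>borel_measurable N. AE \<xi> in bergman_model \<Omega> z. score z v \<xi> = e (f \<xi>))" .
  also have "\<dots> \<longleftrightarrow> (\<exists>e\<in>borel_measurable N. AE \<xi> in dV \<Omega>. K z \<xi> \<noteq> 0 \<longrightarrow> score z v \<xi> = e (f \<xi>))"
  proof (intro bex_cong refl)
    fix e :: "_ \<Rightarrow> real"
    have "0 < ennreal (bergman_density \<Omega> z \<xi>) \<longleftrightarrow> K z \<xi> \<noteq> 0" for \<xi>
      using kernel_diagonal_pos[OF z] by (simp add: bergman_density_def zero_less_divide_iff)
    then show "(AE \<xi> in bergman_model \<Omega> z. score z v \<xi> = e (f \<xi>)) \<longleftrightarrow>
        (AE \<xi> in dV \<Omega>. K z \<xi> \<noteq> 0 \<longrightarrow> score z v \<xi> = e (f \<xi>))"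
      unfolding bergman_model_def by (subst AE_density) auto
  qed
  finally show "fisher_metric (distr (bergman_model \<Omega> z) N f)
       (signed_distr (bergman_model \<Omega> z) f (bergman_model_deriv \<Omega> z v))
       (signed_distr (bergman_model \<Omega> z) f (bergman_model_deriv \<Omega> z v)) =
      fisher_metric (bergman_model \<Omega> z) (bergman_model_deriv \<Omega> z v) (bergman_model_deriv \<Omega> z v)
    \<longleftrightarrow> (\<exists>e\<in>borel_measurable N. AE \<xi> in dV \<Omega>. K z \<xi> \<noteq> 0 \<longrightarrow> score z v \<xi> = e (f \<xi>))" .
qed

text \<open>If the scores at \<open>\<xi>\<close> and \<open>\<eta>\<close> agree, then \<open>K z \<xi> / K z \<eta>\<close> is locally constant in \<open>z\<close>, hence
  constant, and evaluation at \<open>\<xi>\<close> is a multiple of evaluation at \<open>\<eta>\<close> on \<open>A2\<close>. Test it on 1 and on the coordinates.\<close>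

lemma eq_if_score_eq:
  assumes \<xi>: "\<xi> \<in> \<Omega>" and \<eta>: "\<eta> \<in> \<Omega>"
    and eq: "\<And>z v. z \<in> \<Omega> \<Longrightarrow> K z \<xi> \<noteq> 0 \<Longrightarrow> K z \<eta> \<noteq> 0 \<Longrightarrow> score z v \<xi> = score z v \<eta>"
  shows "\<xi> = \<eta>"
proof -
  have hol: "holomorphic_fun_on (\<lambda>z. K z \<zeta>) \<Omega>" if "\<zeta> \<in> \<Omega>" for \<zeta>
    by (rule A2_holomorphic[OF kernel_in_A2[OF that]])
  have nz: "K \<zeta> \<zeta> \<noteq> 0" if "\<zeta> \<in> \<Omega>" for \<zeta>
    using kernel_diagonal_pos[OF that] by auto
  define U where "U = {z \<in> \<Omega>. K z \<xi> \<noteq> 0}"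
  have opn: "open {z \<in> \<Omega>. K z \<zeta> \<noteq> 0}" if "\<zeta> \<in> \<Omega>" for \<zeta>
    by (rule open_Collect_nonzero[OF open_dom holomorphic_fun_on_continuous_on[OF hol[OF that]]])
  \<comment> \<open>If \<open>K z \<eta>\<close> were 0 for all \<open>z\<close> in the nonempty
    open set \<open>U\<close>, it would be 0 for all \<open>z\<close> in \<open>\<Omega>\<close>, in
    particular for \<open>z = \<eta>\<close>.\<close>
  have "\<exists>p\<in>U. K p \<eta> \<noteq> 0"
  proof (rule ccontr)
    assume "\<not> (\<exists>p\<in>U. K p \<eta> \<noteq> 0)"
    then have "K \<eta> \<eta> = 0"
      using holomorphic_fun_on_identity[OF open_dom connected_dom hol[OF \<eta>], of U \<eta>] opn[OF \<xi>] nz[OF \<xi>] \<xi> \<eta>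
      unfolding U_def by blast
    then show False using nz[OF \<eta>] by simp
  qed
  then obtain p where p: "p \<in> \<Omega>" "K p \<xi> \<noteq> 0" "K p \<eta> \<noteq> 0" by (auto simp: U_def)
  define W where "W = {z \<in> \<Omega>. K z \<xi> \<noteq> 0} \<inter> {z \<in> \<Omega>. K z \<eta> \<noteq> 0}"
  have "open W" unfolding W_def by (intro open_Int opn \<xi> \<eta>)
  moreover have "p \<in> W" using p by (simp add: W_def)
  ultimately obtain r where r: "r > 0" "ball p r \<subseteq> W" using open_contains_ball by blast
  have deq: "DK z v \<xi> / K z \<xi> = DK z v \<eta> / K z \<eta>" if z: "z \<in> W" for z v
  proof -
    have zO: "z \<in> \<Omega>" using z by (simp add: W_def)
    have Re_eq: "Re (DK z v \<xi> / K z \<xi>) = Re (DK z v \<eta> / K z \<eta>)" for v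
      using eq[of z v] z by (auto simp: W_def score_def)
    \<comment> \<open>Complex homogeneity turns the real part in direction \<open>\<i> *s v\<close>
      into minus the imaginary part in direction \<open>v\<close>.\<close>
    have i: "DK z (\<i> *s v) \<zeta> = \<i> * DK z v \<zeta>" if "\<zeta> \<in> \<Omega>" for \<zeta>
      unfolding DK_def by (rule has_derivative_kernel(2)[OF zO that])
    have "Re (\<i> * (DK z v \<xi> / K z \<xi>)) = Re (\<i> * (DK z v \<eta> / K z \<eta>))"
      using Re_eq[of "\<i> *s v"] i[OF \<xi>] i[OF \<eta>] by simp
    moreover have "A = B" if "Re A = Re B" "Re (\<i> * A) = Re (\<i> * B)" for A B
      using that by (simp add: complex_eq_iff)
    ultimately show ?thesis using Re_eq[of v] by blast
  qed
  define q where "q = (\<lambda>z. K z \<xi> / K z \<eta>)"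
  have "(q has_derivative (\<lambda>v. 0)) (at z within ball p r)" if z: "z \<in> ball p r" for z
  proof -
    have zW: "z \<in> W" using z r by blast
    then have zO: "z \<in> \<Omega>" and n: "K z \<xi> \<noteq> 0" "K z \<eta> \<noteq> 0" by (auto simp: W_def)
    have "(q has_derivative (\<lambda>v. (DK z v \<xi> * K z \<eta> - K z \<xi> * DK z v \<eta>) / (K z \<eta> * K z \<eta>))) (at z)"
      unfolding q_def DK_def
      by (rule has_derivative_divide'[OF has_derivative_kernel(1)[OF zO \<xi>] has_derivative_kernel(1)[OF zO \<eta>] n(2)])
    moreover have "DK z v \<xi> * K z \<eta> - K z \<xi> * DK z v \<eta> = 0" for v
      using deq[OF zW, of v] n by (simp add: field_simps)
    ultimately show ?thesis by (simp add: has_derivative_at_withinI)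
  qed
  then obtain c where c: "\<And>z. z \<in> ball p r \<Longrightarrow> q z = c"
    using has_derivative_zero_constant[of "ball p r" q] by (metis convex_ball)
  have Kc: "K z \<xi> = c * K z \<eta>" if z: "z \<in> \<Omega>" for z
  proof -
    have "K z \<xi> - c * K z \<eta> = 0"
    proof (rule holomorphic_fun_on_identity[OF open_dom connected_dom _ open_ball _ _ _ z])
      show "holomorphic_fun_on (\<lambda>z. K z \<xi> - c * K z \<eta>) \<Omega>"
        by (intro holomorphic_fun_on_diff holomorphic_fun_on_cmult hol \<xi> \<eta>)
      show "ball p r \<noteq> {}" using r(1) by simp
      show "ball p r \<subseteq> \<Omega>" using r(2) by (auto simp: W_def)
      fix z assume z: "z \<in> ball p r"
      then have "K z \<eta> \<noteq> 0" using r(2) by (auto simp: W_def)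
      then show "K z \<xi> - c * K z \<eta> = 0" using c[OF z] by (simp add: q_def field_simps)
    qed
    then show ?thesis by simp
  qed
  have ev: "h \<xi> = cnj c * h \<eta>" if h: "h \<in> A2" for h
  proof -
    have "h \<xi> = ip h (\<lambda>z. K z \<xi>)" by (simp add: kernel_reproducing[OF \<xi> h])
    also have "\<dots> = ip h (\<lambda>z. c * K z \<eta>)"
      unfolding ip_def by (intro Bochner_Integration.integral_cong refl) (simp add: Kc)
    also have "\<dots> = cnj c * h \<eta>" by (simp only: ip_cmult_right kernel_reproducing[OF \<eta> h])
    finally show ?thesis .
  qed
  have "cnj c = 1" using ev[OF A2_const[of 1]] by simp
  then have "\<xi> $ i = \<eta> $ i" for i using ev[OF A2_component[of i]] by simp
  then show ?thesis by (simp add: vec_eq_iff)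
qed

end

section \<open>Proper holomorphic maps\<close>

lemma Re_cnj_sum_eq_inner: "Re (\<Sum>i\<in>UNIV. x $ i * cnj (y $ i)) = x \<bullet> (y :: complex ^ 'n)"
  by (simp add: inner_vec_def inner_complex_def)

text \<open>Maximum modulus principle for \<open>exp (- L t)\<close>, whose value at the centre is
  1.\<close>

lemma not_Re_pos_on_circle:
  fixes L :: "complex \<Rightarrow> complex"
  assumes L: "L holomorphic_on ball 0 R" "L 0 = 0" and s: "0 < s" "s < R"
    and c: "0 < c" "\<And>t. cmod t = s \<Longrightarrow> c \<le> Re (L t)"
  shows False
proof -
  have sub: "cball 0 s \<subseteq> ball (0::complex) R" using s by auto
  have "cmod (exp (- L 0)) \<le> exp (- c)"
  proof (rule maximum_modulus_frontier[where S = "ball 0 s" and f = "\<lambda>t. exp (- L t)"])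
    show "(\<lambda>t. exp (- L t)) holomorphic_on interior (ball 0 s)"
    proof -
      have "L holomorphic_on ball 0 s"
        by (rule holomorphic_on_subset[OF L(1)]) (use s in auto)
      then show ?thesis by (auto intro!: holomorphic_intros)
    qed
    show "continuous_on (closure (ball 0 s)) (\<lambda>t. exp (- L t))"
      using continuous_on_subset[OF holomorphic_on_imp_continuous_on[OF L(1)] sub] s
      by (auto intro!: continuous_intros)
    fix t assume "t \<in> frontier (ball (0::complex) s)"
    then show "cmod (exp (- L t)) \<le> exp (- c)" using c(2)[of t] s by (simp add: norm_exp_eq_Re)
  qed (use s in auto)
  then show False using L(2) c(1) by simp
qed

text \<open>A local minimum of \<open>|f - w|\<^sup>2 - \<epsilon> |z|\<^sup>2\<close> has nonnegative Levi form, that is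
  \<open>|Df v|\<^sup>2 \<ge> \<epsilon> |v|\<^sup>2\<close>. This replaces the theory of analytic sets in proving that \<open>f\<close> has regular points
  and is surjective.\<close>

lemma Levi_local_min:
  fixes f :: "complex ^ 'n \<Rightarrow> complex ^ 'm"
  assumes \<Omega>: "open \<Omega>" and f: "holomorphic_map_on f \<Omega>" and q: "q \<in> \<Omega>" and \<epsilon>: "0 < \<epsilon>" and r: "0 < r"
    and min: "\<And>z. z \<in> ball q r \<Longrightarrow> (norm (f q - w))\<^sup>2 - \<epsilon> * (norm q)\<^sup>2 \<le> (norm (f z - w))\<^sup>2 - \<epsilon> * (norm z)\<^sup>2"
  shows "\<epsilon> * (norm v)\<^sup>2 \<le> (norm (frechet_derivative f (at q) v))\<^sup>2"
proof (rule ccontr)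
  define d where "d = frechet_derivative f (at q) v"
  assume "\<not> \<epsilon> * (norm v)\<^sup>2 \<le> (norm (frechet_derivative f (at q) v))\<^sup>2"
  then have less: "(norm d)\<^sup>2 < (sqrt \<epsilon> * norm v)\<^sup>2" using \<epsilon> by (simp add: d_def power_mult_distrib)
  then have "norm d < sqrt \<epsilon> * norm v"
    using power_less_imp_less_base \<epsilon> by fastforce
  then obtain k where k: "norm d < k" "k < sqrt \<epsilon> * norm v" using dense by blast
  have k0: "0 \<le> k" using k(1) norm_ge_zero[of d] by linarith
  have k2: "k\<^sup>2 < \<epsilon> * (norm v)\<^sup>2"
    using power_strict_mono[OF k(2) k0, of 2] \<epsilon> by (simp add: power_mult_distrib)
  define F where "F = (\<lambda>t. f (q + t *s v) - f q)"
  have "((\<lambda>t. f (q + t *s v)) has_derivative (\<lambda>t. frechet_derivative f (at q) (t *s v))) (at 0)"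
    using has_derivative_compose[OF has_derivative_line, of f _ q 0 v UNIV] holomorphic_map_onD(1)[OF f q] by simp
  then have "(F has_derivative (\<lambda>t. t *s d)) (at 0)"
    unfolding F_def d_def by (auto intro!: derivative_eq_intros simp: holomorphic_map_onD(2)[OF f q])
  then have "\<forall>e>0. \<exists>s>0. \<forall>t. norm (t - 0) < s \<longrightarrow> norm (F t - F 0 - (t - 0) *s d) \<le> e * norm (t - 0)"
    unfolding has_derivative_at_alt by blast
  from this[rule_format, of "k - norm d"]
  obtain s0 where s0: "s0 > 0" "\<And>t. cmod t < s0 \<Longrightarrow> norm (F t - t *s d) \<le> (k - norm d) * cmod t"
    using k(1) by (auto simp: F_def)
  obtain r0 where r0: "r0 > 0" "ball q r0 \<subseteq> \<Omega>" using \<Omega> q open_contains_ball by blast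
  define R where "R = min s0 (min r r0 / (norm v + 1))"
  have R: "0 < R" using s0 r r0 by (simp add: R_def add_nonneg_pos)
  have in_ball: "q + t *s v \<in> ball q r" "q + t *s v \<in> \<Omega>" if t: "cmod t < R" for t
  proof -
    have "norm (t *s v) \<le> cmod t * (norm v + 1)" by (simp add: norm_scale_vec mult_left_mono)
    also have "\<dots> < min r r0" 
      using t by (simp add: R_def pos_less_divide_eq add_nonneg_pos)
    finally show "q + t *s v \<in> ball q r" "q + t *s v \<in> \<Omega>" using r0 by (auto simp: dist_norm subset_iff)
  qed
  \<comment> \<open>\<open>Re (L t)\<close> collects those terms in the increment of
    \<open>(norm (f z - w))\<^sup>2 - \<epsilon> * (norm z)\<^sup>2\<close> along the line that are
    real parts of holomorphic functions. The other terms,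
    \<open>(norm (F t))\<^sup>2 - \<epsilon> * (norm (t *s v))\<^sup>2\<close>, are negative for
    small nonzero \<open>t\<close>, so minimality makes \<open>Re (L t)\<close> positive on small
    circles.\<close>
  define L where "L = (\<lambda>t. 2 * (\<Sum>i\<in>UNIV. F t $ i * cnj ((f q - w) $ i)) - 2 * of_real \<epsilon> * (\<Sum>i\<in>UNIV. (t *s v) $ i * cnj (q $ i)))"
  have holF: "(\<lambda>t. F t $ i) holomorphic_on ball 0 R" for i
  proof -
    have "holomorphic_fun_on (\<lambda>z. f z $ i) \<Omega>" using f by (simp add: holomorphic_map_on_def)
    from line_holomorphic_onD[OF holomorphic_fun_on_line_holomorphic_on[OF this], of "ball 0 R" q v]
    have "(\<lambda>t. f (q + t *s v) $ i) holomorphic_on ball 0 R" using in_ball by auto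
    then show ?thesis unfolding F_def by (auto intro!: holomorphic_intros)
  qed
  have holL: "L holomorphic_on ball 0 R"
    unfolding L_def vector_scalar_mult_def vec_lambda_beta by (intro holomorphic_intros holF)
  have L0: "L 0 = 0" by (simp add: L_def F_def)
  have ReL: "(\<epsilon> * (norm v)\<^sup>2 - k\<^sup>2) * (cmod t)\<^sup>2 \<le> Re (L t)" if t: "cmod t < R" for t
  proof -
    have "norm (F t) \<le> norm (F t - t *s d) + norm (t *s d)" using norm_triangle_sub[of "F t" "t *s d"] by (simp add: add.commute)
    also have "\<dots> \<le> k * cmod t"
      using s0(2)[of t] t by (simp add: R_def norm_scale_vec algebra_simps)
    finally have F2: "(norm (F t))\<^sup>2 \<le> k\<^sup>2 * (cmod t)\<^sup>2"
      using power_mono[of "norm (F t)" "k * cmod t" 2] by (simp add: power_mult_distrib)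
    have e1: "(norm (f (q + t *s v) - w))\<^sup>2 = (norm (f q - w))\<^sup>2 + 2 * (F t \<bullet> (f q - w)) + (norm (F t))\<^sup>2"
    proof -
      have "f (q + t *s v) - w = (f q - w) + F t" by (simp add: F_def)
      then show ?thesis
        by (simp only: power2_norm_eq_inner) (simp add: inner_add_left inner_add_right inner_commute)
    qed
    have e2: "(norm (q + t *s v))\<^sup>2 = (norm q)\<^sup>2 + 2 * ((t *s v) \<bullet> q) + (cmod t)\<^sup>2 * (norm v)\<^sup>2"
    proof -
      have "(norm (q + t *s v))\<^sup>2 = (norm q)\<^sup>2 + 2 * ((t *s v) \<bullet> q) + (norm (t *s v))\<^sup>2"
        by (simp only: power2_norm_eq_inner) (simp add: inner_add_left inner_add_right inner_commute)
      then show ?thesis by (simp add: norm_scale_vec power_mult_distrib)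
    qed
    have "Re (L t) = 2 * (F t \<bullet> (f q - w)) - 2 * \<epsilon> * ((t *s v) \<bullet> q)"
      unfolding Re_cnj_sum_eq_inner[symmetric] L_def by simp
    moreover have "0 \<le> 2 * (F t \<bullet> (f q - w)) + (norm (F t))\<^sup>2 - \<epsilon> * (2 * ((t *s v) \<bullet> q) + (cmod t)\<^sup>2 * (norm v)\<^sup>2)"
      using min[OF in_ball(1)[OF t]] unfolding e1 e2 by (simp add: algebra_simps)
    ultimately show ?thesis using F2 by (simp add: algebra_simps)
  qed
  show False
  proof (rule not_Re_pos_on_circle[OF holL L0])
    show "0 < R / 2" "R / 2 < R" using R by auto
    show "0 < (\<epsilon> * (norm v)\<^sup>2 - k\<^sup>2) * (R / 2)\<^sup>2" using k2 R by simp
    show "(\<epsilon> * (norm v)\<^sup>2 - k\<^sup>2) * (R / 2)\<^sup>2 \<le> Re (L t)" if "cmod t = R / 2" for t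
      using ReL[of t] that R by simp
  qed
qed

section \<open>The Jacobian determinant and regular points\<close>

definition jacobian :: "(complex ^ 'n \<Rightarrow> complex ^ 'n) \<Rightarrow> complex ^ 'n \<Rightarrow> complex"
  where "jacobian f z = det (\<chi> i j. frechet_derivative f (at z) (axis j 1) $ i)"

lemma frechet_derivative_eq_matrix:
  assumes "holomorphic_map_on f \<Omega>" "z \<in> \<Omega>"
  shows "frechet_derivative f (at z) v = (\<chi> i j. frechet_derivative f (at z) (axis j 1) $ i) *v v"
proof -
  interpret linear "frechet_derivative f (at z)"
    using holomorphic_map_onD(1)[OF assms] has_derivative_linear by blast
  have "frechet_derivative f (at z) v = frechet_derivative f (at z) (\<Sum>j\<in>UNIV. (v $ j) *s axis j 1)"
    by (simp add: basis_expansion)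
  also have "\<dots> = (\<Sum>j\<in>UNIV. (v $ j) *s frechet_derivative f (at z) (axis j 1))"
    by (simp add: sum holomorphic_map_onD(2)[OF assms])
  also have "\<dots> = (\<chi> i j. frechet_derivative f (at z) (axis j 1) $ i) *v v"
    by (simp add: vec_eq_iff matrix_vector_mult_def mult.commute)
  finally show ?thesis .
qed

lemma jacobian_nonzero_iff:
  assumes "holomorphic_map_on f \<Omega>" "z \<in> \<Omega>"
  shows "jacobian f z \<noteq> 0 \<longleftrightarrow> inj (frechet_derivative f (at z))"
proof -
  define A where "A = (\<chi> i j. frechet_derivative f (at z) (axis j 1) $ i)"
  have eq: "frechet_derivative f (at z) = (*v) A"
    unfolding A_def by (rule ext) (rule frechet_derivative_eq_matrix[OF assms])
  show ?thesis
    unfolding jacobian_def A_def[symmetric] unfolding eq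
    by (simp add: invertible_det_nz[symmetric] invertible_left_inverse matrix_left_invertible_injective)
qed

text \<open>By the Leibniz formula the determinant is a polynomial in the first derivatives of the
  components, and these are holomorphic.\<close>

lemma holomorphic_jacobian:
  assumes f: "holomorphic_map_on f \<Omega>" and \<Omega>: "open \<Omega>"
  shows "holomorphic_fun_on (jacobian f) \<Omega>"
proof (rule holomorphic_fun_on_cong[OF _ \<Omega>])
  have fi: "holomorphic_fun_on (\<lambda>z. f z $ i) \<Omega>" for i
    using f by (simp add: holomorphic_map_on_def)
  show "holomorphic_fun_on (\<lambda>z. \<Sum>p\<in>{p. p permutes UNIV}. of_int (sign p) *
      (\<Prod>i\<in>UNIV. frechet_derivative (\<lambda>z. f z $ i) (at z) (axis (p i) 1))) \<Omega>"
    by (intro holomorphic_fun_on_sum holomorphic_fun_on_cmult holomorphic_fun_on_prod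
        holomorphic_fun_on_derivative \<Omega> fi)
  fix z assume "z \<in> \<Omega>"
  then show "(\<Sum>p\<in>{p. p permutes UNIV}. of_int (sign p) *
      (\<Prod>i\<in>UNIV. frechet_derivative (\<lambda>z. f z $ i) (at z) (axis (p i) 1))) = jacobian f z"
    by (simp add: jacobian_def det_def holomorphic_map_onD(3)[OF f])
qed

lemma ex_inverse_derivative:
  assumes f: "holomorphic_map_on f \<Omega>" and z: "z \<in> \<Omega>" and J: "jacobian f z \<noteq> 0"
  obtains g where "bounded_linear g" "frechet_derivative f (at z) \<circ> g = id"
    "\<And>c v. g (c *s v) = c *s g v" "\<And>v. g (frechet_derivative f (at z) v) = v"
proof -
  let ?d = "frechet_derivative f (at z)"
  have inj: "inj ?d" using J jacobian_nonzero_iff[OF f z] by simp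
  have lin: "linear ?d" using holomorphic_map_onD(1)[OF f z] has_derivative_linear by blast
  obtain g where g: "linear g" "\<And>v. g (?d v) = v" "\<And>v. ?d (g v) = v"
    using linear_injective_isomorphism[OF lin inj] by blast
  have "g (c *s v) = c *s g v" for c v
    using g(2)[of "c *s g v"] g(3)[of v] holomorphic_map_onD(2)[OF f z] by simp
  then show thesis
    using that[of g] g linear_conv_bounded_linear[of g] by (auto simp: fun_eq_iff)
qed

text \<open>Sussmann's form of the open mapping theorem: it works from continuity on
  \<open>U\<close> and a right inverse of the derivative at the single point
  \<open>z\<close>.\<close>

lemma regular_point_interior:
  assumes f: "holomorphic_map_on f \<Omega>" and z: "z \<in> U" and J: "jacobian f z \<noteq> 0" and U: "open U" "U \<subseteq> \<Omega>"
  shows "f z \<in> interior (f ` U)"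
proof -
  have zO: "z \<in> \<Omega>" using z U by blast
  obtain g where g: "bounded_linear g" "frechet_derivative f (at z) \<circ> g = id"
    using ex_inverse_derivative[OF f zO J] by metis
  show ?thesis
    using continuous_on_subset[OF holomorphic_map_on_continuous_on[OF f] U(2)] z U
    by (intro sussmann_open_mapping[OF U(1) _ z holomorphic_map_onD(1)[OF f zO] g]) (auto simp: interior_open)
qed

section \<open>Proper maps: surjectivity and density of regular points\<close>

locale proper_holomorphic_map =
  fixes \<Omega>1 \<Omega>2 :: "(complex ^ 'n) set" and f :: "complex ^ 'n \<Rightarrow> complex ^ 'n"
  assumes dom1: "bounded_domain \<Omega>1" and dom2: "bounded_domain \<Omega>2"
    and f_in: "f \<in> \<Omega>1 \<rightarrow> \<Omega>2" and hol: "holomorphic_map_on f \<Omega>1"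
    and proper: "proper_map (top_of_set \<Omega>1) (top_of_set \<Omega>2) f"
begin

lemma open1: "open \<Omega>1" and connected1: "connected \<Omega>1" and ne1: "\<Omega>1 \<noteq> {}" and bounded1: "bounded \<Omega>1"
  using dom1 by (auto simp: bounded_domain_def)

lemma open2: "open \<Omega>2" and connected2: "connected \<Omega>2"
  using dom2 by (auto simp: bounded_domain_def)

lemma cont: "continuous_on \<Omega>1 f"
  by (rule holomorphic_map_on_continuous_on[OF hol])

lemma f_mem: "z \<in> \<Omega>1 \<Longrightarrow> f z \<in> \<Omega>2"
  using f_in by blast

lemma compact_preimage:
  assumes "compact A" "A \<subseteq> \<Omega>2"
  shows "compact {z \<in> \<Omega>1. f z \<in> A}"
  using compactin_proper_map_preimage[OF proper, of A] assms
  by (simp add: compactin_subtopology)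

lemma closedin_image:
  assumes "closedin (top_of_set \<Omega>1) A"
  shows "closedin (top_of_set \<Omega>2) (f ` A)"
  using proper_imp_closed_map[OF proper] assms by (simp add: closed_map_def)

text \<open>Properness makes the preimage of \<open>cball w (2 * \<delta>)\<close> compact, so
  \<open>\<rho>\<close> attains a minimum there; the bound on \<open>\<epsilon>\<close> keeps the
  minimizer \<open>q\<close> in the interior. The Levi inequality then gives both regularity of
  \<open>q\<close> and a bound on the preimage of \<open>f q - w\<close> under the
  derivative.\<close>

lemma regular_approximation:
  assumes z0: "z0 \<in> \<Omega>1" "norm (f z0 - w) < \<delta>" and \<delta>: "0 < \<delta>" "cball w (2 * \<delta>) \<subseteq> \<Omega>2"
    and R: "\<And>z. z \<in> \<Omega>1 \<Longrightarrow> norm z \<le> R" and \<epsilon>: "0 < \<epsilon>" "\<epsilon> * R\<^sup>2 < \<delta>\<^sup>2"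
  shows "\<exists>q\<in>\<Omega>1. jacobian f q \<noteq> 0 \<and> norm (f q - w) \<le> sqrt \<epsilon> * R"
proof -
  define D where "D = {z \<in> \<Omega>1. f z \<in> cball w (2 * \<delta>)}"
  have D: "compact D" unfolding D_def by (rule compact_preimage[OF compact_cball \<delta>(2)])
  define \<rho> where "\<rho> = (\<lambda>z. (norm (f z - w))\<^sup>2 - \<epsilon> * (norm z)\<^sup>2)"
  have "continuous_on D f" by (rule continuous_on_subset[OF cont]) (auto simp: D_def)
  then have "continuous_on D \<rho>" unfolding \<rho>_def by (intro continuous_intros)
  moreover have z0D: "z0 \<in> D" using z0 \<delta>(1) by (simp add: D_def dist_norm norm_minus_commute)
  ultimately obtain q where q: "q \<in> D" "\<And>z. z \<in> D \<Longrightarrow> \<rho> q \<le> \<rho> z"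
    using continuous_attains_inf[OF D, of \<rho>] by blast
  have qO: "q \<in> \<Omega>1" using q by (simp add: D_def)
  have R0: "0 \<le> R" using R[OF z0(1)] norm_ge_zero order_trans by blast
  \<comment> \<open>Comparison with \<open>z0\<close> puts \<open>f q\<close> strictly within
    distance \<open>2 * \<delta>\<close> of \<open>w\<close>, so \<open>q\<close> is a local minimum
    of \<open>\<rho>\<close> on an open set.\<close>
  have "(norm (f q - w))\<^sup>2 \<le> (norm (f z0 - w))\<^sup>2 + \<epsilon> * (norm q)\<^sup>2"
  proof -
    have "0 \<le> \<epsilon> * (norm z0)\<^sup>2" using \<epsilon>(1) by simp
    then show ?thesis using q(2)[OF z0D] unfolding \<rho>_def by linarith
  qed
  also have "\<dots> < \<delta>\<^sup>2 + \<delta>\<^sup>2"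
  proof (rule add_strict_mono)
    show "(norm (f z0 - w))\<^sup>2 < \<delta>\<^sup>2" by (rule power_strict_mono[OF z0(2)]) auto
    have "\<epsilon> * (norm q)\<^sup>2 \<le> \<epsilon> * R\<^sup>2" using R[OF qO] \<epsilon> by (intro mult_left_mono power_mono) auto
    then show "\<epsilon> * (norm q)\<^sup>2 < \<delta>\<^sup>2" using \<epsilon> by linarith
  qed
  also have "\<dots> \<le> (2 * \<delta>)\<^sup>2" by (simp add: power2_eq_square)
  finally have "norm (f q - w) < 2 * \<delta>" using power_less_imp_less_base[of "norm (f q - w)" 2 "2 * \<delta>"] \<delta> by simp
  then have q_in: "q \<in> \<Omega>1 \<inter> f -` ball w (2 * \<delta>)" using qO by (simp add: dist_norm norm_minus_commute)
  have "open (\<Omega>1 \<inter> f -` ball w (2 * \<delta>))"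
    by (rule continuous_open_preimage[OF cont open1 open_ball])
  then obtain r where r: "r > 0" "ball q r \<subseteq> \<Omega>1 \<inter> f -` ball w (2 * \<delta>)"
    using q_in open_contains_ball by blast
  have rD: "ball q r \<subseteq> D" using r(2) unfolding D_def by auto
  then have min: "\<rho> q \<le> \<rho> z" if "z \<in> ball q r" for z using that q(2) by blast
  let ?d = "frechet_derivative f (at q)"
  have levi: "\<epsilon> * (norm v)\<^sup>2 \<le> (norm (?d v))\<^sup>2" for v
    using Levi_local_min[OF open1 hol qO \<epsilon>(1) r(1)] min unfolding \<rho>_def by blast
  have d: "(f has_derivative ?d) (at q)" by (rule holomorphic_map_onD(1)[OF hol qO])
  have lin: "linear ?d" using d has_derivative_linear by blast
  have "inj ?d"
  proof (subst linear_injective_0[OF lin], intro allI impI)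
    fix v assume "?d v = 0"
    then show "v = 0" using levi[of v] \<epsilon>(1) by (simp add: mult_le_0_iff)
  qed
  then have J: "jacobian f q \<noteq> 0" using jacobian_nonzero_iff[OF hol qO] by simp
  have "(\<rho> has_derivative (\<lambda>v. 2 * (?d v \<bullet> (f q - w)) - \<epsilon> * (2 * (v \<bullet> q)))) (at q)"
    unfolding \<rho>_def power2_norm_eq_inner
    by (auto intro!: derivative_eq_intros d simp: fun_eq_iff inner_commute)
  from differential_zero_maxmin[OF _ open_ball[of q r] this] r(1) min
  have grad: "(\<lambda>v. 2 * (?d v \<bullet> (f q - w)) - \<epsilon> * (2 * (v \<bullet> q))) = (\<lambda>v. 0)" by simp
  \<comment> \<open>The gradient condition is tested in the direction that the derivative sends to
    \<open>f q - w\<close>; the Levi inequality controls its length.\<close>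
  obtain v where v: "?d v = f q - w"
    using linear_injective_imp_surjective[OF lin \<open>inj ?d\<close>] by (metis surjD)
  have "(norm (f q - w))\<^sup>2 = \<epsilon> * (v \<bullet> q)"
    using fun_cong[OF grad, of v] v by (simp add: power2_norm_eq_inner)
  also have "\<dots> \<le> \<epsilon> * (norm v * R)"
    using \<epsilon>(1) order_trans[OF norm_cauchy_schwarz[of v q] mult_left_mono[OF R[OF qO] norm_ge_zero[of v]]]
    by (intro mult_left_mono) auto
  also have "\<dots> = (sqrt \<epsilon> * norm v) * (sqrt \<epsilon> * R)"
    using \<epsilon>(1) real_sqrt_mult_self[of \<epsilon>] by (simp add: mult_ac)
  also have "\<dots> \<le> norm (f q - w) * (sqrt \<epsilon> * R)"
  proof (rule mult_right_mono)
    have "(sqrt \<epsilon> * norm v)\<^sup>2 \<le> (norm (f q - w))\<^sup>2"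
      using levi[of v] \<epsilon>(1) by (simp add: v power_mult_distrib)
    then show "sqrt \<epsilon> * norm v \<le> norm (f q - w)" by (rule power2_le_imp_le) simp
  qed (use \<epsilon> R0 in auto)
  finally have sq: "norm (f q - w) * norm (f q - w) \<le> norm (f q - w) * (sqrt \<epsilon> * R)"
    by (simp add: power2_eq_square)
  have "norm (f q - w) \<le> sqrt \<epsilon> * R" if "f q \<noteq> w"
  proof (rule mult_left_le_imp_le)
    show "norm (f q - w) * norm (f q - w) \<le> norm (f q - w) * (sqrt \<epsilon> * R)" by (rule sq)
  qed (use that in simp)
  moreover have "norm (f q - w) \<le> sqrt \<epsilon> * R" if "f q = w"
    using that R0 \<epsilon>(1) by simp
  ultimately have "norm (f q - w) \<le> sqrt \<epsilon> * R" by blast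
  then show ?thesis using qO J by blast
qed

lemma regular_approximation':
  assumes z0: "z0 \<in> \<Omega>1" "norm (f z0 - w) < \<delta>" and \<delta>: "0 < \<delta>" "cball w (2 * \<delta>) \<subseteq> \<Omega>2" and e: "0 < e"
  shows "\<exists>q\<in>\<Omega>1. jacobian f q \<noteq> 0 \<and> norm (f q - w) < e"
proof -
  obtain R where R: "R > 0" "\<And>z. z \<in> \<Omega>1 \<Longrightarrow> norm z \<le> R" using bounded1 bounded_pos by metis
  \<comment> \<open>For \<open>\<epsilon> = m\<^sup>2\<close> the error
    \<open>sqrt \<epsilon> * R\<close> is \<open>m * R\<close>, at most half of
    \<open>\<delta>\<close> and of \<open>e\<close>.\<close>
  define m where "m = min \<delta> e / (2 * R)"
  have m: "0 < m" "m * R < \<delta>" "m * R < e" using \<delta> e R by (auto simp: m_def)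
  have "m\<^sup>2 * R\<^sup>2 < \<delta>\<^sup>2" using power_strict_mono[OF m(2), of 2] m R by (simp add: power_mult_distrib)
  then obtain q where "q \<in> \<Omega>1" "jacobian f q \<noteq> 0" "norm (f q - w) \<le> sqrt (m\<^sup>2) * R"
    using regular_approximation[OF z0 \<delta> R(2), of "m\<^sup>2"] m(1) by auto
  then show ?thesis using m by (intro bexI[of _ q]) auto
qed

text \<open>The image is closed in \<open>\<Omega>2\<close> because proper maps are closed. It is
  open because all points near a value can be approximated by values, hence lie in the closure.
  Connectedness of \<open>\<Omega>2\<close> finishes the proof.\<close>

lemma surjective: "f ` \<Omega>1 = \<Omega>2"
proof -
  have closed: "closedin (top_of_set \<Omega>2) (f ` \<Omega>1)" by (rule closedin_image) simp
  have "open (f ` \<Omega>1)"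
  proof (subst open_contains_ball, rule ballI)
    fix w0 assume "w0 \<in> f ` \<Omega>1"
    then obtain z0 where z0: "z0 \<in> \<Omega>1" "f z0 = w0" by blast
    obtain r where r: "r > 0" "cball w0 r \<subseteq> \<Omega>2" using open2 open_contains_cball f_mem[OF z0(1)] z0(2) by metis
    \<comment> \<open>For \<open>w\<close> within \<open>\<delta>\<close> of \<open>w0\<close>, the
      ball of radius \<open>2 * \<delta>\<close> about \<open>w\<close> fits into
      \<open>cball w0 r\<close>.\<close>
    define \<delta> where "\<delta> = r / 3"
    have \<delta>: "0 < \<delta>" using r by (simp add: \<delta>_def)
    have "w \<in> f ` \<Omega>1" if w: "w \<in> ball w0 \<delta>" for w
    proof -
      have sub: "cball w (2 * \<delta>) \<subseteq> \<Omega>2"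
      proof
        fix x assume "x \<in> cball w (2 * \<delta>)"
        then have "dist w0 x \<le> r" using w dist_triangle[of w0 x w] by (simp add: \<delta>_def)
        then show "x \<in> \<Omega>2" using r by auto
      qed
      have near: "norm (f z0 - w) < \<delta>" using w z0 by (simp add: dist_norm)
      have "w \<in> closure (f ` \<Omega>1)"
        unfolding closure_approachable
      proof (intro allI impI)
        fix e :: real assume "0 < e"
        from regular_approximation'[OF z0(1) near \<delta> sub this]
        show "\<exists>y\<in>f ` \<Omega>1. dist y w < e" by (auto simp: dist_norm)
      qed
      moreover have "w \<in> \<Omega>2" using sub \<delta> by (auto simp: subset_iff)
      moreover obtain T where T: "closed T" "f ` \<Omega>1 = \<Omega>2 \<inter> T"
        using closed unfolding closedin_closed by blast
      moreover have "closure (f ` \<Omega>1) \<subseteq> T" by (rule closure_minimal) (use T in auto)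
      ultimately show ?thesis by blast
    qed
    then show "\<exists>e>0. ball w0 e \<subseteq> f ` \<Omega>1" using \<delta> by blast
  qed
  then have "openin (top_of_set \<Omega>2) (f ` \<Omega>1)" using f_in by (intro open_subset) auto
  then have "f ` \<Omega>1 = {} \<or> f ` \<Omega>1 = \<Omega>2" using closed connected2 connected_clopen by blast
  then show ?thesis using ne1 by blast
qed

definition "regular = {z \<in> \<Omega>1. jacobian f z \<noteq> 0}"

lemma regular_subset: "regular \<subseteq> \<Omega>1" by (auto simp: regular_def)

lemma holomorphic_jac: "holomorphic_fun_on (jacobian f) \<Omega>1"
  by (rule holomorphic_jacobian[OF hol open1])

lemma open_regular: "open regular"
  unfolding regular_def
  by (rule open_Collect_nonzero[OF open1 holomorphic_fun_on_continuous_on[OF holomorphic_jac]])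

text \<open>If the Jacobian vanished on an open set, it would vanish on all of
  \<open>\<Omega>1\<close>, whereas the approximation near any value of \<open>f\<close> produces a
  regular point.\<close>

lemma regular_dense:
  assumes U: "open U" "U \<subseteq> \<Omega>1" "U \<noteq> {}"
  shows "U \<inter> regular \<noteq> {}"
proof
  assume "U \<inter> regular = {}"
  then have 0: "jacobian f z = 0" if "z \<in> \<Omega>1" for z
    using holomorphic_fun_on_identity[OF open1 connected1 holomorphic_jac U(1,3,2) _ that] U(2)
    unfolding regular_def by blast
  obtain z where z: "z \<in> \<Omega>1" using ne1 by blast
  obtain r where r: "r > 0" "cball (f z) r \<subseteq> \<Omega>2" using open2 open_contains_cball f_mem[OF z] by metis
  from regular_approximation'[of z "f z" "r / 2" 1] show False using z r 0 by auto
qed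

text \<open>Openness of \<open>f\<close> at \<open>\<xi>\<close> and at \<open>\<eta>\<close>, together with the fact that \<open>f\<close> maps null sets to null sets,
  yields a point of \<open>f ` U \<inter> f ` V\<close> outside of the image of a given null set.\<close>

lemma common_value_avoiding_negligible:
  assumes \<xi>: "\<xi> \<in> regular" and \<eta>: "\<eta> \<in> regular" and eq: "f \<xi> = f \<eta>"
    and U: "open U" "\<xi> \<in> U" "U \<subseteq> \<Omega>1" and V: "open V" "\<eta> \<in> V" "V \<subseteq> \<Omega>1"
    and N: "negligible N"
  shows "\<exists>a\<in>U - N. \<exists>b\<in>V - N. f a = f b"
proof -
  have "f \<xi> \<in> interior (f ` U)" "f \<eta> \<in> interior (f ` V)"
    using regular_point_interior[OF hol] \<xi> \<eta> U V by (auto simp: regular_def)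
  then have ne: "interior (f ` U) \<inter> interior (f ` V) \<noteq> {}" using eq by auto
  have "negligible (f ` (N \<inter> \<Omega>1))"
  proof (rule negligible_differentiable_image_negligible)
    show "negligible (N \<inter> \<Omega>1)" by (rule negligible_subset[OF N]) auto
    show "f differentiable_on N \<inter> \<Omega>1"
      unfolding differentiable_on_def
      using holomorphic_map_onD(1)[OF hol] differentiableI differentiable_at_withinI by blast
  qed simp
  then have "\<not> interior (f ` U) \<inter> interior (f ` V) \<subseteq> f ` (N \<inter> \<Omega>1)"
    using open_not_negligible[OF open_Int[OF open_interior open_interior] ne] negligible_subset by blast
  then obtain y where y: "y \<in> interior (f ` U)" "y \<in> interior (f ` V)" "y \<notin> f ` (N \<inter> \<Omega>1)"
    by blast
  obtain a where a: "y = f a" "a \<in> U" using subsetD[OF interior_subset y(1)] by (rule imageE)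
  obtain b where b: "y = f b" "b \<in> V" using subsetD[OF interior_subset y(2)] by (rule imageE)
  have "a \<notin> N" "b \<notin> N" using y(3) a b U(3) V(3) by blast+
  then show ?thesis using a b by (intro bexI[of _ a] bexI[of _ b]) auto
qed

end

text \<open>One point is removed at a time by Riemann's theorem. By continuity the bound
  \<open>B\<close> persists at the point filled in, so the induction hypothesis applies to the
  extension.\<close>

lemma removable_finite_singularities:
  fixes \<phi> :: "complex \<Rightarrow> complex"
  assumes "finite Z" "open S" "\<phi> holomorphic_on (S - Z)" "\<And>z. z \<in> S - Z \<Longrightarrow> cmod (\<phi> z) \<le> B"
  shows "\<exists>\<psi>. \<psi> holomorphic_on S \<and> (\<forall>z\<in>S - Z. \<psi> z = \<phi> z)"
  using assms
proof (induction Z arbitrary: \<phi> rule: finite_induct)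
  case empty
  then show ?case by auto
next
  case (insert \<zeta> Z)
  define T where "T = S - Z"
  have T: "open T" using insert by (simp add: T_def open_Diff finite_imp_closed)
  show ?case
  proof (cases "\<zeta> \<in> T")
    case False
    then have "S - insert \<zeta> Z = S - Z" by (auto simp: T_def)
    then show ?thesis using insert by metis
  next
    case True
    have TZ: "T - {\<zeta>} = S - insert \<zeta> Z" by (auto simp: T_def)
    have ev: "eventually (\<lambda>z. z \<in> T - {\<zeta>}) (at \<zeta>)"
      by (rule eventually_at_in_open[OF T True])
    have "eventually (\<lambda>z. cmod (\<phi> z) \<le> B) (at \<zeta>)"
      using ev by eventually_elim (use insert.prems(3) TZ in auto)
    then obtain g where g: "g holomorphic_on T" "\<And>z. z \<in> T - {\<zeta>} \<Longrightarrow> g z = \<phi> z"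
      using holomorphic_on_extend_bounded[of \<phi> T \<zeta>] insert.prems(2) True T TZ
      by (auto simp: interior_open)
    have "cmod (g \<zeta>) \<le> B"
    proof (rule tendsto_upperbound)
      have "isCont g \<zeta>"
        using holomorphic_on_imp_continuous_on[OF g(1)] T True continuous_on_eq_continuous_at by blast
      then show "((\<lambda>z. cmod (g z)) \<longlongrightarrow> cmod (g \<zeta>)) (at \<zeta>)"
        by (intro tendsto_norm) (simp add: isCont_def)
      show "eventually (\<lambda>z. cmod (g z) \<le> B) (at \<zeta>)"
        using ev by eventually_elim (use insert.prems(3) TZ g(2) in auto)
    qed simp
    then have "\<And>z. z \<in> S - Z \<Longrightarrow> cmod (g z) \<le> B"
      using g(2) insert.prems(3) TZ unfolding T_def[symmetric] by (metis Diff_iff singletonD)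
    then obtain \<psi> where "\<psi> holomorphic_on S" "\<forall>z\<in>S - Z. \<psi> z = g z"
      using insert.IH[OF insert.prems(1), of g] g(1) by (auto simp: T_def)
    then show ?thesis using g(2) TZ by (intro exI[of _ \<psi>]) (auto simp: T_def)
  qed
qed

text \<open>In a compact disc \<open>u\<close> has finitely many zeros, across which the bounded
  \<open>\<phi>\<close> extends. Neither the centre nor the unit circle meets them, so Cauchy's
  formula for the extension is one for \<open>\<phi>\<close>.\<close>

lemma removable_circle_average:
  fixes \<phi> u :: "complex \<Rightarrow> complex"
  assumes R: "1 < R" and u: "u holomorphic_on ball 0 R" and u0: "u 0 \<noteq> 0"
    and uc: "\<And>t. cmod t = 1 \<Longrightarrow> u t \<noteq> 0"
    and \<phi>: "\<phi> holomorphic_on {t \<in> ball 0 R. u t \<noteq> 0}"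
    and B: "\<And>t. t \<in> ball 0 R \<Longrightarrow> u t \<noteq> 0 \<Longrightarrow> cmod (\<phi> t) \<le> B"
  shows "integral {0..1} (\<lambda>\<theta>. \<phi> (exp (2 * of_real pi * \<i> * of_real \<theta>))) = \<phi> 0"
proof -
  \<comment> \<open>A radius midway between 1 and \<open>R\<close>: the closed disc lies in
    \<open>ball 0 R\<close>, the open one contains the closed unit disc.\<close>
  define S where "S = ball (0::complex) ((1 + R) / 2)"
  define Z where "Z = {t \<in> cball 0 ((1 + R) / 2). u t = 0}"
  have sub: "cball (0::complex) ((1 + R) / 2) \<subseteq> ball 0 R" using R by auto
  have "finite Z"
  proof (cases "u constant_on ball 0 R")
    case True
    then have "u t = u 0" if "t \<in> ball 0 R" for t
      using that R unfolding constant_on_def by (metis centre_in_ball less_trans zero_less_one)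
    then have "Z = {}" using sub u0 unfolding Z_def by fastforce
    then show ?thesis by simp
  next
    case False
    then show ?thesis
      unfolding Z_def by (intro holomorphic_compact_finite_zeros[OF u]) (use sub in auto)
  qed
  have SZ: "S - Z \<subseteq> {t \<in> ball 0 R. u t \<noteq> 0}" using R by (auto simp: S_def Z_def)
  obtain \<psi> where \<psi>: "\<psi> holomorphic_on S" "\<And>z. z \<in> S - Z \<Longrightarrow> \<psi> z = \<phi> z"
    using removable_finite_singularities[OF \<open>finite Z\<close>, of S \<phi> B] holomorphic_on_subset[OF \<phi> SZ] B SZ
    unfolding S_def by blast
  have c1: "cball (0::complex) 1 \<subseteq> S" using R by (auto simp: S_def)
  have "((\<lambda>\<theta>. \<psi> (exp (2 * of_real pi * \<i> * of_real \<theta>))) has_integral \<psi> 0) {0..1}"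
    using holomorphic_on_subset[OF \<psi>(1)] c1 ball_subset_cball
    by (intro circle_average holomorphic_on_imp_continuous_on) blast+
  moreover have "\<psi> t = \<phi> t" if "cmod t = 1" for t
    using that uc[OF that] R by (intro \<psi>(2)) (auto simp: S_def Z_def)
  moreover have "\<psi> 0 = \<phi> 0" using u0 R by (intro \<psi>(2)) (auto simp: S_def Z_def)
  ultimately show ?thesis by (simp add: integral_unique)
qed

section \<open>Inverting a proper map that is injective on its regular points\<close>

context proper_holomorphic_map
begin

text \<open>Injectivity on the regular points makes the Jacobian constant on fibres, so it descends to a
  continuous function \<open>u\<close> on \<open>\<Omega>2\<close>, holomorphic off its zeros and hence, by Rado's theorem, holomorphic on
  complex lines. Cauchy averages over circles on which \<open>u\<close> has no zeros then extend \<open>g\<close> across the zeros of \<open>u\<close>.\<close>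

context
  assumes inj_regular: "inj_on f regular"
begin

text \<open>The case to exclude is a fibre with a regular point \<open>a\<close> and a critical
  point \<open>b\<close>. The images of regular points near \<open>a\<close> cover a neighbourhood
  of the common value, and regular points are dense near \<open>b\<close>; this gives two distinct
  regular points with equal value.\<close>

lemma jacobian_fibre:
  assumes z: "z \<in> \<Omega>1" and z': "z' \<in> \<Omega>1" and eq: "f z = f z'"
  shows "jacobian f z = jacobian f z'"
proof -
  have mixed: False if a: "a \<in> regular" and b: "b \<in> \<Omega>1" "b \<notin> regular" and eq: "f a = f b" for a b
  proof -
    have "a \<noteq> b" using a b by blast
    then obtain A B where AB: "open A" "open B" "a \<in> A" "b \<in> B" "A \<inter> B = {}"
      using hausdorff by metis
    define W where "W = interior (f ` (A \<inter> regular))"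
    have fa: "f a \<in> W"
      unfolding W_def using a AB open_regular regular_subset
      by (intro regular_point_interior[OF hol]) (auto simp: regular_def)
    have "open (\<Omega>1 \<inter> f -` W)" unfolding W_def by (rule continuous_open_preimage[OF cont open1 open_interior])
    then have "open (B \<inter> (\<Omega>1 \<inter> f -` W))" using AB by blast
    moreover have "b \<in> B \<inter> (\<Omega>1 \<inter> f -` W)" using b AB fa eq by simp
    ultimately obtain c where c: "c \<in> B" "c \<in> regular" "f c \<in> W"
      using regular_dense[of "B \<inter> (\<Omega>1 \<inter> f -` W)"] by blast
    then obtain a' where "a' \<in> A" "a' \<in> regular" "f a' = f c"
      unfolding W_def using interior_subset by fastforce
    then show False using c AB inj_regular by (metis IntI empty_iff inj_onD)
  qed
  consider "z \<in> regular" "z' \<in> regular" | "z \<notin> regular" "z' \<notin> regular"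
    using mixed[of z z'] mixed[of z' z] z z' eq by metis
  then show ?thesis
  proof cases
    case 1
    then show ?thesis using inj_regular eq by (metis inj_onD)
  next
    case 2
    then show ?thesis using z z' by (simp add: regular_def)
  qed
qed

text \<open>At this stage merely a right inverse, dependent on choices outside the regular values
  and not known to be continuous there. The function \<open>u\<close> below does not depend on these
  choices.\<close>

definition "g = inv_into \<Omega>1 f"

definition "u w = jacobian f (g w)"

lemma g_in: "w \<in> \<Omega>2 \<Longrightarrow> g w \<in> \<Omega>1" and f_g: "w \<in> \<Omega>2 \<Longrightarrow> f (g w) = w"
  using surjective by (auto simp: g_def inv_into_into f_inv_into_f)

lemma u_f: "z \<in> \<Omega>1 \<Longrightarrow> u (f z) = jacobian f z"
  unfolding u_def by (rule jacobian_fibre) (auto simp: g_in f_g f_mem)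

text \<open>The Jacobian is constant on fibres, so the chosen preimage of \<open>f z\<close> is
  regular too, and injectivity identifies it with \<open>z\<close>.\<close>

lemma g_f: "z \<in> regular \<Longrightarrow> g (f z) = z"
  using u_f[of z] g_in[of "f z"] f_g[of "f z"] f_mem[of z] inj_regular
  unfolding regular_def u_def by (auto dest: inj_onD)

text \<open>\<open>f\<close> is a quotient map: the preimage of a closed set under \<open>u\<close>
  is the image under the closed map \<open>f\<close> of its preimage under the Jacobian.\<close>

lemma continuous_u: "continuous_on \<Omega>2 u"
  unfolding continuous_on_closed
proof (intro allI impI)
  fix T assume T: "closedin (top_of_set (u ` \<Omega>2)) T"
  have "u ` \<Omega>2 = jacobian f ` \<Omega>1"
    using u_f unfolding surjective[symmetric] image_image by (auto simp: image_iff)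
  then have "closedin (top_of_set \<Omega>1) (\<Omega>1 \<inter> jacobian f -` T)"
    using T holomorphic_fun_on_continuous_on[OF holomorphic_jac] unfolding continuous_on_closed by simp
  then have "closedin (top_of_set \<Omega>2) (f ` (\<Omega>1 \<inter> jacobian f -` T))" by (rule closedin_image)
  moreover have "f ` (\<Omega>1 \<inter> jacobian f -` T) = \<Omega>2 \<inter> u -` T"
    using u_f unfolding surjective[symmetric] by auto
  ultimately show "closedin (top_of_set \<Omega>2) (\<Omega>2 \<inter> u -` T)" by simp
qed

definition "regular_values = {w \<in> \<Omega>2. u w \<noteq> 0}"

lemma regular_values_eq: "regular_values = f ` regular"
proof
  show "regular_values \<subseteq> f ` regular"
  proof
    fix w assume "w \<in> regular_values"
    then have "w = f (g w)" "g w \<in> regular" by (auto simp: regular_values_def regular_def u_def g_in f_g)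
    then show "w \<in> f ` regular" by (rule image_eqI)
  qed
  show "f ` regular \<subseteq> regular_values" by (auto simp: regular_values_def regular_def u_f f_mem)
qed

lemma open_regular_values: "open regular_values"
  unfolding regular_values_def by (rule open_Collect_nonzero[OF open2 continuous_u])

lemma regular_values_dense:
  assumes "open W" "W \<subseteq> \<Omega>2" "W \<noteq> {}"
  shows "W \<inter> regular_values \<noteq> {}"
proof -
  have "open (\<Omega>1 \<inter> f -` W)" by (rule continuous_open_preimage[OF cont open1 assms(1)])
  moreover have "\<Omega>1 \<inter> f -` W \<noteq> {}" using assms(2,3) surjective by blast
  ultimately have "(\<Omega>1 \<inter> f -` W) \<inter> regular \<noteq> {}" by (intro regular_dense) auto
  then show ?thesis using regular_values_eq by blast
qed

lemma holomorphic_g: "holomorphic_map_on g regular_values"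
proof (rule holomorphic_map_onI)
  fix w assume "w \<in> regular_values"
  then obtain z where z: "z \<in> regular" "f z = w" unfolding regular_values_eq by blast
  have zO: "z \<in> \<Omega>1" and J: "jacobian f z \<noteq> 0" using z by (auto simp: regular_def)
  obtain h where h: "frechet_derivative f (at z) \<circ> h = id" "\<And>c v. h (c *s v) = c *s h v"
    using ex_inverse_derivative[OF hol zO J] by metis
  have "(g has_derivative h) (at (f z))"
    by (rule has_derivative_inverse_strong[OF open_regular z(1) continuous_on_subset[OF cont regular_subset]
          g_f holomorphic_map_onD(1)[OF hol zO] h(1)])
  then show "\<exists>g'. (g has_derivative g') (at w) \<and> (\<forall>c v. g' (c *s v) = c *s g' v)"
    using h(2) unfolding z(2) by (intro exI[of _ h] conjI allI)
qed

lemma holomorphic_u_regular_values: "holomorphic_fun_on u regular_values"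
  unfolding u_def[abs_def]
  by (rule holomorphic_fun_on_compose[OF holomorphic_g holomorphic_jac]) (auto simp: regular_values_def g_in)

lemma line_holomorphic_u: "line_holomorphic_on u \<Omega>2"
  unfolding line_holomorphic_on_def
proof (intro allI)
  fix z v
  show "(\<lambda>t. u (z + t *s v)) holomorphic_on {t. z + t *s v \<in> \<Omega>2}"
  proof (rule Rado)
    show "open {t. z + t *s v \<in> \<Omega>2}" by (rule open_line_preimage[OF open2])
    show "continuous_on {t. z + t *s v \<in> \<Omega>2} (\<lambda>t. u (z + t *s v))"
      by (intro continuous_on_compose2[OF continuous_u] continuous_intros) auto
    show "(\<lambda>t. u (z + t *s v)) holomorphic_on {t \<in> {t. z + t *s v \<in> \<Omega>2}. u (z + t *s v) \<noteq> 0}"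
      by (rule line_holomorphic_onD[OF holomorphic_fun_on_line_holomorphic_on[OF holomorphic_u_regular_values]])
         (auto simp: regular_values_def)
  qed
qed

text \<open>On a complex line through \<open>p\<close> where \<open>u\<close> is not identically zero its zeros are isolated; \<open>v\<close> is
  rescaled so that a small circle avoiding them becomes the unit circle.\<close>

lemma circle_in_regular_values:
  assumes p: "p \<in> \<Omega>2"
  shows "\<exists>v \<epsilon>. \<epsilon> > 0 \<and> ball p \<epsilon> \<subseteq> \<Omega>2 \<and>
    (\<forall>w\<in>ball p \<epsilon>. \<forall>t\<in>ball 0 2. w + t *s v \<in> \<Omega>2) \<and> (\<forall>w\<in>ball p \<epsilon>. \<forall>t. cmod t = 1 \<longrightarrow> w + t *s v \<in> regular_values)"
proof -
  obtain \<rho> where \<rho>: "\<rho> > 0" "ball p (2 * \<rho>) \<subseteq> \<Omega>2"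
  proof -
    obtain r where "r > 0" "ball p r \<subseteq> \<Omega>2" using open2 p open_contains_ball by blast
    then show thesis using that[of "r / 2"] by simp
  qed
  have pp: "p \<in> ball p \<rho>" using \<rho> by simp
  have sub\<rho>: "ball p \<rho> \<subseteq> \<Omega>2" using \<rho> by (auto simp: subset_iff)
  then obtain q where q: "q \<in> ball p \<rho>" "q \<in> regular_values"
    using regular_values_dense[OF open_ball sub\<rho>] pp by blast
  \<comment> \<open>In this direction \<open>t = 1\<close> leads to the regular value
    \<open>q\<close>, so \<open>u\<close> does not vanish identically on the line.\<close>
  define v where "v = q - p"
  have nv: "norm v < \<rho>" using q(1) by (simp add: v_def dist_norm norm_minus_commute)
  have in2: "w + t *s v \<in> \<Omega>2" if "w \<in> ball p \<rho>" "cmod t \<le> 1" for w t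
  proof -
    have "norm (t *s v) \<le> norm v" using that(2) mult_right_mono[of "cmod t" 1 "norm v"] by (simp add: norm_scale_vec)
    then have "dist p (w + t *s v) < 2 * \<rho>"
      using that(1) nv norm_triangle_ineq4[of "p - w" "t *s v"] by (simp add: dist_norm algebra_simps)
    then show ?thesis using \<rho> by auto
  qed
  define \<phi> where "\<phi> = (\<lambda>t. u (p + t *s v))"
  \<comment> \<open>Isolation of the zeros is applied on an open disc containing both 0 and 1, so
    the closed unit disc is enlarged a little.\<close>
  obtain R where R: "R > 1" "\<And>t. t \<in> ball 0 R \<Longrightarrow> p + t *s v \<in> \<Omega>2"
  proof -
    have op: "open {t. p + t *s v \<in> \<Omega>2}" by (rule open_line_preimage[OF open2])
    have "cball 0 1 \<subseteq> {t. p + t *s v \<in> \<Omega>2}" using in2[OF pp] by auto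
    then obtain e where e: "e > 0" "(\<Union>x\<in>cball 0 1. ball x e) \<subseteq> {t. p + t *s v \<in> \<Omega>2}"
      using compact_subset_open_imp_ball_epsilon_subset[OF compact_cball op] by metis
    have "p + t *s v \<in> \<Omega>2" if t: "t \<in> ball 0 (1 + e)" for t
    proof (cases "cmod t \<le> 1")
      case True
      then show ?thesis using in2[OF pp] by simp
    next
      case False
      have "dist (sgn t) t = cmod t - 1"
      proof -
        have "sgn t - t = (1 / cmod t - 1) *\<^sub>R t" by (simp add: sgn_div_norm algebra_simps inverse_eq_divide)
        then have "dist (sgn t) t = \<bar>1 / cmod t - 1\<bar> * cmod t" by (simp add: dist_norm)
        moreover have "\<bar>1 / c - 1\<bar> * c = c - 1" if "c > 1" for c :: real
          using that by (simp add: abs_if left_diff_distrib)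
        ultimately show ?thesis using False by simp
      qed
      moreover have "sgn t \<in> cball 0 1" by (simp add: norm_sgn)
      ultimately have "t \<in> (\<Union>x\<in>cball 0 1. ball x e)" using t by (intro UN_I[of "sgn t"]) auto
      then show ?thesis using e(2) by blast
    qed
    then show thesis using that[of "1 + e"] e(1) by simp
  qed
  have \<phi>: "\<phi> holomorphic_on ball 0 R"
    unfolding \<phi>_def by (rule line_holomorphic_onD[OF line_holomorphic_u R(2)])
  have "\<phi> 1 \<noteq> 0" using q(2) by (simp add: \<phi>_def v_def regular_values_def)
  \<comment> \<open>With \<open>s \<le> 1 / 2\<close>, the disc of radius 2 in the rescaled
    parameter stays within the unit disc of the original one.\<close>
  have "\<exists>s. 0 < s \<and> s \<le> 1 / 2 \<and> (\<forall>t. cmod t = s \<longrightarrow> \<phi> t \<noteq> 0)"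
  proof (cases "\<phi> 0 = 0")
    case True
    have "\<exists>r>0. \<forall>t\<in>ball 0 r - {0}. \<phi> t \<noteq> 0"
      by (rule isolated_zeros[OF \<phi> open_ball _ _ True _ \<open>\<phi> 1 \<noteq> 0\<close>]) (use R(1) in auto)
    then obtain r where r: "0 < r" "\<And>t. t \<in> ball 0 r - {0} \<Longrightarrow> \<phi> t \<noteq> 0" by blast
    have "\<phi> t \<noteq> 0" if t: "cmod t = min (r / 2) (1 / 2)" for t
    proof (rule r(2))
      have "0 < cmod t" "cmod t < r" unfolding t using r(1) by auto
      then show "t \<in> ball 0 r - {0}" by auto
    qed
    then show ?thesis using r(1) by (intro exI[of _ "min (r / 2) (1 / 2)"]) auto
  next
    case False
    have "isCont \<phi> 0"
      using holomorphic_on_imp_continuous_on[OF \<phi>] R(1) by (simp add: continuous_on_eq_continuous_at)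
    then obtain e where e: "e > 0" "\<And>t. dist t 0 < e \<Longrightarrow> dist (\<phi> t) (\<phi> 0) < cmod (\<phi> 0)"
      using False unfolding continuous_at_eps_delta by (metis zero_less_norm_iff)
    have "\<phi> t \<noteq> 0" if "cmod t < e" for t using e(2)[of t] that by (auto simp: dist_norm)
    then show ?thesis using e(1) by (intro exI[of _ "min (e / 2) (1 / 2)"]) auto
  qed
  then obtain s where s: "0 < s" "s \<le> 1 / 2" "\<And>t. cmod t = s \<Longrightarrow> \<phi> t \<noteq> 0" by blast
  define v' where "v' = of_real s *s v"
  have tv': "t *s v' = (t * of_real s) *s v" for t by (simp add: v'_def)
  have "compact ((\<lambda>t. p + t *s v') ` sphere 0 1)"
    by (intro compact_continuous_image continuous_intros) auto
  moreover have "(\<lambda>t. p + t *s v') ` sphere 0 1 \<subseteq> regular_values"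
  proof
    fix x assume "x \<in> (\<lambda>t. p + t *s v') ` sphere 0 1"
    then obtain t where t: "cmod t = 1" "x = p + (t * of_real s) *s v" by (auto simp: tv')
    have "cmod (t * of_real s) = s" using t s by (simp add: norm_mult)
    then show "x \<in> regular_values" using s(3)[of "t * of_real s"] in2[OF pp, of "t * of_real s"] s(2) t(2) by (simp add: regular_values_def \<phi>_def)
  qed
  \<comment> \<open>The circle is compact and the regular values are open, so the same circle can be
    translated to all centres near \<open>p\<close>.\<close>
  ultimately obtain e where e: "e > 0" "(\<Union>x\<in>(\<lambda>t. p + t *s v') ` sphere 0 1. ball x e) \<subseteq> regular_values"
    using compact_subset_open_imp_ball_epsilon_subset[OF _ open_regular_values] by metis
  define \<epsilon> where "\<epsilon> = min e \<rho>"
  have "w + t *s v' \<in> \<Omega>2" if "w \<in> ball p \<epsilon>" "t \<in> ball 0 2" for w t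
    unfolding tv'
  proof (rule in2)
    show "w \<in> ball p \<rho>" using that by (simp add: \<epsilon>_def)
    show "cmod (t * of_real s) \<le> 1" using that s mult_mono[of "cmod t" 2 s "1/2"] by (simp add: norm_mult)
  qed
  moreover have "w + t *s v' \<in> regular_values" if "w \<in> ball p \<epsilon>" "cmod t = 1" for w t
  proof -
    have "w + t *s v' \<in> ball (p + t *s v') e" using that(1) by (simp add: \<epsilon>_def dist_norm)
    moreover have "p + t *s v' \<in> (\<lambda>t. p + t *s v') ` sphere 0 1" using that(2) by (intro imageI) simp
    ultimately show ?thesis using e(2) by blast
  qed
  moreover have "\<epsilon> > 0" "ball p \<epsilon> \<subseteq> \<Omega>2" using e \<rho> sub\<rho> by (auto simp: \<epsilon>_def)
  ultimately show ?thesis by blast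
qed

text \<open>The average of \<open>g\<close> over the circle about \<open>w\<close> only involves
  regular values, so it is defined and holomorphic for every \<open>w\<close> near \<open>p\<close>,
  critical value or not. At a regular value it returns \<open>g w\<close> by removability along the
  line.\<close>

lemma local_extension:
  assumes p: "p \<in> \<Omega>2"
  shows "\<exists>\<epsilon>>0. \<exists>\<Psi>. ball p \<epsilon> \<subseteq> \<Omega>2 \<and> holomorphic_map_on \<Psi> (ball p \<epsilon>) \<and> (\<forall>w\<in>ball p \<epsilon> \<inter> regular_values. \<Psi> w = g w)"
proof -
  obtain v \<epsilon> where \<epsilon>: "\<epsilon> > 0" "ball p \<epsilon> \<subseteq> \<Omega>2"
    and in2: "\<And>w t. w \<in> ball p \<epsilon> \<Longrightarrow> t \<in> ball 0 2 \<Longrightarrow> w + t *s v \<in> \<Omega>2"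
    and inG: "\<And>w t. w \<in> ball p \<epsilon> \<Longrightarrow> cmod t = 1 \<Longrightarrow> w + t *s v \<in> regular_values"
    using circle_in_regular_values[OF p] by blast
  define e where "e = (\<lambda>\<theta>::real. exp (2 * of_real pi * \<i> * of_real \<theta>))"
  have e1: "cmod (e \<theta>) = 1" for \<theta> by (simp add: e_def)
  have cont_e: "continuous_on S e" for S unfolding e_def by (intro continuous_intros)
  have gi: "holomorphic_fun_on (\<lambda>w. g w $ i) regular_values" for i
    using holomorphic_g by (simp add: holomorphic_map_on_def)
  define \<Psi> where "\<Psi> = (\<lambda>w. \<chi> i. integral {0..1} (\<lambda>\<theta>. g (w + e \<theta> *s v) $ i))"
  have hol\<Psi>: "holomorphic_fun_on (\<lambda>w. integral (cbox 0 1) (\<lambda>\<theta>. g (w + e \<theta> *s v) $ i)) (ball p \<epsilon>)" for i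
  proof (rule holomorphic_fun_onI[OF open_ball])
    show "continuous_on (ball p \<epsilon>) (\<lambda>w. integral (cbox 0 1) (\<lambda>\<theta>. g (w + e \<theta> *s v) $ i))"
    proof (rule integral_continuous_on_param)
      show "continuous_on (ball p \<epsilon> \<times> cbox 0 1) (\<lambda>(w, \<theta>). g (w + e \<theta> *s v) $ i)"
        unfolding case_prod_beta
        by (intro continuous_on_compose2[OF holomorphic_fun_on_continuous_on[OF gi]]
            continuous_intros continuous_on_compose2[OF cont_e]) (auto intro!: inG simp: e1)
    qed
    show "line_holomorphic_on (\<lambda>w. integral (cbox 0 1) (\<lambda>\<theta>. g (w + e \<theta> *s v) $ i)) (ball p \<epsilon>)"
      unfolding line_holomorphic_on_def
    proof (intro allI)
      fix z x
      define T where "T = {t. z + t *s x \<in> ball p \<epsilon>}"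
      have T: "open T" unfolding T_def by (rule open_line_preimage) simp
      define F where "F = (\<lambda>t \<theta>. g (z + t *s x + e \<theta> *s v) $ i)"
      define F' where "F' = (\<lambda>t \<theta>. frechet_derivative (\<lambda>w. g w $ i) (at (z + t *s x + e \<theta> *s v)) x)"
      have inG': "z + t *s x + e \<theta> *s v \<in> regular_values" if "t \<in> T" for t \<theta>
        using that by (intro inG) (simp_all add: T_def e1)
      have "(\<lambda>t. integral (cbox 0 1) (F t)) field_differentiable at t" if t: "t \<in> T" for t
      proof -
        obtain r where r: "r > 0" "ball t r \<subseteq> T" using T t open_contains_ball by blast
        have "(\<lambda>t. integral (cbox 0 1) (F t)) holomorphic_on ball t r"
        proof (rule leibniz_rule_holomorphic)
          fix s \<theta> assume s: "s \<in> ball t r" "\<theta> \<in> cbox 0 (1::real)"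
          then have reg: "z + s *s x + e \<theta> *s v \<in> regular_values" using inG' r by blast
          have "((\<lambda>s. (z + e \<theta> *s v) + s *s x) has_derivative (\<lambda>c. c *s x)) (at s)"
            by (rule has_derivative_line)
          then have "((\<lambda>s. z + s *s x + e \<theta> *s v) has_derivative (\<lambda>c. c *s x)) (at s)"
            by (simp add: algebra_simps)
          from has_derivative_compose[OF this holomorphic_fun_onD(1)[OF gi reg]]
          have "((\<lambda>s. F s \<theta>) has_field_derivative F' s \<theta>) (at s)"
            unfolding has_field_derivative_def F_def F'_def
            by (rule has_derivative_eq_rhs) (simp add: holomorphic_fun_onD(2)[OF gi reg] fun_eq_iff mult.commute)
          then show "((\<lambda>s. F s \<theta>) has_field_derivative F' s \<theta>) (at s within ball t r)"
            by (rule has_field_derivative_at_within)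
        next
          fix s assume s: "s \<in> ball t r"
          show "F s integrable_on cbox 0 1"
            unfolding F_def
            by (intro integrable_continuous continuous_on_compose2[OF holomorphic_fun_on_continuous_on[OF gi]]
                continuous_intros cont_e) (use s r inG' in blast)
        next
          have "open regular_values" by (rule open_regular_values)
          then have "continuous_on regular_values (\<lambda>w. frechet_derivative (\<lambda>w. g w $ i) (at w) x)"
            by (intro holomorphic_fun_on_continuous_on holomorphic_fun_on_derivative gi)
          then show "continuous_on (ball t r \<times> cbox 0 1) (\<lambda>(s, \<theta>). F' s \<theta>)"
            unfolding F'_def case_prod_beta
            by (rule continuous_on_compose2)
               (intro continuous_intros continuous_on_compose2[OF cont_e], use r inG' in auto)
        qed simp
        then show ?thesis using r(1) by (simp add: holomorphic_on_imp_differentiable_at)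
      qed
      then show "(\<lambda>t. integral (cbox 0 1) (\<lambda>\<theta>. g (z + t *s x + e \<theta> *s v) $ i)) holomorphic_on {t. z + t *s x \<in> ball p \<epsilon>}"
        unfolding T_def[symmetric] F_def holomorphic_on_def using field_differentiable_at_within by blast
    qed
  qed
  then have "holomorphic_map_on \<Psi> (ball p \<epsilon>)"
    by (simp add: holomorphic_map_on_def \<Psi>_def)
  moreover have "\<Psi> w = g w" if w: "w \<in> ball p \<epsilon> \<inter> regular_values" for w
  proof -
    \<comment> \<open>Since \<open>g\<close> takes all its values in the bounded set
      \<open>\<Omega>1\<close>, the singularities on the line are removable.\<close>
    obtain B where B: "\<And>z. z \<in> \<Omega>1 \<Longrightarrow> norm z \<le> B" using bounded1 bounded_iff by metis
    have "integral {0..1} (\<lambda>\<theta>. g (w + e \<theta> *s v) $ i) = g (w + 0 *s v) $ i" for i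
      unfolding e_def
    proof (rule removable_circle_average[where R = 2 and u = "\<lambda>t. u (w + t *s v)" and B = B])
      show "(\<lambda>t. u (w + t *s v)) holomorphic_on ball 0 2"
        by (rule line_holomorphic_onD[OF line_holomorphic_u]) (use w in2 in blast)
      show "u (w + 0 *s v) \<noteq> 0" using w by (simp add: regular_values_def)
      show "u (w + t *s v) \<noteq> 0" if "cmod t = 1" for t
        using inG[of w t] w that by (simp add: regular_values_def)
      show "(\<lambda>t. g (w + t *s v) $ i) holomorphic_on {t \<in> ball 0 2. u (w + t *s v) \<noteq> 0}"
        by (rule line_holomorphic_onD[OF holomorphic_fun_on_line_holomorphic_on[OF gi]])
           (use w in2 in \<open>auto simp: regular_values_def\<close>)
      show "cmod (g (w + t *s v) $ i) \<le> B" if "t \<in> ball 0 2" for t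
        using B[OF g_in[OF in2[OF _ that, of w]]] w Finite_Cartesian_Product.norm_nth_le order_trans by blast
    qed simp
    then show ?thesis by (simp add: \<Psi>_def vec_eq_iff)
  qed
  ultimately show ?thesis using \<epsilon> by blast
qed

text \<open>The identity \<open>\<Psi> (f z) = z\<close> holds at regular points; the set where it
  fails is open and misses them, so it is empty by density. The identity gives injectivity on all of
  \<open>\<Omega>1\<close> and shows that the inverse is locally \<open>\<Psi>\<close>.\<close>

theorem biholomorphism_if_inj_regular: "biholomorphism \<Omega>1 \<Omega>2 f"
proof -
  have local: "\<exists>\<epsilon>>0. \<exists>\<Psi>. ball p \<epsilon> \<subseteq> \<Omega>2 \<and> holomorphic_map_on \<Psi> (ball p \<epsilon>) \<and>
      (\<forall>z\<in>\<Omega>1. f z \<in> ball p \<epsilon> \<longrightarrow> \<Psi> (f z) = z)" if p: "p \<in> \<Omega>2" for p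
  proof -
    obtain \<epsilon> \<Psi> where \<epsilon>: "\<epsilon> > 0" "ball p \<epsilon> \<subseteq> \<Omega>2" "holomorphic_map_on \<Psi> (ball p \<epsilon>)"
      and \<Psi>: "\<And>w. w \<in> ball p \<epsilon> \<inter> regular_values \<Longrightarrow> \<Psi> w = g w"
      using local_extension[OF p] by blast
    define U where "U = \<Omega>1 \<inter> f -` ball p \<epsilon>"
    have U: "open U" unfolding U_def by (rule continuous_open_preimage[OF cont open1 open_ball])
    have "continuous_on U (\<lambda>z. \<Psi> (f z))"
      by (rule continuous_on_compose2[OF holomorphic_map_on_continuous_on[OF \<epsilon>(3)]
            continuous_on_subset[OF cont]]) (auto simp: U_def)
    then have "open (U \<inter> (\<lambda>z. \<Psi> (f z) - z) -` (- {0}))"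
      by (intro continuous_open_preimage[OF _ U] continuous_intros) auto
    moreover have "(U \<inter> (\<lambda>z. \<Psi> (f z) - z) -` (- {0})) \<inter> regular = {}"
      using \<Psi> g_f regular_values_eq unfolding U_def by auto
    ultimately have "U \<inter> (\<lambda>z. \<Psi> (f z) - z) -` (- {0}) = {}"
      using regular_dense unfolding U_def by blast
    then have "\<forall>z\<in>\<Omega>1. f z \<in> ball p \<epsilon> \<longrightarrow> \<Psi> (f z) = z" unfolding U_def by auto
    then show ?thesis using \<epsilon> by blast
  qed
  have inj: "inj_on f \<Omega>1"
  proof (rule inj_onI)
    fix z z' assume z: "z \<in> \<Omega>1" "z' \<in> \<Omega>1" "f z = f z'"
    obtain \<epsilon> \<Psi> where "\<epsilon> > 0" "\<forall>z\<in>\<Omega>1. f z \<in> ball (f z') \<epsilon> \<longrightarrow> \<Psi> (f z) = z"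
      using local[OF f_mem[OF z(2)]] by blast
    then show "z = z'" using z by (metis centre_in_ball)
  qed
  have "holomorphic_map_on (inv_into \<Omega>1 f) \<Omega>2"
  proof (rule holomorphic_map_onI)
    fix p assume p: "p \<in> \<Omega>2"
    obtain \<epsilon> \<Psi> where \<epsilon>: "\<epsilon> > 0" "ball p \<epsilon> \<subseteq> \<Omega>2" "holomorphic_map_on \<Psi> (ball p \<epsilon>)"
      and \<Psi>: "\<And>z. z \<in> \<Omega>1 \<Longrightarrow> f z \<in> ball p \<epsilon> \<Longrightarrow> \<Psi> (f z) = z"
      using local[OF p] by blast
    have pb: "p \<in> ball p \<epsilon>" using \<epsilon> by simp
    have "\<Psi> w = inv_into \<Omega>1 f w" if w: "w \<in> ball p \<epsilon>" for w
      using \<Psi>[OF g_in[of w]] f_g[of w] w \<epsilon>(2) unfolding g_def by auto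
    from has_derivative_transform_within_open[OF holomorphic_map_onD(1)[OF \<epsilon>(3) pb] open_ball pb this]
    show "\<exists>f'. (inv_into \<Omega>1 f has_derivative f') (at p) \<and> (\<forall>c v. f' (c *s v) = c *s f' v)"
      using holomorphic_map_onD(2)[OF \<epsilon>(3) pb] by blast
  qed
  then show ?thesis
    using inj surjective hol by (simp add: biholomorphism_def bij_betw_def)
qed

end

end

section \<open>Sufficiency\<close>

lemma (in bergman_domain) open_kernel_nonzero:
  assumes z: "z \<in> \<Omega>"
  shows "open {\<xi> \<in> \<Omega>. K z \<xi> \<noteq> 0}"
  by (rule open_Collect_nonzero[OF open_dom continuous_on_kernel_right[OF z]])

lemma (in bergman_domain) continuous_on_score:
  assumes z: "z \<in> \<Omega>"
  shows "continuous_on {\<xi> \<in> \<Omega>. K z \<xi> \<noteq> 0} (score z v)"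
  unfolding score_def[abs_def]
  by (intro continuous_intros continuous_on_subset[OF continuous_on_DK[OF z]]
      continuous_on_subset[OF continuous_on_kernel_right[OF z]]) auto

lemma negligible_if_AE_lborel:
  assumes "AE x in lborel. P x"
  shows "negligible {x. \<not> P x}"
proof -
  have "\<exists>N\<in>null_sets lborel. {x. \<not> P x} \<subseteq> N"
    by (rule AE_E3[OF assms]) auto
  then obtain N where N: "N \<in> null_sets lborel" "{x. \<not> P x} \<subseteq> N" by blast
  have "negligible N"
    using null_sets_completionI[OF N(1)] by (simp add: negligible_iff_null_sets)
  then show ?thesis using N(2) by (rule negligible_subset)
qed

locale proper_holomorphic_bergman = proper_holomorphic_map + bergman_domain \<Omega>1
begin

lemma measurable_f: "f \<in> measurable (dV \<Omega>1) (dV \<Omega>2)"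
  using borel_measurable_dV[OF cont] f_mem unfolding dV_def[of \<Omega>2]
  by (intro measurable_restrict_space2) auto

text \<open>The equation \<open>score = e \<circ> f\<close> may fail at \<open>\<xi>\<close> and
  \<open>\<eta>\<close> themselves. It is used instead at nearby points \<open>a\<close> and
  \<open>b\<close> with \<open>f a = f b\<close> outside the exceptional null set, and continuity of
  the score leads back.\<close>

lemma inj_on_regular_if_sufficient:
  assumes suff: "sufficient_for \<Omega>1 (bergman_model \<Omega>1) (bergman_model_deriv \<Omega>1) (dV \<Omega>2) f"
  shows "inj_on f regular"
proof (rule inj_onI)
  fix \<xi> \<eta> assume \<xi>: "\<xi> \<in> regular" and \<eta>: "\<eta> \<in> regular" and eq: "f \<xi> = f \<eta>"
  have O: "\<xi> \<in> \<Omega>1" "\<eta> \<in> \<Omega>1" using \<xi> \<eta> regular_subset by auto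
  show "\<xi> = \<eta>"
  proof (rule eq_if_score_eq[OF O], rule ccontr)
    fix z v assume z: "z \<in> \<Omega>1" and n: "K z \<xi> \<noteq> 0" "K z \<eta> \<noteq> 0" and ne: "score z v \<xi> \<noteq> score z v \<eta>"
    obtain e where "AE \<xi> in dV \<Omega>1. K z \<xi> \<noteq> 0 \<longrightarrow> score z v \<xi> = e (f \<xi>)"
      using suff bergman_sufficient_iff[OF measurable_f] z by blast
    then have "AE \<xi> in lborel. \<xi> \<in> \<Omega>1 \<longrightarrow> K z \<xi> \<noteq> 0 \<longrightarrow> score z v \<xi> = e (f \<xi>)"
      unfolding dV_def using open_dom by (subst (asm) AE_restrict_space_iff) auto
    from negligible_if_AE_lborel[OF this]
    have N: "negligible {\<xi>. \<not> (\<xi> \<in> \<Omega>1 \<longrightarrow> K z \<xi> \<noteq> 0 \<longrightarrow> score z v \<xi> = e (f \<xi>))}" (is "negligible ?N") .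
    \<comment> \<open>Half the distance between the two scores, so that neighbourhoods with
      oscillation below \<open>\<delta>\<close> cannot share a score.\<close>
    define \<delta> where "\<delta> = dist (score z v \<xi>) (score z v \<eta>) / 2"
    have \<delta>: "0 < \<delta>" using ne by (simp add: \<delta>_def)
    define U where "U = (\<lambda>\<zeta>. {a \<in> \<Omega>1. K z a \<noteq> 0} \<inter> score z v -` ball (score z v \<zeta>) \<delta>)"
    have U: "open (U \<zeta>)" "U \<zeta> \<subseteq> \<Omega>1" for \<zeta>
      unfolding U_def using continuous_on_score[OF z] open_kernel_nonzero[OF z]
      by (auto intro: continuous_open_preimage)
    have mem: "\<xi> \<in> U \<xi>" "\<eta> \<in> U \<eta>" using O n \<delta> by (auto simp: U_def)
    obtain a b where a: "a \<in> U \<xi> - ?N" and b: "b \<in> U \<eta> - ?N" and ab: "f a = f b"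
      using common_value_avoiding_negligible[OF \<xi> \<eta> eq U(1) mem(1) U(2) U(1) mem(2) U(2) N] by blast
    have "score z v a = e (f a)" "score z v b = e (f b)" using a b by (auto simp: U_def)
    then have "score z v a = score z v b" using ab by simp
    moreover have "dist (score z v \<xi>) (score z v a) < \<delta>" "dist (score z v \<eta>) (score z v b) < \<delta>"
      using a b by (auto simp: U_def)
    ultimately have "dist (score z v \<xi>) (score z v \<eta>) < \<delta> + \<delta>"
      using dist_triangle2[of "score z v \<xi>" "score z v \<eta>" "score z v a"] by simp
    then show False by (simp add: \<delta>_def)
  qed
qed

text \<open>Composing a score with the inverse of \<open>f\<close> gives \<open>e\<close>, which is
  measurable because the inverse is continuous.\<close>

lemma sufficient_if_biholomorphism:
  assumes bih: "biholomorphism \<Omega>1 \<Omega>2 f"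
  shows "sufficient_for \<Omega>1 (bergman_model \<Omega>1) (bergman_model_deriv \<Omega>1) (dV \<Omega>2) f"
  unfolding bergman_sufficient_iff[OF measurable_f]
proof (intro ballI allI)
  fix z v assume z: "z \<in> \<Omega>1"
  interpret two: bergman_domain \<Omega>2 by unfold_locales (rule dom2)
  let ?g = "inv_into \<Omega>1 f"
  have bij: "bij_betw f \<Omega>1 \<Omega>2" and "holomorphic_map_on ?g \<Omega>2"
    using bih by (auto simp: biholomorphism_def)
  then have "?g \<in> borel_measurable (dV \<Omega>2)"
    by (intro two.borel_measurable_dV holomorphic_map_on_continuous_on)
  moreover have "?g w \<in> \<Omega>1" if "w \<in> \<Omega>2" for w
    using that bij_betw_apply[OF bij_betw_inv_into[OF bij]] by blast
  ultimately have "?g \<in> measurable (dV \<Omega>2) (dV \<Omega>1)"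
    unfolding dV_def[of \<Omega>1] by (intro measurable_restrict_space2) auto
  then have "(\<lambda>w. score z v (?g w)) \<in> borel_measurable (dV \<Omega>2)"
    using measurable_kernel(3)[OF z] by (rule measurable_compose)
  moreover have "AE \<xi> in dV \<Omega>1. K z \<xi> \<noteq> 0 \<longrightarrow> score z v \<xi> = score z v (?g (f \<xi>))"
    using bij by (intro AE_I2) (simp add: bij_betw_def)
  ultimately show "\<exists>e\<in>borel_measurable (dV \<Omega>2). AE \<xi> in dV \<Omega>1. K z \<xi> \<noteq> 0 \<longrightarrow> score z v \<xi> = e (f \<xi>)"
    by (intro bexI[of _ "\<lambda>w. score z v (?g w)"])
qed

end

theorem corollary4p8:
  fixes \<Omega>1 \<Omega>2 :: "(complex ^ 'n::finite) set"
    and f :: "complex ^ 'n \<Rightarrow> complex ^ 'n"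
  assumes "bounded_domain \<Omega>1" and "bounded_domain \<Omega>2"
    and "f \<in> \<Omega>1 \<rightarrow> \<Omega>2"
    and "holomorphic_map_on f \<Omega>1"
    and "proper_map (top_of_set \<Omega>1) (top_of_set \<Omega>2) f"
  shows "biholomorphism \<Omega>1 \<Omega>2 f \<longleftrightarrow>
    sufficient_for \<Omega>1 (bergman_model \<Omega>1) (bergman_model_deriv \<Omega>1) (dV \<Omega>2) f"
proof -
  interpret proper_holomorphic_bergman \<Omega>1 \<Omega>2 f
    using assms by unfold_locales
  show ?thesis
    using sufficient_if_biholomorphism biholomorphism_if_inj_regular inj_on_regular_if_sufficient
    by blast
qed

end
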